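(* Let $K\in\mathbb{R}$ and let $D$ be a convex compact domain in $\mathbb{X}_K$ with $C^1$ boundary $\partial D$ of length $L_K(\partial D)$. Let $f\in C^1(\mathbb{R};\mathbb{R})$. Then $$\int_{\mathcal{G}^K_{D}}(f\circ\rho_K)\,\mathrm{d}\mu_K=\int_{\mathcal{G}^K_{D}}(f'\circ\rho_K)\,\sin_K(\rho_K)\,\cot\alpha_1\cot\alpha_2\,\mathrm{d}\mu_K+f(0)L_K(\partial D).$$ Moreover, if $f(0)=0$, one has the $\mathbb{X}_K$ version of the Pleijel identity: $$\int_{\mathcal{G}^K_{D}}(f\circ\rho_K)\,\mathrm{d}\mu_K=\int_{\mathcal{G}^K_{D}}(f'\circ\rho_K)\,\sin_K(\rho_K)\,\cot\alpha_1\cot\alpha_2\,\mathrm{d}\mu_K.$$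
   Context: $\mathbb{X}_K$ is the maximally symmetric, simply connected, 2-dimensional Riemannian manifold of constant sectional curvature $K$ (sphere of radius $1/\sqrt K$ if $K>0$, Euclidean plane if $K=0$, rescaled hyperbolic plane if $K<0$). The function $\sin_K$ is $\sin_K(x)=\frac{1}{\sqrt K}\sin(\sqrt K x)$ if $K>0$, $\sin_K(x)=x$ if $K=0$, $\sin_K(x)=\frac{1}{\sqrt{-K}}\sinh(\sqrt{-K}x)$ if $K<0$. $\mathcal{G}^K$ is the set of unoriented complete geodesics of $\mathbb{X}_K$ (great circles if $K>0$), and $\mu_K$ is the isometry-invariant measure on $\mathcal{G}^K$ normalized so that, locally, near a geodesic crossing a given geodesic segment, $\mathrm{d}\mu_K=\sin\alpha\,\mathrm{d}l\,\mathrm{d}\alpha$, where $l$ is the arclength position of the crossing point and $\alpha\in(0,\pi)$ the crossing angle. $\mathcal{G}^K_D\subset\mathcal{G}^K$ is the set of geodesics intersecting $D$; for $\gamma\in\mathcal{G}^K_D$ the chord is $\gamma\cap D$ and $\rho_K(\gamma)$ is its length. $\alpha_1(\gamma),\alpha_2(\gamma)$ are the two angles between the boundary $\partial D$ and the chord of $\gamma$, at the two endpoints of the chord, lying on the same side of $\gamma$ (the product $\cot\alpha_1\cot\alpha_2$ does not depend on the choice of side).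
   Formalization: The boundary of D is additionally required to contain no geodesic segment (strict convexity), and for K>0 D contains no antipodal points; the identity fails for a planar stadium with f(x)=x, where flat sides of length a add a²/2 each, and for closed hemispheres. *)

theory Defs
  imports "HOL-Analysis.Analysis"
begin

definition sinK :: "real \<Rightarrow> real \<Rightarrow> real" where
  "sinK K x = (if K > 0 then sin (sqrt K * x) / sqrt K
               else if K = 0 then x
               else sinh (sqrt (- K) * x) / sqrt (- K))"

definition cosK :: "real \<Rightarrow> real \<Rightarrow> real" where
  "cosK K x = (if K > 0 then cos (sqrt K * x)
               else if K = 0 then 1
               else cosh (sqrt (- K) * x))"

(* The surface of curvature K is modelled in real^3, with Riemannian metric the restriction to
   tangent vectors of the bilinear form qform K: Euclidean for K > 0, Minkowskian for K < 0, and
   for K = 0 (sgn 0 = 0) the standard scalar product of the horizontal plane at height 1. *)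
definition qform :: "real \<Rightarrow> real^3 \<Rightarrow> real^3 \<Rightarrow> real" where
  "qform K v w = v $ 1 * w $ 1 + v $ 2 * w $ 2 + sgn K * (v $ 3 * w $ 3)"

definition space_form :: "real \<Rightarrow> (real^3) set" where
  "space_form K = (if K > 0 then sphere 0 (1 / sqrt K)
                   else if K = 0 then {p. p $ 3 = 1}
                   else {p. qform K p p = 1 / K \<and> p $ 3 > 0})"

definition tangent :: "real \<Rightarrow> real^3 \<Rightarrow> real^3 \<Rightarrow> bool" where
  "tangent K p v \<longleftrightarrow> p \<in> space_form K \<and> (if K = 0 then v $ 3 = 0 else qform K p v = 0)"

definition unit_tangent :: "real \<Rightarrow> real^3 \<Rightarrow> real^3 \<Rightarrow> bool" where
  "unit_tangent K p v \<longleftrightarrow> tangent K p v \<and> qform K v v = 1"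

definition orthonormal_frame :: "real \<Rightarrow> real^3 \<Rightarrow> real^3 \<Rightarrow> real^3 \<Rightarrow> bool" where
  "orthonormal_frame K p v n \<longleftrightarrow> unit_tangent K p v \<and> unit_tangent K p n \<and> qform K v n = 0"

(* The unit speed geodesic with initial point p and initial velocity v, and its velocity;
   the derivative of cosK K is - K * sinK K. *)
definition geod :: "real \<Rightarrow> real^3 \<Rightarrow> real^3 \<Rightarrow> real \<Rightarrow> real^3" where
  "geod K p v s = cosK K s *\<^sub>R p + sinK K s *\<^sub>R v"

definition geod_vel :: "real \<Rightarrow> real^3 \<Rightarrow> real^3 \<Rightarrow> real \<Rightarrow> real^3" where
  "geod_vel K p v s = (- K * sinK K s) *\<^sub>R p + cosK K s *\<^sub>R v"

definition geodesic_line :: "real \<Rightarrow> real^3 \<Rightarrow> real^3 \<Rightarrow> (real^3) set" where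
  "geodesic_line K p v = range (geod K p v)"

definition geodesics :: "real \<Rightarrow> (real^3) set set" where
  "geodesics K = {geodesic_line K p v | p v. unit_tangent K p v}"

definition geodesics_meeting :: "real \<Rightarrow> (real^3) set \<Rightarrow> (real^3) set set" where
  "geodesics_meeting K D = {\<gamma> \<in> geodesics K. \<gamma> \<inter> D \<noteq> {}}"

definition distK :: "real \<Rightarrow> real^3 \<Rightarrow> real^3 \<Rightarrow> real" where
  "distK K p q = Inf {s. 0 \<le> s \<and> (\<exists>v. unit_tangent K p v \<and> geod K p v s = q)}"

definition isometryK :: "real \<Rightarrow> (real^3 \<Rightarrow> real^3) \<Rightarrow> bool" where
  "isometryK K \<phi> \<longleftrightarrow> bij_betw \<phi> (space_form K) (space_form K) \<and>
     (\<forall>p \<in> space_form K. \<forall>q \<in> space_form K. distK K (\<phi> p) (\<phi> q) = distK K p q)"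

(* Borel sets of geodesics, the set of geodesics being a quotient of the unit tangent bundle. *)
definition borel_geodesic_sets :: "real \<Rightarrow> (real^3) set set set" where
  "borel_geodesic_sets K = {A. A \<subseteq> geodesics K \<and>
     {(p, v). unit_tangent K p v \<and> geodesic_line K p v \<in> A} \<in> sets borel}"

(* The geodesic crossing geod K p v at arclength position l with angle a. The vector n normal to
   v at p is normal to geod K p v at every point: in this model the parallel transport of n along
   geod K p v is constant. *)
definition crossing_geodesic ::
    "real \<Rightarrow> real^3 \<Rightarrow> real^3 \<Rightarrow> real^3 \<Rightarrow> real \<times> real \<Rightarrow> (real^3) set" where
  "crossing_geodesic K p v n = (\<lambda>(l, a).
     geodesic_line K (geod K p v l) (cos a *\<^sub>R geod_vel K p v l + sin a *\<^sub>R n))"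

(* The last conjunct says that the measure is sin a dl da in the coordinates (l, a) on the set of
   geodesics crossing a geodesic segment of length m. For m \<le> pi / sqrt K, where K > 0, no other
   great circle crosses the open segment twice, so these coordinates are injective. *)
definition invariant_geodesic_measure :: "real \<Rightarrow> (real^3) set measure \<Rightarrow> bool" where
  "invariant_geodesic_measure K \<mu> \<longleftrightarrow>
     space \<mu> = geodesics K \<and> sets \<mu> = borel_geodesic_sets K \<and>
     (\<forall>\<phi> A. isometryK K \<phi> \<and> A \<in> sets \<mu> \<longrightarrow>
        (\<lambda>\<gamma>. \<phi> ` \<gamma>) ` A \<in> sets \<mu> \<and> emeasure \<mu> ((\<lambda>\<gamma>. \<phi> ` \<gamma>) ` A) = emeasure \<mu> A) \<and>
     (\<forall>p v n m A.
        orthonormal_frame K p v n \<and> 0 < m \<and> (K > 0 \<longrightarrow> m \<le> pi / sqrt K) \<and>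
        A \<in> sets \<mu> \<and> A \<subseteq> crossing_geodesic K p v n ` ({0<..<m} \<times> {0<..<pi}) \<longrightarrow>
        emeasure \<mu> A =
          (\<integral>\<^sup>+ x \<in> {0<..<m} \<times> {0<..<pi}.
             ennreal (sin (snd x)) * indicator A (crossing_geodesic K p v n x) \<partial>lborel))"

definition minimizing_segment :: "real \<Rightarrow> real^3 \<Rightarrow> real^3 \<Rightarrow> (real^3) set \<Rightarrow> bool" where
  "minimizing_segment K p q S \<longleftrightarrow>
     (\<exists>v. unit_tangent K p v \<and> geod K p v (distK K p q) = q \<and> S = geod K p v ` {0..distK K p q})"

(* Uniqueness of the minimizing segment matters only for K > 0: it excludes sets containing a pair
   of antipodal points, such as closed hemispheres. *)
definition geodesically_convex :: "real \<Rightarrow> (real^3) set \<Rightarrow> bool" where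
  "geodesically_convex K D \<longleftrightarrow> D \<subseteq> space_form K \<and>
     (\<forall>p \<in> D. \<forall>q \<in> D. (\<exists>!S. minimizing_segment K p q S) \<and>
        (\<forall>S. minimizing_segment K p q S \<longrightarrow> S \<subseteq> D))"

definition convex_compact_domain :: "real \<Rightarrow> (real^3) set \<Rightarrow> bool" where
  "convex_compact_domain K D \<longleftrightarrow> compact D \<and> geodesically_convex K D \<and>
     (top_of_set (space_form K)) interior_of D \<noteq> {}"

definition boundaryK :: "real \<Rightarrow> (real^3) set \<Rightarrow> (real^3) set" where
  "boundaryK K D = (top_of_set (space_form K)) frontier_of D"

(* A side of length a in the boundary lies on one geodesic, hence is not seen by the measure, but
   changes the right-hand side of the Pleijel identity by (integral of f over {0..a}) - a * f 0. *)
definition contains_no_geodesic_segment :: "real \<Rightarrow> (real^3) set \<Rightarrow> bool" where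
  "contains_no_geodesic_segment K B \<longleftrightarrow>
     (\<forall>p v r. unit_tangent K p v \<and> 0 < r \<longrightarrow> \<not> geod K p v ` {0..r} \<subseteq> B)"

(* c is a regular C1 parametrization, with period T, of the simple closed curve B *)
definition C1_closed_curve_param ::
    "(real^3) set \<Rightarrow> (real \<Rightarrow> real^3) \<Rightarrow> real \<Rightarrow> bool" where
  "C1_closed_curve_param B c T \<longleftrightarrow>
     0 < T \<and> (\<forall>s. c (s + T) = c s) \<and> inj_on c {0..<T} \<and> c ` {0..<T} = B \<and>
     c C1_differentiable_on UNIV \<and> (\<forall>s. vector_derivative c (at s) \<noteq> 0)"

definition curve_length :: "real \<Rightarrow> (real \<Rightarrow> real^3) \<Rightarrow> real \<Rightarrow> real" where
  "curve_length K c T = integral {0..T}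
     (\<lambda>s. sqrt (qform K (vector_derivative c (at s)) (vector_derivative c (at s))))"

(* The chord cut out by D on g is the geodesic segment of length r which starts at p with unit
   tangent v; for K > 0 the bound on r makes the segment a proper arc of the great circle. *)
definition is_chord ::
    "real \<Rightarrow> (real^3) set \<Rightarrow> (real^3) set \<Rightarrow> real^3 \<Rightarrow> real^3 \<Rightarrow> real \<Rightarrow> bool" where
  "is_chord K D g p v r \<longleftrightarrow> unit_tangent K p v \<and> g = geodesic_line K p v \<and>
     0 \<le> r \<and> (K > 0 \<longrightarrow> r < 2 * pi / sqrt K) \<and> g \<inter> D = geod K p v ` {0..r}"

definition chord_length :: "real \<Rightarrow> (real^3) set \<Rightarrow> (real^3) set \<Rightarrow> real" where
  "chord_length K D g = (THE r. \<exists>p v. is_chord K D g p v r)"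

definition curve_direction :: "real \<Rightarrow> (real \<Rightarrow> real^3) \<Rightarrow> real^3 \<Rightarrow> real^3 \<Rightarrow> bool" where
  "curve_direction K c q w \<longleftrightarrow>
     (\<exists>s k. c s = q \<and> w = k *\<^sub>R vector_derivative c (at s)) \<and> qform K w w = 1"

definition angleK :: "real \<Rightarrow> real^3 \<Rightarrow> real^3 \<Rightarrow> real" where
  "angleK K u w = arccos (qform K u w / (sqrt (qform K u u) * sqrt (qform K w w)))"

(* a and b are the angles between the boundary, parametrized by c, and the chord of g at the two
   endpoints of the chord, both on the side of g to which the normal n points. The second angle is
   measured from the direction pointing back along the chord. *)
definition chord_angles ::
    "real \<Rightarrow> (real^3) set \<Rightarrow> (real \<Rightarrow> real^3) \<Rightarrow> (real^3) set \<Rightarrow> real \<Rightarrow> real \<Rightarrow> bool" where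
  "chord_angles K D c g a b \<longleftrightarrow>
     (\<exists>p v r n w w'. is_chord K D g p v r \<and> 0 < r \<and> orthonormal_frame K p v n \<and>
        curve_direction K c p w \<and> qform K w n > 0 \<and>
        curve_direction K c (geod K p v r) w' \<and> qform K w' n > 0 \<and>
        a = angleK K v w \<and> b = angleK K (- geod_vel K p v r) w')"

end

theory Submission
  imports Defs
begin

text \<open>
  Chords of \<open>D\<close> are parametrized by the pairs \<open>s < t\<close> of parameters of their endpoints on the
  boundary curve. Write \<open>\<rho>(s, t)\<close> for the length of the chord. In these coordinates
  the invariant measure is \<open>\<partial>\<^sub>s\<partial>\<^sub>t\<rho> ds dt\<close>, and
  \<open>sin_K(\<rho>) cot \<alpha>\<^sub>1 cot \<alpha>\<^sub>2 \<partial>\<^sub>s\<partial>\<^sub>t\<rho> = - \<partial>\<^sub>s\<rho> \<partial>\<^sub>t\<rho>\<close>. Since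
  \<open>\<partial>\<^sub>t(f(\<rho>) \<partial>\<^sub>s\<rho>) = f'(\<rho>) \<partial>\<^sub>s\<rho> \<partial>\<^sub>t\<rho> + f(\<rho>) \<partial>\<^sub>s\<partial>\<^sub>t\<rho>\<close>, the difference of the two
  integrals is a boundary term, which comes from the diagonal, where \<open>\<rho> = 0\<close> and \<open>\<partial>\<^sub>s\<rho>\<close> tends to minus
  the speed of the curve. The mixed derivative exists although the curve is only \<open>C\<^sup>1\<close>.

  A geodesic is the intersection of the surface with a plane through the origin, so \<open>D\<close> is handled
  through the convex cone over it, and a normal vector of the plane provides coordinates in which the
  measure of a crossing segment and the chord measure are compared by a change of variables.
  Geodesics which meet \<open>D\<close> in a single point form a null set: all but finitely many points of
  a crossing segment lie on only finitely many of them.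
\<close>

section \<open>The functions sin_K and cos_K\<close>

text \<open>All signs of \<open>K\<close> are treated at once through the ambient squared chord
  \<open>Q = 4 * (sinK K (r / 2))\<^sup>2\<close>, a polynomial in the two endpoints; the distance
  and its sine are functions of \<open>Q\<close> alone. The mixed derivative asks for no second
  derivative of the curve because in \<open>rho1 s t\<close> the vector \<open>c' s\<close> stays
  fixed while \<open>t\<close> varies. A boundary without segments meets a line in at most two
  points. So a chord determines its pair of parameters, and the curve stays on one side of it in
  between, whence \<open>J\<close> is nonnegative. Integrability then follows from Tonelli and the
  fundamental theorem of calculus, without a pointwise bound near the diagonal. The iterated
  integral has a second boundary term, at \<open>t = T\<close>. It is the derivative in
  \<open>s\<close> of an antiderivative of \<open>f\<close> at \<open>rho s T\<close> and integrates
  to zero, since \<open>c 0 = c T\<close>. In the coordinates of the plane of conormals the weight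
  is \<open>(1 + K u^2 + z^2)^(-3/2)\<close>. Both parametrizations lead to it, because the conormal
  of a unit tangent vector has fixed length for the dual form, and the Jacobian of a central
  projection contributes a third power.\<close>

lemma sinK_0 [simp]: "sinK K 0 = 0" and cosK_0 [simp]: "cosK K 0 = 1"
  by (simp_all add: sinK_def cosK_def)

lemma sinK_minus [simp]: "sinK K (- x) = - sinK K x" and cosK_minus [simp]: "cosK K (- x) = cosK K x"
  by (simp_all add: sinK_def cosK_def)

lemma cosK_sinK_squared: "(cosK K x)\<^sup>2 + K * (sinK K x)\<^sup>2 = 1"
proof -
  consider "K > 0" | "K = 0" | "K < 0" by linarith
  then show ?thesis
  proof cases
    case 1
    then show ?thesis using sin_cos_squared_add[of "sqrt K * x"]
      by (simp add: sinK_def cosK_def power_divide algebra_simps)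
  next
    case 3
    then show ?thesis using hyperbolic_pythagoras[of "sqrt (-K) * x"]
      by (simp add: sinK_def cosK_def power_divide field_simps)
  qed (simp add: sinK_def cosK_def)
qed

lemma sinK_add: "sinK K (x + y) = sinK K x * cosK K y + cosK K x * sinK K y"
proof -
  consider "K > 0" | "K = 0" | "K < 0" by linarith
  then show ?thesis
    by cases (simp_all add: sinK_def cosK_def distrib_left sin_add sinh_add add_divide_distrib)
qed

lemma cosK_add: "cosK K (x + y) = cosK K x * cosK K y - K * sinK K x * sinK K y"
proof -
  consider "K > 0" | "K = 0" | "K < 0" by linarith
  then show ?thesis
    by cases (simp_all add: sinK_def cosK_def distrib_left cos_add cosh_add)
qed

lemma sinK_diff: "sinK K (x - y) = sinK K x * cosK K y - cosK K x * sinK K y"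
  using sinK_add[of K x "- y"] by simp

lemma cosK_diff: "cosK K (x - y) = cosK K x * cosK K y + K * sinK K x * sinK K y"
  using cosK_add[of K x "- y"] by simp

lemma sinK_double: "sinK K x = 2 * sinK K (x / 2) * cosK K (x / 2)"
  using sinK_add[of K "x/2" "x/2"] by simp

lemma cosK_double: "cosK K x = 1 - 2 * K * (sinK K (x / 2))\<^sup>2"
  using cosK_add[of K "x/2" "x/2"] cosK_sinK_squared[of K "x/2"] by (simp add: power2_eq_square)

lemma has_field_derivative_sinK: "(sinK K has_field_derivative cosK K x) (at x)"
proof -
  consider "K > 0" | "K = 0" | "K < 0" by linarith
  then show ?thesis
  proof cases
    case 1
    then have "sqrt K * sqrt K / K = 1" by simp
    then have "((\<lambda>x. sin (sqrt K * x) / sqrt K) has_field_derivative cos (sqrt K * x)) (at x)"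
      using 1 by (auto intro!: derivative_eq_intros simp: mult.assoc)
    with 1 show ?thesis by (simp add: sinK_def[abs_def] cosK_def)
  next
    case 3
    then have "sqrt (-K) * sqrt (-K) / K = -1" by simp
    then have "((\<lambda>x. sinh (sqrt (-K) * x) / sqrt (-K)) has_field_derivative cosh (sqrt (-K) * x)) (at x)"
      using 3 by (auto intro!: derivative_eq_intros simp: mult.assoc)
    with 3 show ?thesis by (simp add: sinK_def[abs_def] cosK_def)
  qed (simp add: sinK_def[abs_def] cosK_def)
qed

lemma has_field_derivative_cosK: "(cosK K has_field_derivative - K * sinK K x) (at x)"
proof -
  consider "K > 0" | "K = 0" | "K < 0" by linarith
  then show ?thesis
  proof cases
    case 1
    then have *: "K / sqrt K = sqrt K" by (simp add: real_div_sqrt)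
    have "((\<lambda>x. cos (sqrt K * x)) has_field_derivative - (K / sqrt K * sin (sqrt K * x))) (at x)"
      unfolding * by (auto intro!: derivative_eq_intros)
    with 1 show ?thesis by (simp add: cosK_def[abs_def] sinK_def)
  next
    case 3
    then have *: "- K / sqrt (-K) = sqrt (-K)" by (intro real_div_sqrt) simp
    have "((\<lambda>x. cosh (sqrt (-K) * x)) has_field_derivative - K / sqrt (-K) * sinh (sqrt (-K) * x)) (at x)"
      unfolding * by (auto intro!: derivative_eq_intros)
    with 3 show ?thesis by (simp add: cosK_def[abs_def] sinK_def)
  qed (simp add: cosK_def[abs_def] sinK_def)
qed

lemma isCont_sinK: "isCont (sinK K) x" and isCont_cosK: "isCont (cosK K) x"
  using has_field_derivative_sinK has_field_derivative_cosK DERIV_isCont by blast+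

lemma continuous_on_sinK [continuous_intros]:
    "continuous_on S g \<Longrightarrow> continuous_on S (\<lambda>x. sinK K (g x))"
  and continuous_on_cosK [continuous_intros]:
    "continuous_on S g \<Longrightarrow> continuous_on S (\<lambda>x. cosK K (g x))"
  by (auto intro: continuous_on_compose2[of UNIV] continuous_at_imp_continuous_on
      isCont_sinK isCont_cosK)

text \<open>For \<open>K > 0\<close>, smaller than half the length of a great circle.\<close>
definition short :: "real \<Rightarrow> real \<Rightarrow> bool" where
  "short K r \<longleftrightarrow> (K > 0 \<longrightarrow> r < pi / sqrt K)"

lemma short_mono: "short K r \<Longrightarrow> s \<le> r \<Longrightarrow> short K s"
  by (auto simp: short_def)

lemma sinK_pos: "0 < x \<Longrightarrow> short K x \<Longrightarrow> 0 < sinK K x"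
  by (auto simp: sinK_def short_def field_simps intro!: sin_gt_zero)

lemma cosK_pos: assumes "0 \<le> x" "short K (2 * x)" shows "0 < cosK K x"
proof -
  have "0 < cos (sqrt K * x)" if "K > 0"
    using that assms by (intro cos_gt_zero_pi) (auto simp: short_def field_simps
      intro: less_le_trans[of _ 0] simp del: pi_less_4)
  then show ?thesis by (auto simp: cosK_def)
qed

text \<open>The bound on \<open>2 * y\<close> keeps the interval below a quarter of a great circle,
  where the derivative \<open>cosK\<close> is positive.\<close>

lemma sinK_strict_mono:
  assumes "0 \<le> x" "x < y" "short K (2 * y)" shows "sinK K x < sinK K y"
proof -
  have "0 < cosK K z" if "x < z" "z < y" for z
    using that assms by (intro cosK_pos) (auto simp: short_def)
  then show ?thesis
    using DERIV_pos_imp_increasing_open[of x y "sinK K"] assms(2) has_field_derivative_sinK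
      continuous_on_sinK[of _ "\<lambda>x. x"] by (metis continuous_on_id)
qed

lemma sinK_inj:
  assumes "0 \<le> x" "0 \<le> y" "short K (2 * x)" "short K (2 * y)" "sinK K x = sinK K y" shows "x = y"
  using sinK_strict_mono[of x y K] sinK_strict_mono[of y x K] assms by force

definition arcsinK :: "real \<Rightarrow> real \<Rightarrow> real" where
  "arcsinK K y = (if K > 0 then arcsin (sqrt K * y) / sqrt K
               else if K = 0 then y
               else arsinh (sqrt (- K) * y) / sqrt (- K))"

lemma has_field_derivative_arcsinK:
  assumes "0 \<le> y" "K * y\<^sup>2 < 1"
  shows "(arcsinK K has_field_derivative 1 / sqrt (1 - K * y\<^sup>2)) (at y)"
proof -
  consider "K > 0" | "K = 0" | "K < 0" by linarith
  then show ?thesis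
  proof cases
    case 1
    then have "(sqrt K * y)\<^sup>2 < 1\<^sup>2" using assms by (simp add: power_mult_distrib)
    then have "sqrt K * y < 1" by (rule power2_less_imp_less) simp
    moreover have "-1 < sqrt K * y" using assms 1 by (auto intro: less_le_trans[of _ 0])
    ultimately have "((\<lambda>y. arcsin (sqrt K * y) / sqrt K) has_field_derivative
        1 / sqrt (1 - K * y\<^sup>2)) (at y)"
      using 1 by (auto simp: power_mult_distrib divide_simps intro!: derivative_eq_intros)
    with 1 show ?thesis by (simp add: arcsinK_def[abs_def])
  next
    case 3
    have "((\<lambda>y. arsinh (sqrt (-K) * y)) has_field_derivative
        1 / sqrt ((sqrt (-K) * y)\<^sup>2 + 1) * sqrt (-K)) (at y)"
      by (rule DERIV_chain2[OF arsinh_real_has_field_derivative]) (auto intro!: derivative_eq_intros)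
    from DERIV_cdivide[OF this, of "sqrt (-K)"]
    have "((\<lambda>y. arsinh (sqrt (-K) * y) / sqrt (-K)) has_field_derivative
        1 / sqrt (1 - K * y\<^sup>2)) (at y)"
      using 3 by (simp add: power_mult_distrib)
    with 3 show ?thesis by (simp add: arcsinK_def[abs_def])
  qed (simp add: arcsinK_def[abs_def])
qed

lemma sinK_arcsinK:
  assumes "0 \<le> y" "K * y\<^sup>2 < 1"
  shows "sinK K (arcsinK K y) = y" and "0 \<le> arcsinK K y" and "short K (2 * arcsinK K y)"
proof -
  have *: "sqrt K * y < 1" "-1 \<le> sqrt K * y" "0 \<le> sqrt K * y" if "K > 0"
  proof -
    have "(sqrt K * y)\<^sup>2 < 1\<^sup>2" using assms that by (simp add: power_mult_distrib)
    then show "sqrt K * y < 1" by (rule power2_less_imp_less) simp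
    show "0 \<le> sqrt K * y" using that assms by simp
    then show "-1 \<le> sqrt K * y" by linarith
  qed
  have "arcsin (sqrt K * y) < pi / 2" if "K > 0"
    using arcsin_lt_bounded[of "sqrt K * y"] * that by fastforce
  moreover have "0 \<le> arcsin (sqrt K * y)" if "K > 0"
    using arcsin_le_arcsin[of 0 "sqrt K * y"] * that by simp
  moreover have "0 \<le> arsinh (sqrt (-K) * y)" if "K < 0"
    using arsinh_real_neg_iff[of "sqrt (-K) * y"] that assms
    by (simp add: not_less[symmetric] mult_less_0_iff)
  ultimately show "sinK K (arcsinK K y) = y" "0 \<le> arcsinK K y" "short K (2 * arcsinK K y)"
    using * assms by (auto simp: sinK_def arcsinK_def short_def divide_strict_right_mono
        zero_le_divide_iff)
qed

lemma arcsinK_sinK: assumes "0 \<le> x" "short K (2 * x)" shows "arcsinK K (sinK K x) = x"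
proof -
  have "short K x" using assms by (auto intro: short_mono)
  then have "0 \<le> sinK K x" using sinK_pos[of x K] assms by (cases "x = 0") auto
  moreover have "K * (sinK K x)\<^sup>2 < 1"
    using cosK_sinK_squared[of K x] cosK_pos[OF assms] zero_less_power[of "cosK K x" 2] by linarith
  ultimately show ?thesis using sinK_arcsinK[of "sinK K x" K] assms by (metis sinK_inj)
qed


text \<open>Parametrizes the half \<open>b > 0\<close> of the curve \<open>a^2 + K b^2 = 1\<close>.
  For \<open>K > 0\<close> it is half an ellipse, and \<open>arccos\<close> yields a parameter below
  half a great circle. For \<open>K \<le> 0\<close> there are two branches, and \<open>a > 0\<close>
  selects the one traced by \<open>cosK\<close> and \<open>sinK\<close>.\<close>

lemma cosK_sinK_total:
  assumes "a\<^sup>2 + K * b\<^sup>2 = 1" "0 < b" "K \<le> 0 \<Longrightarrow> 0 < a"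
  obtains r where "0 < r" "short K r" "cosK K r = a" "sinK K r = b"
proof -
  consider "K > 0" | "K = 0" | "K < 0" by linarith
  then show thesis
  proof cases
    case 1
    have "1 - a\<^sup>2 = (sqrt K * b)\<^sup>2" using assms 1 by (simp add: power_mult_distrib)
    then have s: "sqrt (1 - a\<^sup>2) = sqrt K * b" using assms 1 by (simp add: real_sqrt_mult)
    have "a\<^sup>2 < 1" using assms 1 by (smt (verit) mult_pos_pos zero_less_power)
    then have a: "-1 < a" "a < 1" by (simp_all add: abs_square_less_1 abs_less_iff)
    have "0 < arccos a" "arccos a < pi" using a arccos_lt_bounded by auto
    with 1 a s show thesis
      by (intro that[of "arccos a / sqrt K"])
        (simp_all add: cosK_def sinK_def short_def sin_arccos divide_strict_right_mono)
  next
    case 2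
    then show thesis using assms by (intro that[of b]) (auto simp: cosK_def sinK_def short_def power2_eq_1_iff)
  next
    case 3
    have "(sqrt (- K) * b)\<^sup>2 + 1 = a\<^sup>2" using assms 3 by (simp add: power_mult_distrib)
    then have "cosh (arsinh (sqrt (-K) * b)) = a" using assms 3 by (simp add: cosh_arsinh_real)
    with 3 show thesis using assms
      by (intro that[of "arsinh (sqrt (-K) * b) / sqrt (-K)"]) (simp_all add: cosK_def sinK_def short_def)
  qed
qed

section \<open>Geodesics of the model surfaces\<close>

lemma qform_commute: "qform K x y = qform K y x"
  by (simp add: qform_def mult.commute)

lemma qform_linear:
  "qform K (x + y) z = qform K x z + qform K y z" "qform K z (x + y) = qform K z x + qform K z y"
  "qform K (x - y) z = qform K x z - qform K y z" "qform K z (x - y) = qform K z x - qform K z y"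
  "qform K (c *\<^sub>R x) z = c * qform K x z" "qform K z (c *\<^sub>R x) = c * qform K z x"
  "qform K (- x) z = - qform K x z" "qform K z (- x) = - qform K z x"
  by (simp_all add: qform_def algebra_simps)

lemma space_form_iff:
  "x \<in> space_form K \<longleftrightarrow> (if K = 0 then x $ 3 = 1 else qform K x x = 1 / K \<and> (K < 0 \<longrightarrow> x $ 3 > 0))"
proof -
  have "norm x = 1 / sqrt K \<longleftrightarrow> qform K x x = 1 / K" if "K > 0"
  proof -
    have "qform K x x = x \<bullet> x" using that by (simp add: qform_def inner_vec_def sum_3)
    moreover have "norm x = 1 / sqrt K \<longleftrightarrow> (norm x)\<^sup>2 = (1 / sqrt K)\<^sup>2"
      using that by (intro power2_eq_iff_nonneg[symmetric]) auto
    ultimately show ?thesis using that by (simp add: power2_norm_eq_inner power_divide)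
  qed
  then show ?thesis by (auto simp: space_form_def)
qed

text \<open>Two future-pointing timelike vectors: Cauchy-Schwarz for the horizontal parts, each of
  which is shorter than the third coordinate. It serves to tell the upper sheet of the hyperboloid
  from the lower one.\<close>

lemma space_form_qform_neg:
  assumes "K < 0" "x \<in> space_form K" "y \<in> space_form K" shows "qform K x y < 0"
proof -
  have "1 / K < 0" using assms by simp
  have *: "(z$1)\<^sup>2 + (z$2)\<^sup>2 < (z$3)\<^sup>2" "z$3 > 0" if "z \<in> space_form K" for z
  proof -
    have "(z$1)\<^sup>2 + (z$2)\<^sup>2 - (z$3)\<^sup>2 = 1 / K" "z$3 > 0"
      using assms(1) that by (auto simp: space_form_iff qform_def power2_eq_square)
    with \<open>1 / K < 0\<close> show "(z$1)\<^sup>2 + (z$2)\<^sup>2 < (z$3)\<^sup>2" "z$3 > 0" by linarith+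
  qed
  note x = *[OF assms(2)] and y = *[OF assms(3)]
  have "(x$1 * y$1 + x$2 * y$2)\<^sup>2 \<le> ((x$1)\<^sup>2 + (x$2)\<^sup>2) * ((y$1)\<^sup>2 + (y$2)\<^sup>2)"
    using zero_le_power2[of "x$1 * y$2 - x$2 * y$1"] by (simp add: power2_eq_square algebra_simps)
  also have "\<dots> < (x$3)\<^sup>2 * (y$3)\<^sup>2"
    by (rule mult_strict_mono[OF x(1) y(1)]) (simp_all add: x(2)[THEN less_imp_neq, symmetric])
  finally have "(x$1 * y$1 + x$2 * y$2)\<^sup>2 < (x$3 * y$3)\<^sup>2" by (simp add: power_mult_distrib)
  then have "x$1 * y$1 + x$2 * y$2 < x$3 * y$3"
    by (rule power2_less_imp_less) (simp add: x(2) y(2) less_imp_le)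
  with assms show ?thesis by (simp add: qform_def)
qed

lemma space_form_scaleR_eq:
  assumes "x \<in> space_form K" "a *\<^sub>R x \<in> space_form K" "0 < a" shows "a = 1"
  using assms power2_eq_1_iff[of a]
  by (auto simp: space_form_iff qform_linear power2_eq_square split: if_splits)

lemma space_form_nonzero: "x \<in> space_form K \<Longrightarrow> x \<noteq> 0"
  by (auto simp: space_form_iff qform_def split: if_splits)

lemma tangent_scaleR: "tangent K p v \<Longrightarrow> tangent K p (a *\<^sub>R v)"
  by (auto simp: tangent_def qform_linear split: if_splits)

lemma tangent_add: "tangent K p v \<Longrightarrow> tangent K p w \<Longrightarrow> tangent K p (v + w)"
  by (auto simp: tangent_def qform_linear split: if_splits)

lemma tangent_qform: "tangent K p v \<Longrightarrow> K * qform K p v = 0"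
  by (auto simp: tangent_def split: if_splits)

text \<open>The square of the Euclidean determinant of an orthonormal frame and its base point.\<close>
definition vol2 :: "real \<Rightarrow> real" where
  "vol2 K = (if K = 0 then 1 else 1 / \<bar>K\<bar>)"

lemma vol2_pos: "0 < vol2 K"
  by (simp add: vol2_def)

text \<open>The bracket is the Gram determinant of \<open>(c, d, a)\<close> against
  \<open>(c, d, b)\<close>, which equals the product of the two Euclidean determinants and of the
  determinant \<open>sgn K\<close> of the form; \<open>sgn K\<close> is its own inverse.\<close>

lemma gram_qform:
  assumes "K \<noteq> 0"
  shows "(cross3 c d \<bullet> a) * (cross3 c d \<bullet> b) = sgn K *
    (qform K c c * (qform K d d * qform K a b - qform K d b * qform K d a)
     - qform K c d * (qform K c d * qform K a b - qform K d b * qform K c a)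
     + qform K c b * (qform K c d * qform K d a - qform K d d * qform K c a))"
proof -
  consider "sgn K = 1" | "sgn K = -1" using assms by (metis linorder_neqE_linordered_idom sgn_1_neg sgn_1_pos)
  then show ?thesis
    by cases (simp_all add: qform_def cross3_simps)
qed

text \<open>Off the vertical axis, rotation about that axis moves the point horizontally along the
  surface, for every \<open>K\<close>; on the axis every horizontal vector is tangent.\<close>

lemma unit_tangent_exists: assumes "p \<in> space_form K" shows "\<exists>v. unit_tangent K p v"
proof (cases "p$1 = 0 \<and> p$2 = 0")
  case True
  then have "unit_tangent K p (vector [1, 0, 0])"
    using assms by (simp add: unit_tangent_def tangent_def qform_def)
  then show ?thesis by blast
next
  case False
  define r where "r = sqrt ((p$1)\<^sup>2 + (p$2)\<^sup>2)"
  have r: "r\<^sup>2 = (p$1)\<^sup>2 + (p$2)\<^sup>2" "r \<noteq> 0" using False by (auto simp: r_def sum_power2_eq_zero_iff)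
  have "(- p$2 / r) * (- p$2 / r) + (p$1 / r) * (p$1 / r) = ((p$1)\<^sup>2 + (p$2)\<^sup>2) / r\<^sup>2"
    by (simp add: power2_eq_square add_divide_distrib)
  also have "\<dots> = 1" using r(2) unfolding r(1)[symmetric] by simp
  finally have "unit_tangent K p (vector [- p$2 / r, p$1 / r, 0])"
    using assms by (simp add: unit_tangent_def tangent_def qform_def)
  then show ?thesis by blast
qed

lemma orthonormal_frame_exists: assumes "unit_tangent K p v" shows "\<exists>n. orthonormal_frame K p v n"
proof -
  define N where "N = cross3 p v"
  define s where "s = 1 / sqrt (vol2 K)"
  \<comment> \<open>The factor \<open>sgn K\<close> in the third coordinate turns Euclidean
    orthogonality to \<open>p\<close> and \<open>v\<close> into orthogonality for
    \<open>qform\<close>; for \<open>K = 0\<close> it makes the vector horizontal.\<close>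
  define n :: "real^3" where "n = vector [s * N$1, s * N$2, s * (sgn K * N$3)]"
  have Np: "N$1 * p$1 + N$2 * p$2 + N$3 * p$3 = 0" and Nv: "N$1 * v$1 + N$2 * v$2 + N$3 * v$3 = 0"
    by (simp_all add: N_def cross3_simps)
  have s: "s * s = 1 / vol2 K" using vol2_pos[of K] by (simp add: s_def)
  have "qform K n n = (N$1 * N$1 + N$2 * N$2 + sgn K ^ 3 * (N$3 * N$3)) * (s * s)"
    by (simp add: n_def qform_def algebra_simps power3_eq_cube)
  also have "\<dots> = 1"
  proof -
    consider "K > 0" | "K = 0" | "K < 0" by linarith
    then show ?thesis
    proof cases
      case 1
      have "N$1 * N$1 + N$2 * N$2 + N$3 * N$3 = qform K p p * qform K v v - (qform K p v)\<^sup>2"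
        using 1 by (simp add: N_def qform_def cross3_simps power2_eq_square)
      then show ?thesis using 1 assms
        by (auto simp: s vol2_def unit_tangent_def tangent_def space_form_iff)
    next
      case 2
      then show ?thesis using assms
        by (simp add: s vol2_def unit_tangent_def tangent_def space_form_iff N_def qform_def cross3_simps)
    next
      case 3
      have "- (N$1 * N$1 + N$2 * N$2 - N$3 * N$3) = qform K p p * qform K v v - (qform K p v)\<^sup>2"
        using 3 by (simp add: N_def qform_def cross3_simps power2_eq_square)
      then show ?thesis using 3 assms
        by (auto simp: s vol2_def unit_tangent_def tangent_def space_form_iff field_simps)
    qed
  qed
  finally have nn: "qform K n n = 1" .
  have sg: "sgn K * (sgn K * x) = x" if "K \<noteq> 0" for x :: real
    using that by (metis linorder_neqE_linordered_idom sgn_1_neg sgn_1_pos mult_1 mult_minus1 minus_minus)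
  have vn: "qform K v n = s * (v$1 * N$1 + v$2 * N$2 + sgn K * (sgn K * (v$3 * N$3)))"
    and pn: "qform K p n = s * (p$1 * N$1 + p$2 * N$2 + sgn K * (sgn K * (p$3 * N$3)))"
    by (simp_all add: n_def qform_def algebra_simps)
  show ?thesis
  proof (cases "K = 0")
    case True
    then show ?thesis using nn vn Nv assms
      by (intro exI[of _ n]) (simp add: orthonormal_frame_def unit_tangent_def tangent_def n_def mult.commute)
  next
    case False
    then show ?thesis using nn vn pn Nv Np assms
      by (intro exI[of _ n]) (simp add: orthonormal_frame_def unit_tangent_def tangent_def sg mult.commute)
  qed
qed

lemma frame_det_squared: assumes "orthonormal_frame K p v n" shows "(cross3 p v \<bullet> n)\<^sup>2 = vol2 K"
proof (cases "K = 0")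
  case True
  then have "cross3 p v \<bullet> n = v$1 * n$2 - v$2 * n$1"
    using assms by (simp add: orthonormal_frame_def unit_tangent_def tangent_def space_form_iff cross3_simps)
  then have "(cross3 p v \<bullet> n)\<^sup>2 = (v$1 * n$2 - v$2 * n$1)\<^sup>2" by simp
  also have "\<dots> = qform K v v * qform K n n - (qform K v n)\<^sup>2"
    using True by (simp add: qform_def power2_eq_square algebra_simps)
  finally have "(cross3 p v \<bullet> n)\<^sup>2 = qform K v v * qform K n n - (qform K v n)\<^sup>2" by simp
  moreover have "qform K v v = 1" "qform K n n = 1" "qform K v n = 0" "vol2 K = 1"
    using assms True by (simp_all add: orthonormal_frame_def unit_tangent_def vol2_def)
  ultimately show ?thesis by simp
next
  case False
  then have "qform K v v = 1" "qform K n n = 1" "qform K v n = 0" "qform K p p = 1 / K"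
    "qform K p v = 0" "qform K p n = 0"
    using assms by (simp_all add: orthonormal_frame_def unit_tangent_def tangent_def space_form_iff)
  with gram_qform[OF False, of p v n n] show ?thesis using False
    by (simp add: power2_eq_square vol2_def sgn_if)
qed

lemma frame_det_nonzero: "orthonormal_frame K p v n \<Longrightarrow> cross3 p v \<bullet> n \<noteq> 0"
  using frame_det_squared[of K p v n] vol2_pos[of K] by auto

text \<open>Cramer's rule; the determinant is nonzero by \<open>frame_det_nonzero\<close>.\<close>

lemma frame_expansion:
  assumes "orthonormal_frame K p v n" obtains a b e where "x = a *\<^sub>R p + b *\<^sub>R v + e *\<^sub>R n"
proof
  define d where "d = cross3 p v \<bullet> n"
  have d: "d \<noteq> 0" using frame_det_nonzero[OF assms] by (simp add: d_def)
  have "d *\<^sub>R x = (cross3 v n \<bullet> x) *\<^sub>R p + (cross3 n p \<bullet> x) *\<^sub>R v + (cross3 p v \<bullet> x) *\<^sub>R n"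
    by (simp add: d_def vec_eq_iff forall_3 cross3_simps)
  then have "(1 / d) *\<^sub>R (d *\<^sub>R x) = (1 / d) *\<^sub>R \<dots>" by simp
  then show "x = ((cross3 v n \<bullet> x) / d) *\<^sub>R p + ((cross3 n p \<bullet> x) / d) *\<^sub>R v + ((cross3 p v \<bullet> x) / d) *\<^sub>R n"
    using d by (simp add: scaleR_add_right)
qed

lemma cross3_frame: "cross3 p v \<bullet> (a *\<^sub>R p + b *\<^sub>R v + e *\<^sub>R n) = e * (cross3 p v \<bullet> n)"
  by (simp add: cross3_simps)

lemma orthonormal_frameD:
  assumes "orthonormal_frame K p v n"
  shows "unit_tangent K p v" "unit_tangent K p n" "tangent K p v" "tangent K p n" "p \<in> space_form K"
    and "qform K v v = 1" "qform K n n = 1" "qform K v n = 0" "qform K n v = 0"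
    and "K \<noteq> 0 \<Longrightarrow> qform K p v = 0" "K \<noteq> 0 \<Longrightarrow> qform K p n = 0"
    and "K \<noteq> 0 \<Longrightarrow> qform K v p = 0" "K \<noteq> 0 \<Longrightarrow> qform K n p = 0"
    and "K = 0 \<Longrightarrow> v $ 3 = 0" "K = 0 \<Longrightarrow> n $ 3 = 0"
  using assms by (auto simp: orthonormal_frame_def unit_tangent_def tangent_def
      qform_commute[of K n v] qform_commute[of K v p] qform_commute[of K n p])

lemma frame_tangent_expansion:
  assumes "orthonormal_frame K p v n" "tangent K p w"
  shows "w = qform K w v *\<^sub>R v + qform K w n *\<^sub>R n"
proof -
  obtain a b e where w: "w = a *\<^sub>R p + b *\<^sub>R v + e *\<^sub>R n" using frame_expansion[OF assms(1)] .
  note * = orthonormal_frameD[OF assms(1)]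
  have "a = 0"
  proof (cases "K = 0")
    case True
    then show ?thesis using assms(2) w * by (auto simp: tangent_def space_form_iff)
  next
    case False
    then have "qform K p w = a / K" using * by (simp add: w qform_linear space_form_iff)
    then show ?thesis using assms(2) False by (simp add: tangent_def)
  qed
  then have "w = b *\<^sub>R v + e *\<^sub>R n" using w by simp
  then show ?thesis using * by (simp add: qform_linear)
qed

lemma frame_qform:
  assumes "orthonormal_frame K p v n" "tangent K p w" "tangent K p w'"
  shows "qform K w w' = qform K w v * qform K w' v + qform K w n * qform K w' n"
  by (subst frame_tangent_expansion[OF assms(1,2)])
    (simp add: qform_linear qform_commute[of K v w'] qform_commute[of K n w'])

lemma tangent_qform_pos: assumes "tangent K p w" "w \<noteq> 0" shows "0 < qform K w w"
proof -
  have "p \<in> space_form K" using assms by (simp add: tangent_def)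
  then obtain v n where f: "orthonormal_frame K p v n"
    using unit_tangent_exists orthonormal_frame_exists by metis
  have "qform K w v \<noteq> 0 \<or> qform K w n \<noteq> 0"
    using frame_tangent_expansion[OF f assms(1)] assms(2) by auto
  then show ?thesis using frame_qform[OF f assms(1,1)]
    by (simp add: sum_squares_gt_zero_iff)
qed

text \<open>The squared chord in the ambient space, with the same formula for all \<open>K\<close>.
  On short arcs it determines the length, so lengths of different geodesics with common endpoints
  are compared through it.\<close>

lemma chord_qform: assumes "unit_tangent K p v"
  shows "qform K (geod K p v s - geod K p v t) (geod K p v s - geod K p v t) = 4 * (sinK K ((s - t) / 2))\<^sup>2"
proof -
  have v: "qform K v v = 1" "K * qform K p v = 0" "K * qform K p p = 1 \<or> K = 0" "K \<noteq> 0 \<longrightarrow> qform K p v = 0"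
    using assms by (auto simp: unit_tangent_def tangent_def space_form_iff split: if_splits)
  define A B where "A = cosK K s - cosK K t" and "B = sinK K s - sinK K t"
  have "geod K p v s - geod K p v t = A *\<^sub>R p + B *\<^sub>R v"
    by (simp add: geod_def A_def B_def algebra_simps)
  then have *: "qform K (geod K p v s - geod K p v t) (geod K p v s - geod K p v t)
     = A\<^sup>2 * qform K p p + 2 * A * B * qform K p v + B\<^sup>2"
    using v by (simp add: qform_linear qform_commute[of K v p] power2_eq_square algebra_simps)
  show ?thesis
  proof (cases "K = 0")
    case True
    then show ?thesis unfolding * A_def B_def by (simp add: cosK_def sinK_def power2_eq_square)
  next
    case False
    then have "K * (A\<^sup>2 * qform K p p + 2 * A * B * qform K p v + B\<^sup>2) = A\<^sup>2 + K * B\<^sup>2"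
      using v by (simp add: algebra_simps)
    also have "\<dots> = 2 - 2 * cosK K (s - t)"
      using cosK_sinK_squared[of K s] cosK_sinK_squared[of K t]
      by (simp add: A_def B_def cosK_diff power2_eq_square algebra_simps)
    also have "\<dots> = K * (4 * (sinK K ((s - t) / 2))\<^sup>2)" by (subst cosK_double) simp
    finally show ?thesis using False unfolding * by simp
  qed
qed

lemma geod_0 [simp]: "geod K p v 0 = p" and geod_vel_0 [simp]: "geod_vel K p v 0 = v"
  by (simp_all add: geod_def geod_vel_def)

lemma geod_minus: "geod K p (- v) s = geod K p v (- s)"
  by (simp add: geod_def)

lemma orthonormal_frame_geod:
  assumes "orthonormal_frame K p v n"
  shows "orthonormal_frame K (geod K p v s) (geod_vel K p v s) n"
proof -
  note * = orthonormal_frameD[OF assms]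
  show ?thesis
  proof (cases "K = 0")
    case True
    then show ?thesis using *
      by (simp add: orthonormal_frame_def unit_tangent_def tangent_def space_form_iff geod_def geod_vel_def
          cosK_def sinK_def)
  next
    case False
    then have pp: "qform K p p = 1 / K" using * by (simp add: space_form_iff)
    note cs = cosK_sinK_squared[of K s, unfolded power2_eq_square]
    have gg: "qform K (geod K p v s) (geod K p v s) = 1 / K"
    proof -
      have "qform K (geod K p v s) (geod K p v s) = cosK K s * cosK K s * qform K p p + sinK K s * sinK K s"
        using * False by (simp add: geod_def qform_linear)
      then have "K * qform K (geod K p v s) (geod K p v s) = 1"
        using pp cs False by (simp add: distrib_left)
      then show ?thesis using False by (simp add: field_simps)
    qed
    have gp: "qform K p (geod K p v s) = cosK K s / K" using * False pp by (simp add: geod_def qform_linear)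
    \<comment> \<open>On the lower sheet the negative of the point would lie on the upper one, and
      \<open>space_form_qform_neg\<close> would make \<open>cosK K s\<close> negative.\<close>
    have "0 < geod K p v s $ 3" if "K < 0"
    proof (rule ccontr)
      assume "\<not> 0 < geod K p v s $ 3"
      moreover have "geod K p v s $ 3 \<noteq> 0"
      proof
        assume "geod K p v s $ 3 = 0"
        then have "0 \<le> qform K (geod K p v s) (geod K p v s)" by (simp add: qform_def)
        with gg that show False by simp
      qed
      ultimately have "- geod K p v s \<in> space_form K" using gg that by (simp add: space_form_iff qform_linear)
      from space_form_qform_neg[OF that \<open>p \<in> space_form K\<close> this] have "cosK K s / K > 0" by (simp add: qform_linear gp)
      moreover have "cosK K s > 0" using that by (simp add: cosK_def)
      ultimately show False using that by (simp add: zero_less_divide_iff)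
    qed
    then have "geod K p v s \<in> space_form K" using gg False by (simp add: space_form_iff)
    moreover have "qform K (geod_vel K p v s) (geod_vel K p v s) = 1"
    proof -
      have "qform K (geod_vel K p v s) (geod_vel K p v s)
          = K * sinK K s * sinK K s * (K * qform K p p) + cosK K s * cosK K s"
        using * False by (simp add: geod_vel_def qform_linear)
      then show ?thesis using pp cs False by (simp add: algebra_simps)
    qed
    moreover have "qform K (geod K p v s) (geod_vel K p v s)
        = cosK K s * sinK K s * (qform K v v - K * qform K p p)"
      using *(10,12)[OF False] by (simp add: geod_def geod_vel_def qform_linear algebra_simps)
    then have "qform K (geod K p v s) (geod_vel K p v s) = 0" using *(6) pp False by simp
    moreover have "qform K (geod K p v s) n = 0" "qform K (geod_vel K p v s) n = 0"
      using *(8) *(11)[OF False] by (simp_all add: geod_def geod_vel_def qform_linear)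
    ultimately show ?thesis using *(7) False
      by (simp add: orthonormal_frame_def unit_tangent_def tangent_def)
  qed
qed

lemma unit_tangent_geod:
  assumes "unit_tangent K p v"
  shows "unit_tangent K (geod K p v s) (geod_vel K p v s)" and "geod K p v s \<in> space_form K"
proof -
  obtain n where "orthonormal_frame K p v n" using orthonormal_frame_exists[OF assms] by blast
  from orthonormal_frameD[OF orthonormal_frame_geod[OF this]]
  show "unit_tangent K (geod K p v s) (geod_vel K p v s)" "geod K p v s \<in> space_form K" by blast+
qed

lemma geod_geod: "geod K (geod K p v s) (geod_vel K p v s) t = geod K p v (s + t)"
  by (simp_all add: geod_def geod_vel_def sinK_add cosK_add algebra_simps)

lemma unit_tangent_minus: "unit_tangent K p v \<Longrightarrow> unit_tangent K p (- v)"
  by (auto simp: unit_tangent_def tangent_def qform_linear split: if_splits)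

text \<open>The plane spanned by \<open>p\<close> and \<open>v\<close> cuts the surface in the curve
  of \<open>cosK_sinK_total\<close>. For \<open>K \<le> 0\<close> the sign of \<open>a\<close> is
  fixed by the model: third coordinate 1, or the upper sheet.\<close>

lemma geod_total:
  assumes v: "unit_tangent K p v" and x: "a *\<^sub>R p + b *\<^sub>R v \<in> space_form K" and b: "0 < b"
  obtains r where "0 < r" "short K r" "cosK K r = a" "sinK K r = b"
proof -
  have *: "qform K v v = 1" "K \<noteq> 0 \<Longrightarrow> qform K p v = 0" "K \<noteq> 0 \<Longrightarrow> qform K v p = 0" "p \<in> space_form K"
    using v by (auto simp: unit_tangent_def tangent_def qform_commute[of K v p] split: if_splits)
  have "a\<^sup>2 + K * b\<^sup>2 = 1 \<and> (K \<le> 0 \<longrightarrow> 0 < a)"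
  proof (cases "K = 0")
    case True
    then have "a = 1" using x v by (simp add: space_form_iff unit_tangent_def tangent_def)
    with True show ?thesis by simp
  next
    case False
    then have pp: "qform K p p = 1 / K" using * by (simp add: space_form_iff)
    have "qform K (a *\<^sub>R p + b *\<^sub>R v) (a *\<^sub>R p + b *\<^sub>R v) = 1 / K" using x False by (simp add: space_form_iff)
    then have "a\<^sup>2 + K * b\<^sup>2 = 1"
      using * False pp by (simp add: qform_linear field_simps power2_eq_square)
    moreover have "0 < a" if "K < 0"
      using space_form_qform_neg[OF that \<open>p \<in> space_form K\<close> x] * that pp
      by (simp add: qform_linear divide_less_0_iff)
    ultimately show ?thesis using False by auto
  qed
  then show thesis using cosK_sinK_total[of a K b] b that by blast
qed

lemma space_form_minus: assumes "x \<in> space_form K" "- x \<in> space_form K" shows "K > 0"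
  using assms by (auto simp: space_form_iff split: if_splits)

lemma geod_half_circle: "K > 0 \<Longrightarrow> geod K p v (pi / sqrt K) = - p"
  by (simp add: geod_def cosK_def sinK_def)

lemma geodesic_line_eq:
  assumes v: "unit_tangent K p v"
  shows "geodesic_line K p v = {x \<in> space_form K. cross3 p v \<bullet> x = 0}"
proof (intro equalityI subsetI)
  fix x assume "x \<in> geodesic_line K p v"
  then obtain s where x: "x = geod K p v s" by (auto simp: geodesic_line_def)
  have "cross3 p v \<bullet> x = 0" by (simp add: x geod_def cross3_simps)
  then show "x \<in> {x \<in> space_form K. cross3 p v \<bullet> x = 0}"
    using unit_tangent_geod(2)[OF v, of s] x by simp
next
  fix x assume "x \<in> {x \<in> space_form K. cross3 p v \<bullet> x = 0}"
  then have x: "x \<in> space_form K" "cross3 p v \<bullet> x = 0" by auto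
  obtain n where f: "orthonormal_frame K p v n" using orthonormal_frame_exists[OF v] by blast
  obtain a b e where abe: "x = a *\<^sub>R p + b *\<^sub>R v + e *\<^sub>R n" using frame_expansion[OF f] .
  have "e = 0" using x(2) frame_det_nonzero[OF f] unfolding abe cross3_frame by simp
  with abe have ab: "x = a *\<^sub>R p + b *\<^sub>R v" by simp
  have p: "p \<in> space_form K" using v by (simp add: unit_tangent_def tangent_def)
  consider "b > 0" | "b < 0" | "b = 0" by linarith
  then show "x \<in> geodesic_line K p v"
  proof cases
    case 1
    then obtain r where "cosK K r = a" "sinK K r = b" using geod_total[OF v _ 1, of a] x ab by auto
    then have "x = geod K p v r" by (simp add: ab geod_def)
    then show ?thesis by (simp add: geodesic_line_def)
  next
    case 2
    then obtain r where "cosK K r = a" "sinK K r = - b"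
      using geod_total[OF unit_tangent_minus[OF v], of a "-b"] x ab by auto
    then have "x = geod K p v (- r)" by (simp add: ab geod_def)
    then show ?thesis by (simp add: geodesic_line_def)
  next
    \<comment> \<open>Only multiples of \<open>p\<close> are left: \<open>p\<close> itself and, for
      \<open>K > 0\<close>, its antipode, half a great circle away.\<close>
    case 3
    then have xa: "x = a *\<^sub>R p" using ab by simp
    have "a \<noteq> 0" using space_form_nonzero[OF x(1)] xa by auto
    then consider "a > 0" | "a < 0" by linarith
    then show ?thesis
    proof cases
      case 1
      then have "x = geod K p v 0" using space_form_scaleR_eq[OF p, of a] x xa by simp
      then show ?thesis unfolding geodesic_line_def by blast
    next
      case 2
      have "K \<noteq> 0" using 2 xa x p by (auto simp: space_form_iff)
      have "qform K x x = a\<^sup>2 * qform K p p" unfolding xa by (simp add: qform_linear power2_eq_square)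
      moreover have "qform K x x = 1 / K" "qform K p p = 1 / K" using x(1) p \<open>K \<noteq> 0\<close> by (simp_all add: space_form_iff)
      ultimately have "a\<^sup>2 = 1" using \<open>K \<noteq> 0\<close> by simp
      then have "a = - 1" using 2 by (simp add: power2_eq_1_iff)
      then have xp: "x = - p" using xa by simp
      then have "x = geod K p v (pi / sqrt K)" using geod_half_circle[of K p v] space_form_minus[OF p] x(1) by simp
      then show ?thesis unfolding geodesic_line_def by blast
    qed
  qed
qed

text \<open>Polar coordinates at \<open>p\<close>: the part of \<open>q\<close> in the span of
  \<open>v\<close> and \<open>n\<close> gives the direction, and it vanishes only for
  \<open>q = p\<close> and \<open>q = - p\<close>.\<close>

lemma geod_between:
  assumes p: "p \<in> space_form K" and q: "q \<in> space_form K" and "p \<noteq> q" "q \<noteq> - p"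
  obtains v r where "unit_tangent K p v" "0 < r" "short K r" "q = geod K p v r"
proof -
  obtain v n where f: "orthonormal_frame K p v n"
    using p unit_tangent_exists orthonormal_frame_exists by metis
  have v: "unit_tangent K p v" and n: "unit_tangent K p n" and vn: "qform K v n = 0" "qform K n v = 0"
    using orthonormal_frameD[OF f] by auto
  obtain a b e where abe: "q = a *\<^sub>R p + b *\<^sub>R v + e *\<^sub>R n" using frame_expansion[OF f] .
  define \<beta> where "\<beta> = sqrt (b\<^sup>2 + e\<^sup>2)"
  show thesis
  proof (cases "b = 0 \<and> e = 0")
    case True
    have qa: "q = a *\<^sub>R p" using True abe by simp
    have False
    proof (cases "K = 0")
      case True
      then have "a = 1" using p q qa by (simp add: space_form_iff)
      then show False using qa assms(3) by simp
    next
      case False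
      have "qform K q q = a\<^sup>2 * qform K p p" unfolding qa by (simp add: qform_linear power2_eq_square)
      moreover have "qform K q q = 1 / K" "qform K p p = 1 / K" using q p \<open>K \<noteq> 0\<close> by (simp_all add: space_form_iff)
      ultimately have "a\<^sup>2 = 1" using \<open>K \<noteq> 0\<close> by simp
      then have "a = 1 \<or> a = - 1" by (simp add: power2_eq_1_iff)
      then show False using qa assms(3,4) by auto
    qed
    then show ?thesis ..
  next
    case False
    then have b: "\<beta> > 0" "\<beta>\<^sup>2 = b\<^sup>2 + e\<^sup>2" by (auto simp: \<beta>_def sum_power2_gt_zero_iff)
    define v' where "v' = (b / \<beta>) *\<^sub>R v + (e / \<beta>) *\<^sub>R n"
    have "b / \<beta> * (b / \<beta>) + e / \<beta> * (e / \<beta>) = (b\<^sup>2 + e\<^sup>2) / \<beta>\<^sup>2"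
      by (simp add: power2_eq_square add_divide_distrib)
    also have "\<dots> = 1" using b(1) unfolding b(2)[symmetric] by simp
    finally have "qform K v' v' = 1"
      using v n vn by (simp add: v'_def qform_linear unit_tangent_def)
    moreover have "tangent K p v'" using v n
      by (auto simp: v'_def unit_tangent_def intro!: tangent_add tangent_scaleR)
    ultimately have v': "unit_tangent K p v'" by (simp add: unit_tangent_def)
    have qv: "q = a *\<^sub>R p + \<beta> *\<^sub>R v'" using abe b by (simp add: v'_def scaleR_add_right)
    obtain r where "0 < r" "short K r" "cosK K r = a" "sinK K r = \<beta>"
      using geod_total[OF v', of a \<beta>] q qv b by auto
    then show ?thesis using that[OF v'] qv by (simp add: geod_def)
  qed
qed

section \<open>Convex domains\<close>

lemma sinK_nonneg: "0 \<le> x \<Longrightarrow> short K x \<Longrightarrow> 0 \<le> sinK K x"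
  using sinK_pos[of x K] by (cases "x = 0") auto

lemma chord_qform_0: "unit_tangent K p v \<Longrightarrow>
    qform K (p - geod K p v r) (p - geod K p v r) = 4 * (sinK K (r / 2))\<^sup>2"
  using chord_qform[of K p v 0 r] by simp

text \<open>Common endpoints mean a common ambient chord, and \<open>sinK K (r / 2)\<close> is
  strictly increasing in \<open>r\<close> as long as \<open>short K r\<close>.\<close>

lemma geod_length_le:
  assumes "unit_tangent K p v" "unit_tangent K p w" "geod K p w s = geod K p v r"
    and "0 \<le> s" "0 \<le> r" "short K r"
  shows "r \<le> s"
proof (rule ccontr)
  assume "\<not> r \<le> s"
  then have "sinK K (s / 2) < sinK K (r / 2)" using assms by (intro sinK_strict_mono) auto
  moreover have "0 \<le> sinK K (s / 2)"
    using sinK_pos[of "s / 2" K] assms \<open>\<not> r \<le> s\<close> short_mono[OF \<open>short K r\<close>, of "s / 2"]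
    by (cases "s = 0") auto
  ultimately have "(sinK K (s / 2))\<^sup>2 < (sinK K (r / 2))\<^sup>2" by (intro power_strict_mono) auto
  then show False using chord_qform_0[OF assms(1), of r] chord_qform_0[OF assms(2), of s] assms(3) by simp
qed

text \<open>The squared chord \<open>4 / K\<close> to the antipode forces
  \<open>cosK K (s / 2) = 0\<close>, while this value is positive below half a circle.\<close>

lemma antipode_length_ge:
  assumes "unit_tangent K p w" "K > 0" "geod K p w s = - p" "0 \<le> s" shows "pi / sqrt K \<le> s"
proof (rule ccontr)
  assume "\<not> pi / sqrt K \<le> s"
  then have "0 < cosK K (s / 2)" using assms by (intro cosK_pos) (auto simp: short_def)
  moreover have "p - geod K p w s = 2 *\<^sub>R p" using assms by (simp add: scaleR_2)
  then have "qform K (p - geod K p w s) (p - geod K p w s) = 4 / K"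
    using assms by (simp add: qform_linear unit_tangent_def tangent_def space_form_iff)
  then have "K * (sinK K (s / 2))\<^sup>2 = 1" using chord_qform_0[OF assms(1), of s] assms(2) by (simp add: field_simps)
  ultimately show False using cosK_sinK_squared[of K "s / 2"] by simp
qed

lemma distK_geod:
  assumes "unit_tangent K p v" "0 \<le> r" "short K r" shows "distK K p (geod K p v r) = r"
  unfolding distK_def using assms geod_length_le[OF assms(1)] by (intro cInf_eq_minimum) auto

lemma distK_antipode:
  assumes "unit_tangent K p v" "K > 0" shows "distK K p (- p) = pi / sqrt K"
  unfolding distK_def
proof (rule cInf_eq_minimum)
  show "pi / sqrt K \<in> {s. 0 \<le> s \<and> (\<exists>v. unit_tangent K p v \<and> geod K p v s = - p)}"
    using assms geod_half_circle[of K p v] by auto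
qed (use assms antipode_length_ge in blast)

lemma cross3_unit_tangent_nonzero: "unit_tangent K p v \<Longrightarrow> cross3 p v \<noteq> 0"
  using orthonormal_frame_exists frame_det_nonzero by fastforce

lemma plane_coordinates:
  assumes "unit_tangent K p v" "a *\<^sub>R p + b *\<^sub>R v = a' *\<^sub>R p + b' *\<^sub>R v" shows "a = a'" "b = b'"
proof -
  have "cross3 p (a *\<^sub>R p + b *\<^sub>R v) = cross3 p (a' *\<^sub>R p + b' *\<^sub>R v)"
    "cross3 (a *\<^sub>R p + b *\<^sub>R v) v = cross3 (a' *\<^sub>R p + b' *\<^sub>R v) v" using assms(2) by simp_all
  then have "b *\<^sub>R cross3 p v = b' *\<^sub>R cross3 p v" "a *\<^sub>R cross3 p v = a' *\<^sub>R cross3 p v"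
    by (simp_all add: cross_add_right cross_add_left cross_mult_right cross_mult_left)
  then show "a = a'" "b = b'" using cross3_unit_tangent_nonzero[OF assms(1)] by simp_all
qed

lemma geod_unique:
  assumes "unit_tangent K p v" "unit_tangent K p w" "geod K p v r = geod K p w s"
    "0 \<le> r" "0 < s" "short K r" "short K s"
  shows "r = s" "v = w"
proof -
  show "r = s"
    using geod_length_le[OF assms(1,2) assms(3)[symmetric] less_imp_le[OF assms(5)] assms(4,6)]
      geod_length_le[OF assms(2,1) assms(3) assms(4) less_imp_le[OF assms(5)] assms(7)] by simp
  then have "sinK K s *\<^sub>R v = sinK K s *\<^sub>R w" using assms(3) by (simp add: geod_def)
  then show "v = w" using sinK_pos[of s K] assms by simp
qed

text \<open>Spherical linear interpolation. For \<open>0 < \<theta> < r\<close> and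
  \<open>short K r\<close> both coefficients are positive, so arcs of the surface are the radial
  images of segments in the ambient space.\<close>

lemma geod_combination:
  "sinK K r *\<^sub>R geod K p v \<theta> = sinK K (r - \<theta>) *\<^sub>R p + sinK K \<theta> *\<^sub>R geod K p v r"
  by (simp add: geod_def sinK_diff algebra_simps)

text \<open>Converse of \<open>geod_combination\<close>: the intermediate value theorem finds the
  parameter at which the two interpolation coefficients have the ratio of \<open>a\<close> and
  \<open>b\<close>.\<close>

lemma geod_positive_combination:
  assumes "0 < r" "short K r" "0 \<le> a" "0 \<le> b" "0 < a + b"
  obtains \<theta> l where "0 \<le> \<theta>" "\<theta> \<le> r" "0 < l" "a *\<^sub>R p + b *\<^sub>R geod K p v r = l *\<^sub>R geod K p v \<theta>"
proof -
  define h where "h = (\<lambda>\<theta>. a * sinK K \<theta> - b * sinK K (r - \<theta>))"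
  have sr: "sinK K r > 0" using sinK_pos assms by blast
  have "\<exists>\<theta>\<ge>0. \<theta> \<le> r \<and> h \<theta> = 0"
    by (rule IVT') (use sr assms in \<open>auto simp: h_def intro!: continuous_intros\<close>)
  then obtain \<theta> where th: "0 \<le> \<theta>" "\<theta> \<le> r" "a * sinK K \<theta> = b * sinK K (r - \<theta>)" by (auto simp: h_def)
  have sh: "short K \<theta>" "short K (r - \<theta>)" using th assms(2) by (auto intro: short_mono)
  then have s: "0 \<le> sinK K \<theta>" "0 \<le> sinK K (r - \<theta>)" using th by (auto intro: sinK_nonneg)
  have s': "0 < sinK K \<theta> + sinK K (r - \<theta>)"
    using sinK_pos[OF _ sh(1)] th s sr by (cases "\<theta> = 0") (auto intro: add_pos_nonneg)
  define t where "t = (a + b) / (sinK K \<theta> + sinK K (r - \<theta>))"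
  have t: "0 < t" using s' assms by (simp add: t_def)
  have "a = t * sinK K (r - \<theta>)" "b = t * sinK K \<theta>"
    using s' th(3) by (simp_all add: t_def field_simps)
  then have "a *\<^sub>R p + b *\<^sub>R geod K p v r = t *\<^sub>R (sinK K (r - \<theta>) *\<^sub>R p + sinK K \<theta> *\<^sub>R geod K p v r)"
    by (simp add: scaleR_add_right)
  also have "\<dots> = (t * sinK K r) *\<^sub>R geod K p v \<theta>" by (simp add: geod_combination[symmetric])
  finally show thesis using that[OF th(1,2), of "t * sinK K r"] t sr by simp
qed

lemma cross3_geod: assumes "unit_tangent K p v"
  shows "cross3 (geod K p v s) (geod_vel K p v s) = cross3 p v"
proof -
  have "cross3 (geod K p v s) (geod_vel K p v s) = ((cosK K s)\<^sup>2 + K * (sinK K s)\<^sup>2) *\<^sub>R cross3 p v"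
    by (simp add: geod_def geod_vel_def forall_3 power2_eq_square cross3_simps)
  then show ?thesis by (simp add: cosK_sinK_squared)
qed

text \<open>At a point of the line, the only unit tangent vectors inside its plane are the velocity
  and its negative.\<close>

lemma geodesic_line_through:
  assumes v: "unit_tangent K p v" and x: "x \<in> geodesic_line K p v" and w: "unit_tangent K x w"
    and "cross3 p v \<bullet> w = 0"
  shows "geodesic_line K x w = geodesic_line K p v" "\<exists>l. l \<noteq> 0 \<and> cross3 x w = l *\<^sub>R cross3 p v"
proof -
  obtain s where xs: "x = geod K p v s" using x by (auto simp: geodesic_line_def)
  obtain n where "orthonormal_frame K p v n" using orthonormal_frame_exists[OF v] by blast
  from orthonormal_frame_geod[OF this, of s] have f: "orthonormal_frame K x (geod_vel K p v s) n" by (simp add: xs)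
  define u where "u = geod_vel K p v s"
  have cu: "cross3 x u = cross3 p v" by (simp add: xs u_def cross3_geod[OF v])
  have f: "orthonormal_frame K x u n" using f by (simp add: u_def)
  have we: "w = qform K w u *\<^sub>R u + qform K w n *\<^sub>R n"
    using frame_tangent_expansion[OF f] w by (simp add: unit_tangent_def)
  have "cross3 x u \<bullet> w = 0" using assms(4) by (simp add: cu)
  then have "cross3 x u \<bullet> (0 *\<^sub>R x + qform K w u *\<^sub>R u + qform K w n *\<^sub>R n) = 0" using we by simp
  then have "qform K w n = 0" unfolding cross3_frame using frame_det_nonzero[OF f] by simp
  then have wu: "w = qform K w u *\<^sub>R u" using we by simp
  have "qform K w w = (qform K w u)\<^sup>2"
    by (subst (1 2) wu) (simp add: qform_linear orthonormal_frameD(6)[OF f] power2_eq_square)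
  then have "(qform K w u)\<^sup>2 = 1" using w by (simp add: unit_tangent_def)
  then have c: "qform K w u = 1 \<or> qform K w u = - 1" by (simp add: power2_eq_1_iff)
  then have "w = u \<or> w = - u" using wu by auto
  moreover have g: "geod K x u t = geod K p v (s + t)" for t by (simp add: xs u_def geod_geod)
  have "range (geod K x u) = range (geod K p v)"
  proof (intro equalityI subsetI)
    fix y assume "y \<in> range (geod K p v)"
    then obtain t where "y = geod K p v (s + (t - s))" by auto
    then show "y \<in> range (geod K x u)" using g by (metis rangeI)
  qed (auto simp: g)
  moreover have "range (geod K x (- u)) = range (geod K x u)"
  proof (intro equalityI subsetI)
    fix y assume "y \<in> range (geod K x u)"
    then obtain t where "y = geod K x (- u) (- t)" by (auto simp: geod_minus)
    then show "y \<in> range (geod K x (- u))" by blast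
  qed (auto simp: geod_minus)
  ultimately show "geodesic_line K x w = geodesic_line K p v" by (auto simp: geodesic_line_def)
  show "\<exists>l. l \<noteq> 0 \<and> cross3 x w = l *\<^sub>R cross3 p v"
    using c by (subst wu, intro exI[of _ "qform K w u"]) (auto simp: cross_mult_right cu)
qed

lemma geod_near:
  assumes "open U" "p \<in> U" obtains e where "0 < e" "short K e" "geod K p v e \<in> U"
proof -
  have "open (geod K p v -` U)"
    unfolding geod_def by (intro open_vimage assms continuous_intros)
  moreover have "0 \<in> geod K p v -` U" using assms by simp
  ultimately obtain d where d: "0 < d" "ball 0 d \<subseteq> geod K p v -` U" by (meson openE)
  define P where "P = pi / sqrt K"
  have P: "0 < P" if "K > 0" using that by (simp add: P_def)
  define e where "e = min (d / 2) (if K > 0 then P / 2 else 1)"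
  have "0 < e" "e < d" "short K e" unfolding short_def P_def[symmetric]
    using d P by (auto simp: e_def min_def)
  moreover from this have "e \<in> geod K p v -` U" using d by (intro subsetD[OF d(2)]) (simp add: dist_norm)
  ultimately show thesis using that by auto
qed

lemma is_chord_reverse:
  assumes "is_chord K D g p v r"
  shows "is_chord K D g (geod K p v r) (- geod_vel K p v r) r" "geod K (geod K p v r) (- geod_vel K p v r) r = p"
proof -
  have v: "unit_tangent K p v" and g: "g = geodesic_line K p v" using assms by (auto simp: is_chord_def)
  have *: "geod K (geod K p v r) (- geod_vel K p v r) t = geod K p v (r - t)" for t
    by (simp add: geod_minus geod_geod)
  show "geod K (geod K p v r) (- geod_vel K p v r) r = p" by (simp add: *)
  have "geodesic_line K (geod K p v r) (- geod_vel K p v r) = g" unfolding g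
  proof (rule geodesic_line_through(1)[OF v])
    show "unit_tangent K (geod K p v r) (- geod_vel K p v r)"
      using unit_tangent_minus[OF unit_tangent_geod(1)[OF v]] .
    show "cross3 p v \<bullet> - geod_vel K p v r = 0" by (simp add: geod_vel_def cross3_simps)
  qed (simp add: geodesic_line_def)
  moreover have "geod K (geod K p v r) (- geod_vel K p v r) ` {0..r} = geod K p v ` {0..r}"
  proof -
    have "geod K (geod K p v r) (- geod_vel K p v r) ` {0..r} = (\<lambda>t. geod K p v (r - t)) ` {0..r}"
      by (rule image_cong) (simp_all only: *)
    also have "\<dots> = geod K p v ` ((\<lambda>t. r - t) ` {0..r})" by (simp only: image_image)
    also have "(\<lambda>t. r - t) ` {0..r} = {0..r}" by simp
    finally show ?thesis .
  qed
  ultimately show "is_chord K D g (geod K p v r) (- geod_vel K p v r) r"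
    using assms unit_tangent_geod[OF v] by (auto simp: is_chord_def intro: unit_tangent_minus)
qed

section \<open>The cone over the domain and its supporting planes\<close>

locale convex_domain =
  fixes K :: real and D :: "(real^3) set"
  assumes domain: "convex_compact_domain K D"
    and no_segment: "contains_no_geodesic_segment K (boundaryK K D)"
begin

lemma D_space_form: "D \<subseteq> space_form K" and compact_D: "compact D" and closed_D: "closed D"
  using domain compact_imp_closed by (auto simp: convex_compact_domain_def geodesically_convex_def)

lemma boundary_subset: "boundaryK K D \<subseteq> D"
proof -
  have "closedin (top_of_set (space_form K)) D"
    using D_space_form closed_D by (simp add: closed_subset)
  then show ?thesis by (simp add: boundaryK_def frontier_of_def closure_of_closedin)
qed

lemma boundary_iff_not_interior:
  "x \<in> boundaryK K D \<longleftrightarrow> x \<in> D \<and> \<not> (\<exists>U. open U \<and> x \<in> U \<and> space_form K \<inter> U \<subseteq> D)"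
proof -
  have "closedin (top_of_set (space_form K)) D"
    using D_space_form closed_D by (simp add: closed_subset)
  then have "boundaryK K D = D - top_of_set (space_form K) interior_of D"
    by (simp add: boundaryK_def frontier_of_def closure_of_closedin)
  moreover have "x \<in> top_of_set (space_form K) interior_of D \<longleftrightarrow> (\<exists>U. open U \<and> x \<in> U \<and> space_form K \<inter> U \<subseteq> D)"
    if "x \<in> D" using that D_space_form by (auto simp: interior_of_def openin_open)
  ultimately show ?thesis by auto
qed

lemma interior_exists: obtains x U where "x \<in> D" "open U" "x \<in> U" "space_form K \<inter> U \<subseteq> D"
  using domain by (auto simp: convex_compact_domain_def interior_of_def openin_open)

text \<open>Every half great circle from \<open>p\<close> ends in \<open>- p\<close> and is
  minimizing, so uniqueness of the minimizing segment fails: the half circles with directions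
  \<open>v\<close> and \<open>- v\<close> differ, since the midpoint of the first has a positive
  coordinate along \<open>v\<close> and no point of the second has one.\<close>

lemma no_antipodes: assumes "p \<in> D" shows "- p \<notin> D"
proof
  assume "- p \<in> D"
  have p: "p \<in> space_form K" using assms D_space_form by auto
  have K: "K > 0" using space_form_minus p \<open>- p \<in> D\<close> D_space_form by blast
  obtain v where v: "unit_tangent K p v" using unit_tangent_exists[OF p] by blast
  have d: "distK K p (- p) = pi / sqrt K" by (rule distK_antipode[OF v K])
  have "minimizing_segment K p (- p) (geod K p w ` {0..pi / sqrt K})" if "unit_tangent K p w" for w
    unfolding minimizing_segment_def d using that geod_half_circle[OF K] by auto
  moreover have "\<exists>!S. minimizing_segment K p (- p) S"
    using domain assms \<open>- p \<in> D\<close> by (simp add: convex_compact_domain_def geodesically_convex_def)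
  ultimately have "geod K p v ` {0..pi / sqrt K} = geod K p (- v) ` {0..pi / sqrt K}"
    using v unit_tangent_minus[OF v] by blast
  moreover have "geod K p v (pi / sqrt K / 2) \<in> geod K p v ` {0..pi / sqrt K}"
    using K by (intro imageI) (simp add: divide_simps)
  ultimately obtain t where t: "0 \<le> t" "t \<le> pi / sqrt K" "geod K p v (pi / sqrt K / 2) = geod K p v (- t)"
    by (auto simp: geod_minus)
  from plane_coordinates(2)[OF v t(3)[unfolded geod_def]] have "sinK K (pi / sqrt K / 2) = - sinK K t" by simp
  moreover have "sinK K (pi / sqrt K / 2) > 0" using K by (simp add: sinK_def)
  moreover have "sinK K t \<ge> 0" using K t by (auto simp: sinK_def field_simps intro!: sin_ge_zero)
  ultimately show False by simp
qed

lemma segment_subset: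
  assumes "p \<in> D" "unit_tangent K p v" "0 \<le> r" "short K r" "geod K p v r \<in> D"
  shows "geod K p v ` {0..r} \<subseteq> D"
proof -
  have "minimizing_segment K p (geod K p v r) (geod K p v ` {0..r})"
    unfolding minimizing_segment_def distK_geod[OF assms(2-4)] using assms by auto
  then show ?thesis
    using domain assms by (auto simp: convex_compact_domain_def geodesically_convex_def)
qed

lemma segment_between: assumes "x \<in> D" "y \<in> D" "x \<noteq> y"
  obtains v r where "unit_tangent K x v" "0 < r" "short K r" "y = geod K x v r"
  using geod_between[of x K y] assms D_space_form no_antipodes by blast

text \<open>This is convexity of the cone over \<open>D\<close>: the combination lies on the ray
  through a point of the segment from \<open>x\<close> to \<open>y\<close>.\<close>

lemma positive_combination:
  assumes "x \<in> D" "y \<in> D" "0 \<le> a" "0 \<le> b" "0 < a + b"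
  obtains z l where "z \<in> D" "0 < l" "a *\<^sub>R x + b *\<^sub>R y = l *\<^sub>R z"
proof (cases "x = y")
  case True
  then show ?thesis using that[of x "a + b"] assms by (simp add: scaleR_add_left)
next
  case False
  then obtain v r where vr: "unit_tangent K x v" "0 < r" "short K r" "y = geod K x v r"
    using segment_between assms by blast
  obtain \<theta> l where "0 \<le> \<theta>" "\<theta> \<le> r" "0 < l" "a *\<^sub>R x + b *\<^sub>R geod K x v r = l *\<^sub>R geod K x v \<theta>"
    using geod_positive_combination[OF vr(2,3) assms(3-5)] .
  moreover have "geod K x v ` {0..r} \<subseteq> D" using vr assms by (intro segment_subset) auto
  then have "geod K x v \<theta> \<in> D" using \<open>0 \<le> \<theta>\<close> \<open>\<theta> \<le> r\<close> by auto
  ultimately show ?thesis using that[of "geod K x v \<theta>" l] vr by auto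
qed

text \<open>The cone is pointed, because sums of its vectors lie again on rays through points of the
  surface, and these are nonzero.\<close>

lemma no_zero_combination:
  assumes "x \<in> D" "y \<in> D" "z \<in> D" "0 \<le> a" "0 \<le> b" "0 < e" shows "a *\<^sub>R x + b *\<^sub>R y + e *\<^sub>R z \<noteq> 0"
proof -
  have *: "a *\<^sub>R x + b *\<^sub>R y \<noteq> 0" if xy: "x \<in> D" "y \<in> D" "0 \<le> a" "0 < b" for x y a b
  proof -
    have "0 \<le> b" "0 < a + b" using xy by auto
    then obtain z l where "z \<in> D" "0 < l" "a *\<^sub>R x + b *\<^sub>R y = l *\<^sub>R z"
      using positive_combination[of x y a b] xy by blast
    then show ?thesis using space_form_nonzero D_space_form by (metis subsetD scaleR_eq_0_iff less_irrefl)
  qed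
  show ?thesis
  proof (cases "a + b = 0")
    case True
    then have "a = 0" "b = 0" using assms by auto
    then show ?thesis using *[OF assms(1,3), of 0 e] assms by simp
  next
    case False
    then obtain w l where w: "w \<in> D" "0 < l" "a *\<^sub>R x + b *\<^sub>R y = l *\<^sub>R w"
      using positive_combination[of x y a b] assms by (metis add_nonneg_nonneg less_eq_real_def)
    then show ?thesis using *[of w z l e] assms by simp
  qed
qed

lemma boundary_supporting: assumes "x \<in> boundaryK K D"
  obtains M where "M \<noteq> 0" "M \<bullet> x = 0" "\<And>d. d \<in> D \<Longrightarrow> 0 \<le> M \<bullet> d"
proof -
  define C where "C = {l *\<^sub>R d | l d. 0 < l \<and> d \<in> D}"
  have xD: "x \<in> D" using assms boundary_subset by auto
  have "convex C"
  proof (rule convexI)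
    fix y z :: "real^3" and u v :: real
    assume "y \<in> C" "z \<in> C" and uv: "0 \<le> u" "0 \<le> v" "u + v = 1"
    then obtain l d m e where yz: "y = l *\<^sub>R d" "z = m *\<^sub>R e" "0 < l" "0 < m" "d \<in> D" "e \<in> D" by (auto simp: C_def)
    have "0 < u * l + v * m"
      using uv yz by (cases "u = 0") (auto intro: add_pos_nonneg)
    then obtain w k where "w \<in> D" "0 < k" "(u * l) *\<^sub>R d + (v * m) *\<^sub>R e = k *\<^sub>R w"
      using positive_combination[OF yz(5,6), of "u * l" "v * m"] uv yz by auto
    then show "u *\<^sub>R y + v *\<^sub>R z \<in> C" by (auto simp: C_def yz)
  qed
  have C_scale: "l *\<^sub>R d \<in> C" if "d \<in> D" "0 < l" for l d using that by (auto simp: C_def)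
  have xC: "x \<in> C" using C_scale[OF xD, of 1] by simp
  \<comment> \<open>An open set inside the cone meets the surface only in points of
    \<open>D\<close>, because a ray meets the surface at most once; so an interior point of the cone
    would be an interior point of \<open>D\<close>.\<close>
  have "x \<notin> interior C"
  proof
    assume "x \<in> interior C"
    moreover have "space_form K \<inter> interior C \<subseteq> D"
    proof
      fix y assume y: "y \<in> space_form K \<inter> interior C"
      then obtain l d where ld: "y = l *\<^sub>R d" "0 < l" "d \<in> D" using interior_subset by (fastforce simp: C_def)
      then have "l = 1" using space_form_scaleR_eq[of d K l] y D_space_form by auto
      then show "y \<in> D" using ld by simp
    qed
    ultimately show False using assms open_interior unfolding boundary_iff_not_interior by blast
  qed
  \<comment> \<open>A cone with empty interior lies in a hyperplane, and a normal of it is constant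
    on the cone; otherwise \<open>x\<close> is a relative boundary point and has a supporting
    hyperplane.\<close>
  have "\<exists>M. M \<noteq> 0 \<and> (\<forall>y\<in>C. M \<bullet> x \<le> M \<bullet> y)"
  proof (cases "interior C = {}")
    case True
    then obtain a b where "a \<noteq> 0" "C \<subseteq> {x. a \<bullet> x = b}"
      using empty_interior_subset_hyperplane[OF \<open>convex C\<close>] by blast
    then have "a \<bullet> y = b" if "y \<in> C" for y using that by auto
    then show ?thesis using xC \<open>a \<noteq> 0\<close> by (intro exI[of _ a]) auto
  next
    case False
    then have "x \<notin> rel_interior C" using \<open>x \<notin> interior C\<close> rel_interior_nonempty_interior by blast
    then show ?thesis using supporting_hyperplane_rel_boundary[OF \<open>convex C\<close> xC] by metis
  qed
  then obtain M where M: "M \<noteq> 0" "\<And>y. y \<in> C \<Longrightarrow> M \<bullet> x \<le> M \<bullet> y" by blast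
  \<comment> \<open>The cone contains \<open>x / 2\<close> and \<open>2 x\<close>, so a linear
    functional with minimum at \<open>x\<close> vanishes there.\<close>
  have "M \<bullet> x = 0" using M(2)[OF C_scale[OF xD, of "1/2"]] M(2)[OF C_scale[OF xD, of 2]] by simp
  moreover have "0 \<le> M \<bullet> d" if "d \<in> D" for d using M(2)[OF C_scale[OF that, of 1]] \<open>M \<bullet> x = 0\<close> by simp
  ultimately show thesis using that M(1) by blast
qed

text \<open>A nonzero functional which vanishes at \<open>x\<close> is nonzero on some tangent
  direction at \<open>x\<close>. A short geodesic in a direction of decrease leaves the half-space,
  so no neighbourhood of \<open>x\<close> on the surface lies in \<open>D\<close>.\<close>

lemma supporting_boundary:
  assumes "x \<in> D" "M \<noteq> 0" "M \<bullet> x = 0" "\<And>d. d \<in> D \<Longrightarrow> 0 \<le> M \<bullet> d" shows "x \<in> boundaryK K D"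
  unfolding boundary_iff_not_interior
proof (intro conjI notI assms(1))
  assume "\<exists>U. open U \<and> x \<in> U \<and> space_form K \<inter> U \<subseteq> D"
  then obtain U where U: "open U" "x \<in> U" "space_form K \<inter> U \<subseteq> D" by blast
  obtain v n where f: "orthonormal_frame K x v n"
    using unit_tangent_exists orthonormal_frame_exists assms(1) D_space_form by (metis subsetD)
  have "M \<bullet> v \<noteq> 0 \<or> M \<bullet> n \<noteq> 0"
  proof (rule ccontr)
    assume *: "\<not> ?thesis"
    obtain a b e where "M = a *\<^sub>R x + b *\<^sub>R v + e *\<^sub>R n" using frame_expansion[OF f] .
    from arg_cong[OF this, of "(\<bullet>) M"] show False using * assms(2,3) by (simp add: inner_add_right)
  qed
  then obtain u where u: "unit_tangent K x u" "M \<bullet> u \<noteq> 0" using orthonormal_frameD(1,2)[OF f] by blast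
  obtain w where w: "unit_tangent K x w" "M \<bullet> w < 0"
  proof (cases "M \<bullet> u < 0")
    case False
    then show thesis using u unit_tangent_minus[OF u(1)] by (intro that[of "- u"]) auto
  qed (use u that in blast)
  obtain e where e: "0 < e" "short K e" "geod K x w e \<in> U" using geod_near[OF U(1,2)] .
  then have "geod K x w e \<in> D" using unit_tangent_geod[OF w(1)] U by auto
  then have "0 \<le> M \<bullet> geod K x w e" using assms by blast
  also have "\<dots> = sinK K e * (M \<bullet> w)" using assms(3) by (simp add: geod_def inner_add_right)
  finally show False using sinK_pos[OF e(1,2)] w(2) by (simp add: zero_le_mult_iff)
qed

lemma not_in_plane: assumes "M \<noteq> 0" obtains d where "d \<in> D" "M \<bullet> d \<noteq> 0"
proof -
  obtain x U where "x \<in> D" "open U" "x \<in> U" "space_form K \<inter> U \<subseteq> D" using interior_exists .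
  then have "x \<notin> boundaryK K D" by (auto simp: boundary_iff_not_interior)
  then show thesis using supporting_boundary[of x M] assms that \<open>x \<in> D\<close> by fastforce
qed

text \<open>Strict convexity, and the place where \<open>no_segment\<close> enters: a supporting
  plane at \<open>z\<close> contains both \<open>x\<close> and \<open>y\<close>, hence the segment
  between them, and all points of \<open>D\<close> in a supporting plane belong to the
  boundary.\<close>

lemma combination_not_boundary:
  assumes "x \<in> D" "y \<in> D" "x \<noteq> y" "0 < a" "0 < b" "0 < l" "l *\<^sub>R z = a *\<^sub>R x + b *\<^sub>R y"
  shows "z \<notin> boundaryK K D"
proof
  assume "z \<in> boundaryK K D"
  then obtain M where M: "M \<noteq> 0" "M \<bullet> z = 0" "\<And>d. d \<in> D \<Longrightarrow> 0 \<le> M \<bullet> d" using boundary_supporting by blast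
  have "l * (M \<bullet> z) = a * (M \<bullet> x) + b * (M \<bullet> y)"
    using arg_cong[OF assms(7), of "(\<bullet>) M"] by (simp add: inner_add_right)
  then have "a * (M \<bullet> x) + b * (M \<bullet> y) = 0" using M by simp
  moreover have "0 \<le> a * (M \<bullet> x)" "0 \<le> b * (M \<bullet> y)" using M(3) assms by simp_all
  ultimately have "a * (M \<bullet> x) = 0" "b * (M \<bullet> y) = 0" by linarith+
  then have xy: "M \<bullet> x = 0" "M \<bullet> y = 0" using assms by auto
  obtain v r where vr: "unit_tangent K x v" "0 < r" "short K r" "y = geod K x v r" using segment_between assms by blast
  have "M \<bullet> v = 0" using xy vr sinK_pos[OF vr(2,3)] by (simp add: geod_def inner_add_right)
  have "geod K x v ` {0..r} \<subseteq> D" using vr assms by (intro segment_subset) auto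
  moreover have "M \<bullet> geod K x v t = 0" for t using \<open>M \<bullet> v = 0\<close> xy by (simp add: geod_def inner_add_right)
  ultimately have "geod K x v ` {0..r} \<subseteq> boundaryK K D" using supporting_boundary[OF _ M(1)] M(3) by blast
  then show False using no_segment vr by (auto simp: contains_no_geodesic_segment_def)
qed

end

lemma space_form_scaleR_cases: assumes "x \<in> space_form K" "a *\<^sub>R x \<in> space_form K" shows "a = 1 \<or> a = - 1"
proof (cases "K = 0")
  case True
  then show ?thesis using assms by (simp add: space_form_iff)
next
  case False
  have "qform K (a *\<^sub>R x) (a *\<^sub>R x) = a\<^sup>2 * qform K x x" by (simp add: qform_linear power2_eq_square)
  moreover have "qform K (a *\<^sub>R x) (a *\<^sub>R x) = 1 / K" "qform K x x = 1 / K"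
    using assms False by (simp_all only: space_form_iff if_False)
  ultimately have "a\<^sup>2 = 1" using False by simp
  then show ?thesis by (simp add: power2_eq_1_iff)
qed

lemma finite_if_no_three:
  fixes S :: "real set" assumes "\<And>a b c. a \<in> S \<Longrightarrow> b \<in> S \<Longrightarrow> c \<in> S \<Longrightarrow> a < b \<Longrightarrow> b < c \<Longrightarrow> False"
  shows "finite S"
proof (rule ccontr)
  assume "infinite S"
  then obtain T where "T \<subseteq> S" "card T = 3" using infinite_arbitrarily_large by metis
  then obtain x y z where *: "x \<in> S" "y \<in> S" "z \<in> S" "x \<noteq> y" "y \<noteq> z" "x \<noteq> z" by (auto simp: card_3_iff)
  consider "x < y" "y < z" | "x < z" "z < y" | "y < x" "x < z" | "y < z" "z < x" | "z < x" "x < y" | "z < y" "y < x"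
    using * by linarith
  then show False by cases (use * assms in blast)+
qed

lemma geod_combination_general:
  "sinK K (c - a) *\<^sub>R geod K p v b = sinK K (c - b) *\<^sub>R geod K p v a + sinK K (b - a) *\<^sub>R geod K p v c"
  using geod_combination[of K "c - a" "geod K p v a" "geod_vel K p v a" "b - a"] by (simp add: geod_geod)

lemma geod_neq:
  assumes "unit_tangent K p v" "a < c" "short K (c - a)" shows "geod K p v a \<noteq> geod K p v c"
proof
  assume "geod K p v a = geod K p v c"
  then have "sinK K ((c - a) / 2) = 0" using chord_qform[OF assms(1), of c a] by (simp add: qform_def)
  moreover have "0 < sinK K ((c - a) / 2)" using assms by (intro sinK_pos) (auto intro: short_mono[OF assms(3)])
  ultimately show False by simp
qed

section \<open>Chords, their endpoints, and lines which only touch the domain\<close>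

context convex_domain
begin

text \<open>Prepares the extremal argument for chords: seen from \<open>x\<close>, a point strictly
  inside a segment is nearer than its far end, so a point of \<open>D\<close> beyond an endpoint
  would be farther away than that endpoint.\<close>

lemma nearer_than_endpoint:
  assumes "x \<in> D" "z \<in> D" "y \<in> D" "x \<noteq> z" "0 < a" "0 < b" "0 < l" "l *\<^sub>R y = a *\<^sub>R x + b *\<^sub>R z"
  shows "qform K (x - y) (x - y) < qform K (x - z) (x - z)"
proof -
  obtain v r where vr: "unit_tangent K x v" "0 < r" "short K r" "z = geod K x v r" using segment_between assms by blast
  obtain \<theta> m where th: "0 \<le> \<theta>" "\<theta> \<le> r" "0 < m" "a *\<^sub>R x + b *\<^sub>R geod K x v r = m *\<^sub>R geod K x v \<theta>"
    using geod_positive_combination[OF vr(2,3), of a b x v] assms by auto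
  have "y = (1 / l) *\<^sub>R (l *\<^sub>R y)" using assms(7) by simp
  also have "\<dots> = (1 / l) *\<^sub>R (m *\<^sub>R geod K x v \<theta>)" using th(4) assms(8) vr(4) by simp
  finally have y: "y = (m / l) *\<^sub>R geod K x v \<theta>" by simp
  moreover have "y \<in> space_form K" "geod K x v \<theta> \<in> space_form K"
    using assms D_space_form unit_tangent_geod[OF vr(1)] by auto
  ultimately have "m / l = 1" using space_form_scaleR_eq[of "geod K x v \<theta>" K "m / l"] th assms by auto
  then have yt: "y = geod K x v \<theta>" using y by simp
  have "\<theta> \<noteq> r"
  proof
    assume "\<theta> = r"
    then have "(a + b * cosK K r) *\<^sub>R x + (b * sinK K r) *\<^sub>R v = (m * cosK K r) *\<^sub>R x + (m * sinK K r) *\<^sub>R v"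
      using th(4) by (simp add: geod_def algebra_simps)
    from plane_coordinates[OF vr(1) this] have "b = m" "a + b * cosK K r = m * cosK K r"
      using sinK_pos[OF vr(2,3)] by auto
    then show False using assms by simp
  qed
  then have "sinK K (\<theta> / 2) < sinK K (r / 2)" using th vr by (intro sinK_strict_mono) auto
  moreover have "0 \<le> sinK K (\<theta> / 2)" using th by (intro sinK_nonneg short_mono[OF vr(3)]) auto
  ultimately have "(sinK K (\<theta> / 2))\<^sup>2 < (sinK K (r / 2))\<^sup>2" by (intro power_strict_mono) auto
  then show ?thesis unfolding yt vr(4) chord_qform_0[OF vr(1)] by simp
qed

lemma chord_exists:
  assumes v: "unit_tangent K p v" and y: "y \<in> geodesic_line K p v \<inter> D" "y' \<in> geodesic_line K p v \<inter> D" "y \<noteq> y'"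
  obtains x w r where "is_chord K D (geodesic_line K p v) x w r" "0 < r" "short K r"
proof -
  \<comment> \<open>The endpoints are two points of the line in \<open>D\<close> at maximal distance.\<close>
  define G where "G = geodesic_line K p v \<inter> D"
  define dq where "dq = (\<lambda>(x, y). qform K (x - y) (x - y))"
  have "G = D \<inter> {x. cross3 p v \<bullet> x = 0}" using D_space_form by (auto simp: G_def geodesic_line_eq[OF v])
  then have "compact G" using compact_Int_closed[OF compact_D closed_hyperplane] by simp
  then have "compact (G \<times> G)" by (rule compact_Times) fact
  moreover have "continuous_on (G \<times> G) dq"
    by (auto simp: dq_def qform_def split_beta intro!: continuous_intros)
  moreover have "G \<times> G \<noteq> {}" using y by (auto simp: G_def)
  ultimately obtain m where "m \<in> G \<times> G" and max: "\<And>q. q \<in> G \<times> G \<Longrightarrow> dq q \<le> dq m"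
    using continuous_attains_sup by metis
  then obtain x z where xz: "x \<in> G" "z \<in> G" and m: "m = (x, z)" by auto
  have max: "qform K (a - b) (a - b) \<le> qform K (x - z) (x - z)" if "a \<in> G" "b \<in> G" for a b
    using max[of "(a, b)"] that by (simp add: m dq_def)
  have D: "x \<in> D" "z \<in> D" "y \<in> D" "y' \<in> D" using xz y by (auto simp: G_def)
  have "x \<noteq> z"
  proof
    assume "x = z"
    obtain u r where ur: "unit_tangent K y u" "0 < r" "short K r" "y' = geod K y u r" using segment_between D y(3) by blast
    have "0 < sinK K (r / 2)" using ur by (intro sinK_pos short_mono[OF ur(3)]) auto
    then have "0 < qform K (y - y') (y - y')" unfolding ur(4) chord_qform_0[OF ur(1)] by simp
    then show False using max[of y y'] y \<open>x = z\<close> by (simp add: G_def qform_def)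
  qed
  then obtain w r where wr: "unit_tangent K x w" "0 < r" "short K r" "z = geod K x w r" using segment_between D by blast
  have sr: "0 < sinK K r" by (rule sinK_pos[OF wr(2,3)])
  have "cross3 p v \<bullet> x = 0" "cross3 p v \<bullet> z = 0" and xl: "x \<in> geodesic_line K p v"
    using xz by (auto simp: G_def geodesic_line_eq[OF v])
  then have "cross3 p v \<bullet> w = 0" using sr by (simp add: wr(4) geod_def inner_add_right)
  then have line: "geodesic_line K x w = geodesic_line K p v" using geodesic_line_through(1)[OF v xl wr(1)] by blast
  have "G = geod K x w ` {0..r}"
  proof
    show "geod K x w ` {0..r} \<subseteq> G"
      using segment_subset[of x w r] wr D unfolding G_def line[symmetric] by (auto simp: geodesic_line_def)
    show "G \<subseteq> geod K x w ` {0..r}"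
    proof
      fix u assume u: "u \<in> G"
      then have uD: "u \<in> D" and "u \<in> geodesic_line K x w" by (auto simp: G_def line)
      then obtain s where s: "u = geod K x w s" by (auto simp: geodesic_line_def)
      define \<beta> \<alpha> where "\<beta> = sinK K s / sinK K r" and "\<alpha> = cosK K s - sinK K s / sinK K r * cosK K r"
      have ab: "u = \<alpha> *\<^sub>R x + \<beta> *\<^sub>R z"
        using sr by (simp add: s wr(4) \<alpha>_def \<beta>_def geod_def algebra_simps)
      have u0: "u \<noteq> 0" using space_form_nonzero uD D_space_form by blast
      \<comment> \<open>Nonnegative coordinates put \<open>u\<close> on the segment from
        \<open>x\<close> to \<open>z\<close>. Two nonpositive ones contradict that the cone is
        pointed. Mixed signs put one endpoint between the other endpoint and \<open>u\<close>,
        against the maximal distance of \<open>x\<close> and \<open>z\<close>.\<close>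
      consider "0 \<le> \<alpha>" "0 \<le> \<beta>" | "\<alpha> \<le> 0" "\<beta> \<le> 0" | "\<alpha> < 0" "0 < \<beta>" | "0 < \<alpha>" "\<beta> < 0" by linarith
      then show "u \<in> geod K x w ` {0..r}"
      proof cases
        case 1
        have "0 < \<alpha> + \<beta>" using 1 u0 ab by (cases "\<alpha> = 0") (auto intro: add_pos_nonneg)
        from geod_positive_combination[OF wr(2,3) 1 this, of x w]
        obtain \<theta> l where th: "0 \<le> \<theta>" "\<theta> \<le> r" "0 < l" "\<alpha> *\<^sub>R x + \<beta> *\<^sub>R geod K x w r = l *\<^sub>R geod K x w \<theta>" by blast
        then have ul: "u = l *\<^sub>R geod K x w \<theta>" using ab wr by simp
        then have "l = 1" using space_form_scaleR_eq[of "geod K x w \<theta>" K l] unit_tangent_geod[OF wr(1)] uD D_space_form th by auto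
        then show ?thesis using ul th by auto
      next
        case 2
        then have "(- \<alpha>) *\<^sub>R x + (- \<beta>) *\<^sub>R z + 1 *\<^sub>R u \<noteq> 0" using D uD by (intro no_zero_combination) auto
        then show ?thesis using ab by simp
      next
        case 3
        have e: "\<beta> *\<^sub>R z = (- \<alpha>) *\<^sub>R x + 1 *\<^sub>R u" using ab by simp
        have "x \<noteq> u"
        proof
          assume "x = u"
          then have "\<beta> *\<^sub>R z = (1 - \<alpha>) *\<^sub>R x" using e by (simp add: algebra_simps)
          then have "(1 / \<beta>) *\<^sub>R (\<beta> *\<^sub>R z) = (1 / \<beta>) *\<^sub>R ((1 - \<alpha>) *\<^sub>R x)" by simp
          then have "z = ((1 - \<alpha>) / \<beta>) *\<^sub>R x" using 3 by simp
          moreover from this have "(1 - \<alpha>) / \<beta> = 1"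
            using space_form_scaleR_eq[of x K "(1 - \<alpha>) / \<beta>"] D D_space_form 3 by auto
          ultimately show False using \<open>x \<noteq> z\<close> by simp
        qed
        then have "qform K (x - z) (x - z) < qform K (x - u) (x - u)"
          using nearer_than_endpoint[OF D(1) uD D(2) _ _ _ 3(2) e] 3 by simp
        then show ?thesis using max[OF xz(1) u] by simp
      next
        case 4
        have e: "\<alpha> *\<^sub>R x = (- \<beta>) *\<^sub>R z + 1 *\<^sub>R u" using ab by simp
        have "z \<noteq> u"
        proof
          assume "z = u"
          then have "\<alpha> *\<^sub>R x = (1 - \<beta>) *\<^sub>R z" using e by (simp add: algebra_simps)
          then have "(1 / \<alpha>) *\<^sub>R (\<alpha> *\<^sub>R x) = (1 / \<alpha>) *\<^sub>R ((1 - \<beta>) *\<^sub>R z)" by simp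
          then have "x = ((1 - \<beta>) / \<alpha>) *\<^sub>R z" using 4 by simp
          moreover from this have "(1 - \<beta>) / \<alpha> = 1"
            using space_form_scaleR_eq[of z K "(1 - \<beta>) / \<alpha>"] D D_space_form 4 by auto
          ultimately show False using \<open>x \<noteq> z\<close> by simp
        qed
        then have "qform K (z - x) (z - x) < qform K (z - u) (z - u)"
          using nearer_than_endpoint[OF D(2) uD D(1) _ _ _ 4(1) e] 4 by simp
        moreover have "qform K (z - x) (z - x) = qform K (x - z) (x - z)" by (simp add: qform_def algebra_simps)
        ultimately show ?thesis using max[OF xz(2) u] by simp
      qed
    qed
  qed
  then have "is_chord K D (geodesic_line K p v) x w r"
  proof -
    have "pi / sqrt K \<le> 2 * pi / sqrt K" if "K > 0" using that by (intro divide_right_mono) auto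
    then have "K > 0 \<longrightarrow> r < 2 * pi / sqrt K" using wr(3) by (auto simp: short_def)
    with \<open>G = geod K x w ` {0..r}\<close> show ?thesis
      unfolding is_chord_def G_def line[symmetric] using wr(1,2) by simp
  qed
  then show thesis using that wr by blast
qed

text \<open>\<open>is_chord\<close> bounds the length only by a full circle;
  \<open>short K r\<close> holds because an arc of half a circle or more would contain two antipodal
  points of \<open>D\<close>.\<close>

lemma is_chordD:
  assumes "is_chord K D g p v r"
  shows "unit_tangent K p v" "g = geodesic_line K p v" "0 \<le> r" "short K r" "p \<in> D" "geod K p v r \<in> D"
    "g \<inter> D = geod K p v ` {0..r}"
proof -
  show c: "unit_tangent K p v" "g = geodesic_line K p v" "0 \<le> r" "g \<inter> D = geod K p v ` {0..r}"
    using assms by (auto simp: is_chord_def)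
  have "geod K p v 0 \<in> g \<inter> D" "geod K p v r \<in> g \<inter> D" unfolding c(4) using c(3) by (auto simp del: geod_0)
  then show p: "p \<in> D" "geod K p v r \<in> D" by auto
  show "short K r"
  proof (rule ccontr)
    assume "\<not> short K r"
    then have K: "K > 0" "pi / sqrt K \<le> r" by (auto simp: short_def)
    then have "geod K p v (pi / sqrt K) \<in> g \<inter> D" unfolding c(4) by (intro imageI) simp
    then show False using no_antipodes p geod_half_circle[OF K(1)] by simp
  qed
qed

text \<open>If \<open>p\<close> were interior, a small step backwards along the line would stay in
  \<open>D\<close>. Its coordinate along \<open>v\<close> is negative, whereas it is nonnegative on
  the whole chord.\<close>

lemma chord_start_boundary: assumes c: "is_chord K D g p v r" and r: "0 < r" shows "p \<in> boundaryK K D"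
  unfolding boundary_iff_not_interior
proof (intro conjI notI)
  note c = is_chordD[OF c]
  show "p \<in> D" by fact
  assume "\<exists>U. open U \<and> p \<in> U \<and> space_form K \<inter> U \<subseteq> D"
  then obtain U where U: "open U" "p \<in> U" "space_form K \<inter> U \<subseteq> D" by blast
  obtain e where e: "0 < e" "short K e" "geod K p (- v) e \<in> U" using geod_near[OF U(1,2)] .
  then have "geod K p (- v) e \<in> g \<inter> D"
    using U unit_tangent_geod[OF c(1)] by (auto simp: geod_minus c(2) geodesic_line_def)
  then obtain t where t: "0 \<le> t" "t \<le> r" "geod K p v (- e) = geod K p v t" unfolding c(7) by (auto simp: geod_minus)
  from plane_coordinates(2)[OF c(1) t(3)[unfolded geod_def]] have "- sinK K e = sinK K t" by simp
  moreover have "0 \<le> sinK K t" using t by (intro sinK_nonneg short_mono[OF c(4)])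
  ultimately show False using sinK_pos[OF e(1,2)] by simp
qed

lemma chord_end_boundary: "is_chord K D g p v r \<Longrightarrow> 0 < r \<Longrightarrow> geod K p v r \<in> boundaryK K D"
  using is_chord_reverse(1) chord_start_boundary by blast

lemma boundary_of_chord:
  assumes c: "is_chord K D g p v r" and z: "z \<in> g" "z \<in> boundaryK K D"
  shows "z = p \<or> z = geod K p v r"
proof (rule ccontr)
  assume *: "\<not> ?thesis"
  note c = is_chordD[OF c]
  have "z \<in> geod K p v ` {0..r}" unfolding c(7)[symmetric] using z boundary_subset by auto
  then obtain t where t: "0 \<le> t" "t \<le> r" "z = geod K p v t" by auto
  with * have t': "0 < t" "t < r" by (auto simp: less_le)
  have r: "0 < r" using t' by simp
  have "p \<noteq> geod K p v r" using geod_neq[OF c(1) r] c(4) by simp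
  then show False
    using combination_not_boundary[OF c(5,6) _ _ _ sinK_pos[OF r c(4)] geod_combination[of K r p v t]] z(2) t t'
      short_mono[OF c(4), of t] short_mono[OF c(4), of "r - t"] by (simp add: sinK_pos)
qed

text \<open>The line carries a chord by \<open>chord_exists\<close>, and
  \<open>boundary_of_chord\<close> identifies the endpoints of that chord with the two given points,
  up to reversal.\<close>

lemma chord_through:
  assumes x: "x \<in> boundaryK K D" and y: "geod K x w r \<in> boundaryK K D"
    and w: "unit_tangent K x w" and r: "0 < r" "short K r"
  shows "is_chord K D (geodesic_line K x w) x w r"
proof -
  define g where "g = geodesic_line K x w"
  have ne: "x \<noteq> geod K x w r" using geod_neq[OF w r(1)] r by simp
  have g: "x \<in> g" "geod K x w r \<in> g"
    using rangeI[of "geod K x w" 0] rangeI[of "geod K x w" r] unfolding g_def geodesic_line_def geod_0 by this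
  have "x \<in> geodesic_line K x w \<inter> D" "geod K x w r \<in> geodesic_line K x w \<inter> D"
    using g x y boundary_subset by (auto simp: g_def)
  from chord_exists[OF w this ne, folded g_def]
  obtain p v s where c: "is_chord K D g p v s" "0 < s" by metis
  note cD = is_chordD[OF c(1)]
  have "x = p \<or> x = geod K p v s" "geod K x w r = p \<or> geod K x w r = geod K p v s"
    using boundary_of_chord[OF c(1)] g x y by blast+
  moreover have "is_chord K D g x w r" if "is_chord K D g x v s" "geod K x w r = geod K x v s" for v
  proof -
    note cD = is_chordD[OF that(1)]
    have "r = s" "w = v" using geod_unique[OF w cD(1) that(2) _ c(2) r(2) cD(4)] r by auto
    then show ?thesis using that by simp
  qed
  ultimately show ?thesis unfolding g_def[symmetric] using c(1) is_chord_reverse[OF c(1)] ne by metis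
qed

text \<open>Uniqueness behind the description operator in \<open>chord_length\<close>: the endpoints
  of the first chord are two points of the second, at parameters whose difference is at most
  \<open>r'\<close>, and the ambient chord determines the length.\<close>

lemma is_chord_le:
  assumes c: "is_chord K D g p v r" and c': "is_chord K D g p' v' r'" shows "r \<le> r'"
proof (rule ccontr)
  assume "\<not> r \<le> r'"
  note c = is_chordD[OF c] and c' = is_chordD[OF c']
  have "geod K p v 0 \<in> geod K p' v' ` {0..r'}" "geod K p v r \<in> geod K p' v' ` {0..r'}"
    unfolding c'(7)[symmetric] c(7) using c(3) by (auto simp del: geod_0)
  then obtain a b where ab: "0 \<le> a" "a \<le> r'" "0 \<le> b" "b \<le> r'" "geod K p v 0 = geod K p' v' a" "geod K p v r = geod K p' v' b"
    by auto
  have "4 * (sinK K ((r - 0) / 2))\<^sup>2 = 4 * (sinK K ((b - a) / 2))\<^sup>2"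
    using chord_qform[OF c(1), of r 0] chord_qform[OF c'(1), of b a] unfolding ab by simp
  also have "(sinK K ((b - a) / 2))\<^sup>2 = (sinK K (\<bar>b - a\<bar> / 2))\<^sup>2"
  proof -
    have "\<bar>b - a\<bar> / 2 = (b - a) / 2 \<or> \<bar>b - a\<bar> / 2 = - ((b - a) / 2)" by linarith
    then show ?thesis using sinK_minus[of K "(b - a) / 2"] by (metis power2_minus)
  qed
  finally have e: "(sinK K (r / 2))\<^sup>2 = (sinK K (\<bar>b - a\<bar> / 2))\<^sup>2" by simp
  have "\<bar>b - a\<bar> < r" using ab \<open>\<not> r \<le> r'\<close> by auto
  then have "sinK K (\<bar>b - a\<bar> / 2) < sinK K (r / 2)" using c(4) by (intro sinK_strict_mono) auto
  moreover have "0 \<le> sinK K (\<bar>b - a\<bar> / 2)" using \<open>\<bar>b - a\<bar> < r\<close> by (intro sinK_nonneg short_mono[OF c(4)]) auto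
  ultimately show False using e power_strict_mono[of "sinK K (\<bar>b - a\<bar> / 2)" "sinK K (r / 2)" 2] by simp
qed

lemma chord_length_eq: assumes "is_chord K D g p v r" shows "chord_length K D g = r"
  unfolding chord_length_def using assms is_chord_le by (intro the_equality) (blast intro: order_antisym)+

text \<open>A degenerate chord of length 0 satisfies \<open>is_chord\<close>, so touching lines
  receive the value 0 rather than an unspecified one.\<close>

lemma chord_length_singleton:
  assumes "g \<in> geodesics K" "g \<inter> D = {y}" shows "chord_length K D g = 0"
proof -
  obtain p v where v: "unit_tangent K p v" and g: "g = geodesic_line K p v" using assms by (auto simp: geodesics_def)
  have "y \<in> g" using assms by auto
  then obtain s where s: "y = geod K p v s" by (auto simp: g geodesic_line_def)
  have "geodesic_line K y (geod_vel K p v s) = g" unfolding g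
  proof (rule geodesic_line_through(1)[OF v])
    show "y \<in> geodesic_line K p v" using \<open>y \<in> g\<close> g by simp
    show "unit_tangent K y (geod_vel K p v s)" unfolding s by (rule unit_tangent_geod[OF v])
    show "cross3 p v \<bullet> geod_vel K p v s = 0" by (simp add: geod_vel_def cross3_simps)
  qed
  then have "is_chord K D g y (geod_vel K p v s) 0"
    using assms unit_tangent_geod[OF v, of s] by (auto simp: is_chord_def s)
  then show ?thesis by (rule chord_length_eq)
qed

text \<open>If \<open>D\<close> had points on both sides of the line, every segment joining the
  sides would cross it at \<open>y\<close>. For \<open>d1\<close> and \<open>d2\<close> this puts
  \<open>y\<close> into their common plane. A third point of \<open>D\<close> off that plane, joined
  to whichever of the two is on the other side, would put \<open>y\<close> off the plane.\<close>

lemma touching_one_sided: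
  assumes v: "unit_tangent K p v" and y: "geodesic_line K p v \<inter> D = {y}"
  shows "(\<forall>d\<in>D. 0 \<le> cross3 p v \<bullet> d) \<or> (\<forall>d\<in>D. cross3 p v \<bullet> d \<le> 0)"
proof (rule ccontr)
  define N where "N = cross3 p v"
  assume "\<not> ?thesis"
  then obtain d1 d2 where d: "d1 \<in> D" "d2 \<in> D" "N \<bullet> d1 < 0" "0 < N \<bullet> d2" by (auto simp: N_def not_le)
  have yD: "y \<in> D" and Ny: "N \<bullet> y = 0" using y by (auto simp: N_def geodesic_line_eq[OF v])
  have uniq: "z = y" if z: "z \<in> D" "N \<bullet> z = 0" for z
  proof -
    have "z \<in> geodesic_line K p v" using z D_space_form unfolding geodesic_line_eq[OF v] N_def by blast
    then have "z \<in> geodesic_line K p v \<inter> D" using z(1) by (rule IntI)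
    from this[unfolded y] show "z = y" by (rule singletonD)
  qed
  have comb: "\<exists>l>0. l *\<^sub>R y = (N \<bullet> b) *\<^sub>R a + (- (N \<bullet> a)) *\<^sub>R b" if H: "a \<in> D" "b \<in> D" "N \<bullet> a < 0" "0 < N \<bullet> b" for a b
  proof -
    have "0 \<le> N \<bullet> b" "0 \<le> - (N \<bullet> a)" "0 < N \<bullet> b + - (N \<bullet> a)" using H by auto
    from positive_combination[OF H(1,2) this]
    obtain z l where z: "z \<in> D" "0 < l" "(N \<bullet> b) *\<^sub>R a + (- (N \<bullet> a)) *\<^sub>R b = l *\<^sub>R z" by metis
    have "l * (N \<bullet> z) = 0" using arg_cong[OF z(3), of "(\<bullet>) N"] by (simp add: inner_diff_right)
    then have "z = y" using uniq z by simp
    then show ?thesis using z by auto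
  qed
  have "d1 \<noteq> d2" using d by auto
  then obtain w r where wr: "unit_tangent K d1 w" "0 < r" "short K r" "d2 = geod K d1 w r" using segment_between d by blast
  define M where "M = cross3 d1 w"
  have "M \<noteq> 0" using cross3_unit_tangent_nonzero[OF wr(1)] by (simp add: M_def)
  then obtain d3 where d3: "d3 \<in> D" "M \<bullet> d3 \<noteq> 0" using not_in_plane by blast
  have M: "M \<bullet> d1 = 0" "M \<bullet> d2 = 0" by (simp_all add: M_def wr(4) geod_def cross3_simps)
  have "\<exists>l>0. l *\<^sub>R y = (N \<bullet> d2) *\<^sub>R d1 + (- (N \<bullet> d1)) *\<^sub>R d2" using comb d by blast
  then obtain l where l: "0 < l" "l *\<^sub>R y = (N \<bullet> d2) *\<^sub>R d1 + (- (N \<bullet> d1)) *\<^sub>R d2" by blast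
  have My: "M \<bullet> y = 0" using arg_cong[OF l(2), of "(\<bullet>) M"] l(1) M by (simp add: inner_diff_right)
  consider "N \<bullet> d3 = 0" | "N \<bullet> d3 < 0" | "N \<bullet> d3 > 0" by linarith
  then show False
  proof cases
    case 1
    then show ?thesis using uniq d3 My by blast
  next
    case 2
    then obtain l where "l *\<^sub>R y = (N \<bullet> d2) *\<^sub>R d3 + (- (N \<bullet> d3)) *\<^sub>R d2" using comb[of d3 d2] d d3 by blast
    from arg_cong[OF this, of "(\<bullet>) M"] show ?thesis using My M d d3 by (simp add: inner_diff_right)
  next
    case 3
    then obtain l where "l *\<^sub>R y = (N \<bullet> d3) *\<^sub>R d1 + (- (N \<bullet> d1)) *\<^sub>R d3" using comb[of d1 d3] d d3 by blast
    from arg_cong[OF this, of "(\<bullet>) M"] show ?thesis using My M d d3 by (simp add: inner_diff_right)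
  qed
qed

text \<open>Touching lines through \<open>x\<close> are sorted by the side \<open>s\<close> on which
  \<open>D\<close> lies, and each class has at most two angles. If \<open>x\<close> or
  \<open>- x\<close> belongs to \<open>D\<close> there are none, since it would be the touching
  point and hence a boundary point.\<close>

lemma finite_touching_through:
  assumes f: "orthonormal_frame K x w n" and x: "x \<notin> boundaryK K D" "- x \<notin> boundaryK K D"
  shows "finite {a \<in> {0<..<pi}. \<exists>y. geodesic_line K x (cos a *\<^sub>R w + sin a *\<^sub>R n) \<inter> D = {y}}"
proof -
  define u where "u = (\<lambda>a. cos a *\<^sub>R w + sin a *\<^sub>R n)"
  define N where "N = (\<lambda>a. cross3 x (u a))"
  define P where "P = (\<lambda>s::real. {a \<in> {0<..<pi}. (\<forall>d\<in>D. 0 \<le> s * (N a \<bullet> d)) \<and> (\<exists>y\<in>D. N a \<bullet> y = 0)})"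
  note fD = orthonormal_frameD[OF f]
  have u: "unit_tangent K x (u a)" for a
    using fD(3,4,6-9) sin_cos_squared_add[of a]
    by (auto simp: unit_tangent_def u_def qform_linear power2_eq_square intro!: tangent_add tangent_scaleR)
  have N0: "N a \<noteq> 0" for a using cross3_unit_tangent_nonzero[OF u] by (simp add: N_def)
  have "\<not> (x \<in> D \<or> - x \<in> D)" if touch: "geodesic_line K x (u a) \<inter> D = {y}" for a y
  proof
    assume "x \<in> D \<or> - x \<in> D"
    moreover have "z \<in> boundaryK K D" if "z = x \<or> z = - x" "z \<in> D" for z
    proof -
      have "N a \<bullet> z = 0" using that by (auto simp: N_def dot_cross_self inner_commute)
      then show ?thesis using touching_one_sided[OF u touch] supporting_boundary[OF that(2), of "N a"]
          supporting_boundary[OF that(2), of "- N a"] N0 by (auto simp: N_def)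
    qed
    ultimately show False using x by blast
  qed
  then have sub: "{a \<in> {0<..<pi}. \<exists>y. geodesic_line K x (u a) \<inter> D = {y}} \<subseteq>
      (if x \<in> D \<or> - x \<in> D then {} else P 1 \<union> P (- 1))"
  proof (intro subsetI, goal_cases)
    case (1 a)
    then obtain y where a: "a \<in> {0<..<pi}" and y: "geodesic_line K x (u a) \<inter> D = {y}" by auto
    have nx: "\<not> (x \<in> D \<or> - x \<in> D)" using 1(1)[OF y] .
    have "y \<in> D" "N a \<bullet> y = 0" using y geodesic_line_eq[OF u, of a] by (auto simp: N_def)
    then have "a \<in> P 1 \<union> P (- 1)" using touching_one_sided[OF u y] a by (auto simp: P_def N_def)
    then show ?case using nx by simp
  qed
  have fin: "finite (P s)" if s: "s \<noteq> 0" and nx: "\<not> (x \<in> D \<or> - x \<in> D)" for s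
  proof (rule finite_if_no_three)
    fix a b c assume abc: "a \<in> P s" "b \<in> P s" "c \<in> P s" "a < b" "b < c"
    \<comment> \<open>\<open>N b\<close> is a positive combination of \<open>N a\<close> and \<open>N c\<close>, so all three planes contain the touching point of the
      line at angle \<open>b\<close>; they have only the line spanned by \<open>x\<close> in common.\<close>
    then have r: "0 < a" "c < pi" by (auto simp: P_def)
    obtain y where y: "y \<in> D" "N b \<bullet> y = 0" using abc by (auto simp: P_def)
    have pos: "0 < sin (c - b)" "0 < sin (b - a)" "0 < sin (c - a)" using abc r by (auto intro!: sin_gt_zero)
    have "sin (c - b) *\<^sub>R u a + sin (b - a) *\<^sub>R u c = sin (c - a) *\<^sub>R u b"
    proof -
      have "sin (c - b) * cos a + sin (b - a) * cos c = sin (c - a) * cos b"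
        "sin (c - b) * sin a + sin (b - a) * sin c = sin (c - a) * sin b"
        unfolding sin_diff by (simp_all add: algebra_simps)
      moreover have "sin (c - b) *\<^sub>R u a + sin (b - a) *\<^sub>R u c =
          (sin (c - b) * cos a + sin (b - a) * cos c) *\<^sub>R w + (sin (c - b) * sin a + sin (b - a) * sin c) *\<^sub>R n"
        by (simp add: u_def algebra_simps)
      ultimately show ?thesis by (simp add: u_def scaleR_add_right)
    qed
    from arg_cong[OF this, of "\<lambda>z. cross3 x z \<bullet> y"]
    have "sin (c - b) * (N a \<bullet> y) + sin (b - a) * (N c \<bullet> y) = sin (c - a) * (N b \<bullet> y)"
      by (simp add: N_def cross_add_right cross_mult_right inner_add_left)
    from arg_cong[OF this, of "\<lambda>z. s * z"] have "sin (c - b) * (s * (N a \<bullet> y)) + sin (b - a) * (s * (N c \<bullet> y)) = 0" using y by (simp add: algebra_simps)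
    moreover have "0 \<le> sin (c - b) * (s * (N a \<bullet> y))" "0 \<le> sin (b - a) * (s * (N c \<bullet> y))"
      using abc y pos by (auto simp: P_def intro!: mult_nonneg_nonneg)
    ultimately have "sin (c - b) * (s * (N a \<bullet> y)) = 0" "sin (b - a) * (s * (N c \<bullet> y)) = 0" by linarith+
    then have ac: "N a \<bullet> y = 0" "N c \<bullet> y = 0" using pos s by auto
    obtain \<alpha> \<beta> \<epsilon> where ye: "y = \<alpha> *\<^sub>R x + \<beta> *\<^sub>R w + \<epsilon> *\<^sub>R n" using frame_expansion[OF f] .
    have Ny: "N t \<bullet> y = (cos t * \<epsilon> - sin t * \<beta>) * (cross3 x w \<bullet> n)" for t
      by (simp add: N_def u_def ye cross3_simps)
    then have e: "cos a * \<epsilon> = sin a * \<beta>" "cos c * \<epsilon> = sin c * \<beta>" using ac frame_det_nonzero[OF f] by auto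
    have "sin (c - a) * \<beta> = sin c * \<beta> * cos a - cos c * (sin a * \<beta>)" by (simp add: sin_diff algebra_simps)
    also have "\<dots> = 0" unfolding e[symmetric] by simp
    finally have "\<beta> = 0" using pos by simp
    moreover have "sin (c - a) * \<epsilon> = sin c * (cos a * \<epsilon>) - sin a * (cos c * \<epsilon>)" by (simp add: sin_diff algebra_simps)
    then have "\<epsilon> = 0" using pos by (simp add: e)
    ultimately have "y = \<alpha> *\<^sub>R x" using ye by simp
    moreover from this have "\<alpha> = 1 \<or> \<alpha> = - 1"
      using space_form_scaleR_cases[OF fD(5), of \<alpha>] y(1) D_space_form by blast
    ultimately have "y = x \<or> y = - x" by auto
    then show False using nx y(1) by blast
  qed
  have "finite (if x \<in> D \<or> - x \<in> D then {} else P 1 \<union> P (- 1))"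
  proof (cases "x \<in> D \<or> - x \<in> D")
    case False
    then have "finite (P 1 \<union> P (- 1))" using fin[of 1] fin[of "- 1"] by simp
    then show ?thesis unfolding if_not_P[OF False] .
  qed simp
  with sub have "finite {a \<in> {0<..<pi}. \<exists>y. geodesic_line K x (u a) \<inter> D = {y}}" by (rule finite_subset)
  then show ?thesis by (simp only: u_def)
qed

text \<open>Of three boundary points on a short arc, the middle one would be a positive combination
  of the outer two.\<close>

lemma finite_boundary_on_geodesic:
  assumes v: "unit_tangent K p v" and m: "short K m"
  shows "finite {l \<in> {0<..<m}. geod K p v l \<in> boundaryK K D}"
proof (rule finite_if_no_three, clarsimp)
  fix a b c assume *: "0 < a" "a < b" "b < c" "c < m" and B: "geod K p v a \<in> boundaryK K D"
    "geod K p v b \<in> boundaryK K D" "geod K p v c \<in> boundaryK K D"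
  have sh: "short K (c - a)" "short K (c - b)" "short K (b - a)" using * by (auto intro: short_mono[OF m])
  have "0 < sinK K (c - a)" "0 < sinK K (c - b)" "0 < sinK K (b - a)" "geod K p v a \<noteq> geod K p v c"
    using * sh geod_neq[OF v _ sh(1)] by (auto intro!: sinK_pos)
  then show False
    using combination_not_boundary[OF _ _ _ _ _ _ geod_combination_general[of K c a p v b]] B boundary_subset by blast
qed

text \<open>Great circles through a point also contain its antipode, which is why
  \<open>finite_touching_through\<close> excludes both from the boundary.\<close>

lemma finite_antipodal_boundary_on_geodesic:
  assumes v: "unit_tangent K p v" and m: "short K m"
  shows "finite {l \<in> {0<..<m}. - geod K p v l \<in> boundaryK K D}"
proof (cases "K > 0")
  case True
  then have "unit_tangent K (- p) (- v)" using v by (simp add: unit_tangent_def tangent_def space_form_iff qform_linear)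
  moreover have "geod K (- p) (- v) = (\<lambda>l. - geod K p v l)" by (simp add: geod_def fun_eq_iff)
  ultimately show ?thesis using finite_boundary_on_geodesic[of "- p" "- v", OF _ m] by simp
next
  case False
  have "- geod K p v l \<notin> boundaryK K D" for l
    using False space_form_minus[OF unit_tangent_geod(2)[OF v, of l]] boundary_subset D_space_form by blast
  then show ?thesis by simp
qed

end

section \<open>The boundary curve and the distance between two boundary points\<close>

lemma has_field_derivative_component:
  assumes "(c has_vector_derivative c') (at t)" shows "((\<lambda>t. c t $ i) has_field_derivative c' $ i) (at t)"
  using bounded_linear.has_vector_derivative[OF bounded_linear_vec_nth assms, of i]
  by (simp add: has_real_derivative_iff_has_vector_derivative)

text \<open>For points at distance \<open>r\<close>, the expression
  \<open>Q - K * Q\<^sup>2 / 4\<close> is \<open>(sinK K r)\<^sup>2\<close> and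
  \<open>1 - K * Q / 2\<close> is \<open>cosK K r\<close>. The first identity will produce the mixed
  derivative of the distance, the second bounds its first derivatives.\<close>

lemma tangent_gram:
  assumes x: "x \<in> space_form K" and y: "y \<in> space_form K" and a: "tangent K x a"
    and Q: "Q = qform K (x - y) (x - y)"
  shows "tangent K y b \<Longrightarrow> (cross3 x y \<bullet> a) * (cross3 x y \<bullet> b) = vol2 K *
      (qform K a b * (Q - K * Q\<^sup>2 / 4) - qform K (x - y) a * qform K (x - y) b * (1 - K * Q / 2))"
    and "(cross3 x y \<bullet> a)\<^sup>2 = vol2 K * (qform K a a * (Q - K * Q\<^sup>2 / 4) - (qform K (x - y) a)\<^sup>2)"
proof -
  define p where "p = qform K x y"
  consider (zero) "K = 0" | (nonzero) "K \<noteq> 0" by blast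
  then have "(tangent K y b \<longrightarrow> (cross3 x y \<bullet> a) * (cross3 x y \<bullet> b) = vol2 K *
      (qform K a b * (Q - K * Q\<^sup>2 / 4) - qform K (x - y) a * qform K (x - y) b * (1 - K * Q / 2))) \<and>
    (cross3 x y \<bullet> a)\<^sup>2 = vol2 K * (qform K a a * (Q - K * Q\<^sup>2 / 4) - (qform K (x - y) a)\<^sup>2)"
  proof cases
    case zero
    then have 3: "x$3 = 1" "y$3 = 1" "a$3 = 0" "tangent K y b \<Longrightarrow> b$3 = 0"
      using x y a by (auto simp: space_form_iff tangent_def)
    have d: "cross3 x y \<bullet> z = (x$2 - y$2) * z$1 - (x$1 - y$1) * z$2" if "z$3 = 0" for z
      using 3 that by (simp add: cross3_simps)
    show ?thesis using zero 3
      by (auto simp: d Q vol2_def qform_def power2_eq_square algebra_simps)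
  next
    case nonzero
    have xx: "qform K x x = 1 / K" "qform K y y = 1 / K" "qform K x a = 0" "qform K a x = 0"
        "qform K y x = p" "qform K x y = p"
      using x y a nonzero by (auto simp: space_form_iff tangent_def p_def qform_commute[of K y x] qform_commute[of K a x])
    have Qp: "Q = 2 / K - 2 * p" unfolding Q by (simp add: qform_linear xx)
    have S: "Q - K * Q\<^sup>2 / 4 = 1 / K - K * p\<^sup>2" and C: "1 - K * Q / 2 = K * p"
      using nonzero by (simp_all add: Qp power2_eq_square field_simps)
    have v: "vol2 K = sgn K / K" using nonzero by (simp add: vol2_def sgn_if)
    have 1: "(cross3 x y \<bullet> a) * (cross3 x y \<bullet> b) = vol2 K *
      (qform K a b * (Q - K * Q\<^sup>2 / 4) - qform K (x - y) a * qform K (x - y) b * (1 - K * Q / 2))" if "tangent K y b"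
    proof -
      have "qform K y b = 0" using that nonzero by (simp add: tangent_def)
      then show ?thesis unfolding S C v gram_qform[OF nonzero] using nonzero
        by (simp add: xx qform_linear power2_eq_square field_simps)
    qed
    have "(cross3 x y \<bullet> a)\<^sup>2 = vol2 K * (qform K a a * (Q - K * Q\<^sup>2 / 4) - (qform K (x - y) a)\<^sup>2)"
      unfolding S v power2_eq_square[of "cross3 x y \<bullet> a"] gram_qform[OF nonzero] using nonzero
      by (simp add: xx qform_linear power2_eq_square field_simps)
    with 1 show ?thesis by blast
  qed
  then show "tangent K y b \<Longrightarrow> (cross3 x y \<bullet> a) * (cross3 x y \<bullet> b) = vol2 K *
      (qform K a b * (Q - K * Q\<^sup>2 / 4) - qform K (x - y) a * qform K (x - y) b * (1 - K * Q / 2))"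
    and "(cross3 x y \<bullet> a)\<^sup>2 = vol2 K * (qform K a a * (Q - K * Q\<^sup>2 / 4) - (qform K (x - y) a)\<^sup>2)" by blast+
qed

text \<open>The distance \<open>r\<close> of two points and \<open>sinK K r\<close>, as functions of \<open>Q = 4 * (sinK K (r / 2))\<^sup>2\<close>.\<close>
definition dist_of_Q :: "real \<Rightarrow> real \<Rightarrow> real" where "dist_of_Q K Q = 2 * arcsinK K (sqrt Q / 2)"
definition sin_of_Q :: "real \<Rightarrow> real \<Rightarrow> real" where "sin_of_Q K Q = sqrt (Q - K * Q\<^sup>2 / 4)"

lemma radicand_pos: fixes Q :: real assumes "0 < Q" "K * Q < 4" shows "0 < Q - K * Q\<^sup>2 / 4"
proof -
  have "0 < Q * (4 - K * Q)" using assms by simp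
  then show ?thesis by (simp add: power2_eq_square algebra_simps)
qed

lemma sin_of_Q_pos: "0 < Q \<Longrightarrow> K * Q < 4 \<Longrightarrow> 0 < sin_of_Q K Q"
  unfolding sin_of_Q_def real_sqrt_gt_0_iff by (rule radicand_pos)

lemma Q_of_dist:
  assumes "0 < r" "short K r"
  shows "dist_of_Q K (4 * (sinK K (r / 2))\<^sup>2) = r" "sin_of_Q K (4 * (sinK K (r / 2))\<^sup>2) = sinK K r"
    "0 < 4 * (sinK K (r / 2))\<^sup>2" "K * (4 * (sinK K (r / 2))\<^sup>2) < 4"
proof -
  have s: "0 < sinK K (r / 2)" using assms by (intro sinK_pos short_mono[OF assms(2)]) auto
  have c: "0 < cosK K (r / 2)" using assms by (intro cosK_pos) auto
  have "sqrt (4 * (sinK K (r / 2))\<^sup>2) / 2 = sinK K (r / 2)" using s by (simp add: real_sqrt_mult)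
  then show "dist_of_Q K (4 * (sinK K (r / 2))\<^sup>2) = r"
    using arcsinK_sinK[of "r / 2" K] assms by (simp add: dist_of_Q_def)
  have "4 * (sinK K (r / 2))\<^sup>2 - K * (4 * (sinK K (r / 2))\<^sup>2)\<^sup>2 / 4 = 4 * (sinK K (r / 2))\<^sup>2 * (1 - K * (sinK K (r / 2))\<^sup>2)"
    by (simp add: power2_eq_square algebra_simps)
  also have "1 - K * (sinK K (r / 2))\<^sup>2 = (cosK K (r / 2))\<^sup>2" using cosK_sinK_squared[of K "r / 2"] by simp
  also have "4 * (sinK K (r / 2))\<^sup>2 * (cosK K (r / 2))\<^sup>2 = (sinK K r)\<^sup>2"
    by (subst sinK_double[of K r]) (simp add: power_mult_distrib)
  finally show "sin_of_Q K (4 * (sinK K (r / 2))\<^sup>2) = sinK K r"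
    using sinK_pos[OF assms] by (simp add: sin_of_Q_def)
  show "0 < 4 * (sinK K (r / 2))\<^sup>2" using s by simp
  have "0 < (cosK K (r / 2))\<^sup>2" using c by simp
  then show "K * (4 * (sinK K (r / 2))\<^sup>2) < 4" using cosK_sinK_squared[of K "r / 2"] by linarith
qed

lemma has_field_derivative_dist_of_Q:
  assumes "0 < Q" "K * Q < 4"
  shows "(dist_of_Q K has_field_derivative 1 / (2 * sin_of_Q K Q)) (at Q)"
proof -
  have sq: "(sqrt Q / 2)\<^sup>2 = Q / 4" using assms by (simp add: power_divide)
  have 1: "((\<lambda>Q. sqrt Q / 2) has_field_derivative inverse (sqrt Q) / 2 / 2) (at Q)"
    using assms by (auto intro!: derivative_eq_intros)
  have 2: "(arcsinK K has_field_derivative 1 / sqrt (1 - K * (sqrt Q / 2)\<^sup>2)) (at (sqrt Q / 2))"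
    using assms by (intro has_field_derivative_arcsinK) (auto simp: sq)
  have "sin_of_Q K Q = sqrt Q * sqrt (1 - K * Q / 4)"
    unfolding sin_of_Q_def real_sqrt_mult[symmetric] by (simp add: power2_eq_square algebra_simps)
  then show ?thesis
    using DERIV_cmult[OF DERIV_chain2[OF 2 1], of 2] unfolding sq dist_of_Q_def
    by (simp add: field_simps)
qed

lemma has_field_derivative_sin_of_Q:
  assumes "0 < Q" "K * Q < 4"
  shows "(sin_of_Q K has_field_derivative (1 - K * Q / 2) / (2 * sin_of_Q K Q)) (at Q)"
  unfolding sin_of_Q_def using radicand_pos[OF assms]
  by (auto intro!: derivative_eq_intros simp: field_simps)

lemma dist_of_Q_0 [simp]: "dist_of_Q K 0 = 0"
  by (simp add: dist_of_Q_def arcsinK_def)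

text \<open>Includes \<open>Q = 0\<close>, where the square root has no derivative; this is
  continuity of the distance on the diagonal, on which the boundary terms depend.\<close>

lemma isCont_dist_of_Q: assumes "0 \<le> Q" "K * Q < 4" shows "isCont (dist_of_Q K) Q"
proof -
  have "(sqrt Q / 2)\<^sup>2 = Q / 4" using assms by (simp add: power_divide)
  then have "K * (sqrt Q / 2)\<^sup>2 < 1" using assms by (simp only:)
  then have "isCont (arcsinK K) (sqrt Q / 2)"
    using has_field_derivative_arcsinK[of "sqrt Q / 2" K, THEN DERIV_isCont] assms by simp
  moreover have "isCont (\<lambda>Q. sqrt Q / 2) Q" by (intro continuous_intros) simp
  ultimately have "isCont (\<lambda>Q. arcsinK K (sqrt Q / 2)) Q" by (rule isCont_o2[rotated])
  then show ?thesis unfolding dist_of_Q_def by (intro continuous_intros)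
qed

section \<open>The periodic parametrization and the derivatives of the distance function\<close>

locale smooth_domain = convex_domain +
  fixes c :: "real \<Rightarrow> real^3" and T :: real
  assumes param: "C1_closed_curve_param (boundaryK K D) c T"
begin

definition c' :: "real \<Rightarrow> real^3" where "c' s = vector_derivative c (at s)"

lemma T_pos: "0 < T" and c_period: "c (s + T) = c s" and c_inj: "inj_on c {0..<T}"
    and c_image: "c ` {0..<T} = boundaryK K D" and c'_nonzero: "c' s \<noteq> 0"
  using param by (auto simp: C1_closed_curve_param_def c'_def)

lemma c_deriv: "(c has_vector_derivative c' s) (at s)" and c'_continuous: "continuous_on UNIV c'"
  using param unfolding C1_closed_curve_param_def C1_differentiable_on_eq c'_def[abs_def]
  by (auto simp: vector_derivative_works)

lemma c_continuous: "continuous_on A c"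
  using c_deriv by (meson continuous_at_imp_continuous_on has_vector_derivative_continuous)

lemma c'_continuous_on: "continuous_on A c'"
  using c'_continuous continuous_on_subset by blast

lemma c'_period: "c' (s + T) = c' s"
proof -
  have "((\<lambda>u. c (u + T)) has_vector_derivative c' (s + T)) (at s)"
  proof -
    have "((\<lambda>u. u + T) has_vector_derivative 1) (at s)" by (auto intro!: derivative_eq_intros)
    from vector_diff_chain_at[OF this, of c "c' (s + T)"] show ?thesis using c_deriv[of "s + T"] by (simp add: o_def)
  qed
  then show ?thesis using c_deriv[of s] vector_derivative_unique_at by (simp add: c_period)
qed

lemma period_nat: "c (s + real n * T) = c s \<and> c' (s + real n * T) = c' s"
proof (induction n)
  case (Suc n)
  have "s + real (Suc n) * T = (s + real n * T) + T" by (simp add: algebra_simps)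
  then show ?case using Suc by (simp only: c_period c'_period)
qed simp

lemma period_int: "c (s + real_of_int k * T) = c s \<and> c' (s + real_of_int k * T) = c' s"
proof (cases "0 \<le> k")
  case True
  then show ?thesis using period_nat[of s "nat k"] by simp
next
  case False
  then show ?thesis using period_nat[of "s + real_of_int k * T" "nat (- k)"] by (simp add: algebra_simps)
qed

lemma period_reduce: obtains k where "0 \<le> s + real_of_int k * T" "s + real_of_int k * T < T"
proof
  have "of_int \<lfloor>s / T\<rfloor> \<le> s / T" "s / T < of_int \<lfloor>s / T\<rfloor> + 1" by linarith+
  then have "of_int \<lfloor>s / T\<rfloor> * T \<le> s" "s < (of_int \<lfloor>s / T\<rfloor> + 1) * T"
    by (simp_all only: pos_le_divide_eq[OF T_pos] pos_divide_less_eq[OF T_pos])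
  then show "0 \<le> s + real_of_int (- \<lfloor>s / T\<rfloor>) * T" "s + real_of_int (- \<lfloor>s / T\<rfloor>) * T < T"
    by (simp_all add: algebra_simps)
qed

lemma c_boundary: "c s \<in> boundaryK K D"
proof -
  obtain k where "0 \<le> s + real_of_int k * T" "s + real_of_int k * T < T" using period_reduce .
  then have "c (s + real_of_int k * T) \<in> boundaryK K D" unfolding c_image[symmetric] by (intro imageI) simp
  then show ?thesis using period_int by simp
qed

lemma c_D: "c s \<in> D" and c_space_form: "c s \<in> space_form K"
  using c_boundary boundary_subset D_space_form by auto

text \<open>Injectivity is given on one period only. Moving \<open>s\<close> there may leave
  \<open>t\<close> beyond its end, and then \<open>t\<close> is moved back by one more
  period.\<close>

lemma c_neq: assumes "s < t" "t < s + T" shows "c s \<noteq> c t"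
proof -
  obtain k where k: "0 \<le> s + real_of_int k * T" "s + real_of_int k * T < T" using period_reduce .
  define s' t' where "s' = s + real_of_int k * T" and "t' = t + real_of_int k * T"
  have *: "c s' = c s" "c t' = c t" using period_int by (simp_all add: s'_def t'_def)
  have st: "0 \<le> s'" "s' < T" "s' < t'" "t' < s' + T" using k assms by (auto simp: s'_def t'_def)
  have "c s' \<noteq> c t'"
  proof (cases "t' < T")
    case True
    then show ?thesis using inj_onD[OF c_inj, of s' t'] st by auto
  next
    case False
    then have "c s' \<noteq> c (t' - T)" using inj_onD[OF c_inj, of s' "t' - T"] st by auto
    then show ?thesis using c_period[of "t' - T"] by simp
  qed
  then show ?thesis using * by simp
qed

lemma c'_tangent: "tangent K (c s) (c' s)"
proof (cases "K = 0")
  case True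
  then have "c s $ 3 = 1" for s using c_space_form[of s] by (simp add: space_form_iff)
  then have "c' s $ 3 = 0"
    using DERIV_unique[OF has_field_derivative_component[OF c_deriv[of s], of 3], of 0] by simp
  then show ?thesis using True c_space_form by (simp add: tangent_def)
next
  case False
  have "((\<lambda>s. qform K (c s) (c s)) has_field_derivative 2 * qform K (c s) (c' s)) (at s)"
    unfolding qform_def by (auto intro!: derivative_eq_intros has_field_derivative_component[OF c_deriv] simp: algebra_simps)
  moreover have "(\<lambda>s. qform K (c s) (c s)) = (\<lambda>s. 1 / K)" using False c_space_form by (auto simp: space_form_iff)
  ultimately have "((\<lambda>s. 1 / K) has_field_derivative 2 * qform K (c s) (c' s)) (at s)" by simp
  from DERIV_unique[OF this DERIV_const] have "2 * qform K (c s) (c' s) = 0" .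
  then show ?thesis using False c_space_form by (simp add: tangent_def)
qed

definition speed :: "real \<Rightarrow> real" where "speed s = sqrt (qform K (c' s) (c' s))"

lemma speed_pos: "0 < speed s" and speed_squared: "(speed s)\<^sup>2 = qform K (c' s) (c' s)"
  using tangent_qform_pos[OF c'_tangent c'_nonzero, of s] by (simp_all add: speed_def)

lemma speed_continuous: "continuous_on A speed"
  unfolding speed_def qform_def by (intro continuous_intros c'_continuous_on)

definition Q :: "real \<Rightarrow> real \<Rightarrow> real" where "Q s t = qform K (c s - c t) (c s - c t)"
definition rho :: "real \<Rightarrow> real \<Rightarrow> real" where "rho s t = dist_of_Q K (Q s t)"
definition S :: "real \<Rightarrow> real \<Rightarrow> real" where "S s t = sin_of_Q K (Q s t)"
text \<open>First variation of length: at distinct endpoints this is minus the component of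
  \<open>c' s\<close> along the initial direction of the chord. Its form in terms of
  \<open>Q\<close> avoids mention of that direction.\<close>

definition rho1 :: "real \<Rightarrow> real \<Rightarrow> real" where "rho1 s t = qform K (c s - c t) (c' s) / S s t"
definition rho2 :: "real \<Rightarrow> real \<Rightarrow> real" where "rho2 s t = - qform K (c s - c t) (c' t) / S s t"

text \<open>The mixed derivative of \<open>rho\<close>; the product form is a Gram determinant identity.\<close>
definition J :: "real \<Rightarrow> real \<Rightarrow> real" where
  "J s t = - (cross3 (c s) (c t) \<bullet> c' s) * (cross3 (c s) (c t) \<bullet> c' t) / (vol2 K * S s t ^ 3)"

lemma chord_data:
  assumes "c s \<noteq> c t"
  obtains w where "is_chord K D (geodesic_line K (c s) w) (c s) w (rho s t)" "0 < rho s t"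
    "c t = geod K (c s) w (rho s t)" "S s t = sinK K (rho s t)" "0 < Q s t" "K * Q s t < 4"
proof -
  obtain w r where wr: "unit_tangent K (c s) w" "0 < r" "short K r" "c t = geod K (c s) w r"
    using segment_between[OF c_D c_D assms] .
  have Q: "Q s t = 4 * (sinK K (r / 2))\<^sup>2" unfolding Q_def wr(4) by (rule chord_qform_0[OF wr(1)])
  have r: "rho s t = r" "S s t = sinK K r" "0 < Q s t" "K * Q s t < 4"
    using Q_of_dist[OF wr(2,3)] by (simp_all add: rho_def S_def Q)
  have "is_chord K D (geodesic_line K (c s) w) (c s) w r"
    using chord_through[OF c_boundary _ wr(1-3)] c_boundary[of t] wr(4) by simp
  then show thesis using that[of w] r wr by simp
qed

lemma Q_bounds: "0 \<le> Q s t" "K * Q s t < 4"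
proof -
  have "0 \<le> Q s t \<and> K * Q s t < 4"
  proof (cases "c s = c t")
    case False
    then show ?thesis using chord_data[OF False] by (metis less_imp_le)
  qed (simp add: Q_def qform_def)
  then show "0 \<le> Q s t" "K * Q s t < 4" by auto
qed

lemma Q_pos: "c s \<noteq> c t \<Longrightarrow> 0 < Q s t" and S_pos: "c s \<noteq> c t \<Longrightarrow> 0 < S s t"
proof -
  assume "c s \<noteq> c t"
  then show "0 < Q s t" using chord_data by metis
  then show "0 < S s t" unfolding S_def using Q_bounds by (intro sin_of_Q_pos)
qed

lemma Q_deriv:
  "((\<lambda>t. Q s t) has_field_derivative - 2 * qform K (c s - c t) (c' t)) (at t)"
  "((\<lambda>s. Q s t) has_field_derivative 2 * qform K (c s - c t) (c' s)) (at s)"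
  unfolding Q_def qform_def
  by (auto intro!: derivative_eq_intros has_field_derivative_component[OF c_deriv] simp: algebra_simps)

lemma rho_deriv:
  assumes "c s \<noteq> c t"
  shows "((\<lambda>t. rho s t) has_field_derivative rho2 s t) (at t)"
    and "((\<lambda>s. rho s t) has_field_derivative rho1 s t) (at s)"
proof -
  note d = has_field_derivative_dist_of_Q[OF Q_pos[OF assms] Q_bounds(2)]
  show "((\<lambda>t. rho s t) has_field_derivative rho2 s t) (at t)"
    using DERIV_chain2[OF d Q_deriv(1)] by (simp add: rho_def rho2_def S_def)
  show "((\<lambda>s. rho s t) has_field_derivative rho1 s t) (at s)"
    using DERIV_chain2[OF d Q_deriv(2)] by (simp add: rho_def rho1_def S_def)
qed

text \<open>Only \<open>c t\<close> varies, so the first derivative of the curve is enough. The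
  quotient rule gives the Gram expression of \<open>tangent_gram\<close>, which factors into two
  determinants.\<close>

lemma rho1_deriv:
  assumes "c s \<noteq> c t" shows "((\<lambda>t. rho1 s t) has_field_derivative J s t) (at t)"
proof -
  note S0 = S_pos[OF assms]
  have S2: "(S s t)\<^sup>2 = Q s t - K * (Q s t)\<^sup>2 / 4"
    using radicand_pos[OF Q_pos[OF assms] Q_bounds(2)] by (simp add: S_def sin_of_Q_def)
  define A where "A = qform K (c s - c t) (c' s)"
  define B where "B = qform K (c s - c t) (c' t)"
  define C where "C = qform K (c' s) (c' t)"
  have dS: "((\<lambda>t. S s t) has_field_derivative (1 - K * Q s t / 2) / (2 * S s t) * (- 2 * B)) (at t)"
    unfolding S_def B_def
    by (rule DERIV_chain2[OF has_field_derivative_sin_of_Q[OF Q_pos[OF assms] Q_bounds(2)] Q_deriv(1)])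
  have dA: "((\<lambda>t. qform K (c s - c t) (c' s)) has_field_derivative - C) (at t)"
    unfolding C_def qform_def
    by (auto intro!: derivative_eq_intros has_field_derivative_component[OF c_deriv] simp: algebra_simps)
  have "((\<lambda>t. rho1 s t) has_field_derivative
      (- C * S s t - A * ((1 - K * Q s t / 2) / (2 * S s t) * (- 2 * B))) / (S s t * S s t)) (at t)"
    unfolding rho1_def A_def by (rule DERIV_divide[OF dA dS]) (use S0 in simp)
  moreover have "(- C * S s t - A * ((1 - K * Q s t / 2) / (2 * S s t) * (- 2 * B))) / (S s t * S s t) =
      - (C * (S s t)\<^sup>2 - A * B * (1 - K * Q s t / 2)) / S s t ^ 3"
    using S0 by (simp add: field_simps power2_eq_square power3_eq_cube)
  moreover have "\<dots> = J s t"
    using tangent_gram(1)[OF c_space_form c_space_form c'_tangent Q_def c'_tangent, of s t] vol2_pos[of K]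
    by (simp add: J_def S2 A_def B_def C_def minus_divide_left)
  ultimately show ?thesis by simp
qed

text \<open>The squared determinant in \<open>tangent_gram\<close> is nonnegative; in terms of
  angles this says that a cosine is at most 1 in absolute value.\<close>

lemma rho_partials_bound:
  assumes "c s \<noteq> c t" shows "\<bar>rho1 s t\<bar> \<le> speed s" "\<bar>rho2 s t\<bar> \<le> speed t"
proof -
  note S0 = S_pos[OF assms]
  have S2: "(S s t)\<^sup>2 = Q s t - K * (Q s t)\<^sup>2 / 4"
    using radicand_pos[OF Q_pos[OF assms] Q_bounds(2)] by (simp add: S_def sin_of_Q_def)
  have *: "\<bar>q / S s t\<bar> \<le> speed u" if "q\<^sup>2 \<le> qform K (c' u) (c' u) * (S s t)\<^sup>2" for q u
  proof -
    have "\<bar>q\<bar> \<le> \<bar>speed u * S s t\<bar>"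
      using that by (intro abs_le_square_iff[THEN iffD2]) (simp add: power_mult_distrib speed_squared)
    then show ?thesis using S0 speed_pos[of u] by (simp add: abs_mult field_simps)
  qed
  have "0 \<le> vol2 K * (qform K (c' s) (c' s) * (S s t)\<^sup>2 - (qform K (c s - c t) (c' s))\<^sup>2)"
    unfolding S2 tangent_gram(2)[OF c_space_form c_space_form c'_tangent Q_def, symmetric] by simp
  then show "\<bar>rho1 s t\<bar> \<le> speed s"
    unfolding rho1_def using vol2_pos[of K] by (intro *) (simp add: zero_le_mult_iff)
  have Q': "Q s t = qform K (c t - c s) (c t - c s)" by (simp add: Q_def qform_def algebra_simps)
  have "0 \<le> vol2 K * (qform K (c' t) (c' t) * (S s t)\<^sup>2 - (qform K (c t - c s) (c' t))\<^sup>2)"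
    unfolding S2 tangent_gram(2)[OF c_space_form c_space_form c'_tangent Q', symmetric] by simp
  then have "\<bar>qform K (c t - c s) (c' t) / S s t\<bar> \<le> speed t"
    using vol2_pos[of K] by (intro *) (simp add: zero_le_mult_iff)
  moreover have "qform K (c t - c s) (c' t) = - qform K (c s - c t) (c' t)" by (simp add: qform_linear)
  ultimately show "\<bar>rho2 s t\<bar> \<le> speed t" by (simp add: rho2_def)
qed

lemma line_meets_boundary:
  assumes "s < t" "t < s + T" "s \<le> u" "u < s + T" "cross3 (c s) (c t) \<bullet> c u = 0" shows "u = s \<or> u = t"
proof -
  have ne: "c s \<noteq> c t" using c_neq assms by blast
  obtain w where w: "is_chord K D (geodesic_line K (c s) w) (c s) w (rho s t)" "0 < rho s t"
    "c t = geod K (c s) w (rho s t)" "S s t = sinK K (rho s t)" using chord_data[OF ne] by metis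
  have "cross3 (c s) (c t) = S s t *\<^sub>R cross3 (c s) w"
    unfolding w(4) by (subst w(3)) (simp add: geod_def cross_add_right cross_mult_right)
  then have "cross3 (c s) w \<bullet> c u = 0" using assms(5) S_pos[OF ne] by simp
  then have "c u \<in> geodesic_line K (c s) w"
    using geodesic_line_eq is_chordD(1)[OF w(1)] c_space_form by blast
  then have "c u = c s \<or> c u = c t" using boundary_of_chord[OF w(1) _ c_boundary] w(3) by simp
  moreover have "c s \<noteq> c u" if "s < u" using c_neq[of s u] that assms by simp
  moreover have "c u \<noteq> c t" if "u < t" using c_neq[of u t] that assms by simp
  moreover have "c t \<noteq> c u" if "t < u" using c_neq[of t u] that assms by simp
  ultimately show ?thesis using assms by (metis linorder_neqE_linordered_idom order_le_less)
qed

lemma J_nonneg: assumes st: "s < t" "t < s + T" shows "0 \<le> J s t"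
proof -
  \<comment> \<open>The curve meets the line through its points at \<open>s\<close> and \<open>t\<close> nowhere else, so it stays on one side in between.\<close>
  define N where "N = cross3 (c s) (c t)"
  define g where "g = (\<lambda>u. N \<bullet> c u)"
  have dg: "(g has_field_derivative N \<bullet> c' u) (at u)" for u
    unfolding g_def using has_derivative_inner_right[OF c_deriv[of u, unfolded has_vector_derivative_def], of N]
    by (simp add: has_field_derivative_def mult.commute[of "N \<bullet> c' u"] mult_commute_abs)
  have cont: "continuous_on A g" for A unfolding g_def by (intro continuous_intros c_continuous)
  have g0: "g s = 0" "g t = 0" by (simp_all add: g_def N_def dot_cross_self)
  have gn: "g u \<noteq> 0" if "u \<in> {s<..<t}" for u
    using line_meets_boundary[OF st, of u] that st by (auto simp: g_def N_def)
  have key: "h'1 * h'2 \<le> 0" if h: "\<And>u. u \<in> {s<..<t} \<Longrightarrow> 0 < h u" "h s = 0" "h t = 0"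
    "(h has_field_derivative h'1) (at s)" "(h has_field_derivative h'2) (at t)" for h h'1 h'2
  proof -
    have "0 \<le> h'1"
    proof (rule ccontr)
      assume "\<not> 0 \<le> h'1"
      then obtain d where d: "d > 0" "\<And>e. 0 < e \<Longrightarrow> e < d \<Longrightarrow> h (s + e) < h s"
        using DERIV_neg_dec_right[OF h(4)] by force
      have "h (s + min (d / 2) ((t - s) / 2)) < 0" using d st h by (auto simp: min_def)
      moreover have "0 < h (s + min (d / 2) ((t - s) / 2))" using d st by (intro h) (auto simp: min_def field_simps)
      ultimately show False by simp
    qed
    moreover have "h'2 \<le> 0"
    proof (rule ccontr)
      assume "\<not> h'2 \<le> 0"
      then obtain d where d: "d > 0" "\<And>e. 0 < e \<Longrightarrow> e < d \<Longrightarrow> h (t - e) < h t"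
        using DERIV_pos_inc_left[OF h(5)] by force
      have "h (t - min (d / 2) ((t - s) / 2)) < 0" using d st h by (auto simp: min_def)
      moreover have "0 < h (t - min (d / 2) ((t - s) / 2))" using d st by (intro h) (auto simp: min_def field_simps)
      ultimately show False by simp
    qed
    ultimately show ?thesis by (rule mult_nonneg_nonpos)
  qed
  have "(\<forall>u\<in>{s<..<t}. 0 < g u) \<or> (\<forall>u\<in>{s<..<t}. g u < 0)"
  proof (rule ccontr)
    assume "\<not> ?thesis"
    then obtain a b where ab: "a \<in> {s<..<t}" "b \<in> {s<..<t}" "g a < 0" "0 < g b" using gn by force
    have "connected (g ` {s<..<t})" by (intro connected_continuous_image cont) simp
    then have "0 \<in> g ` {s<..<t}" using connectedD_interval[of "g ` {s<..<t}" "g a" "g b" 0] ab by auto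
    then show False using gn by auto
  qed
  then have "(N \<bullet> c' s) * (N \<bullet> c' t) \<le> 0"
  proof
    assume "\<forall>u\<in>{s<..<t}. 0 < g u" then show ?thesis using key[of g] g0 dg by blast
  next
    assume "\<forall>u\<in>{s<..<t}. g u < 0"
    then have "(- (N \<bullet> c' s)) * (- (N \<bullet> c' t)) \<le> 0"
      using g0 by (intro key[of "\<lambda>u. - g u"] DERIV_minus dg) auto
    then show ?thesis by simp
  qed
  then have "0 \<le> - (N \<bullet> c' s) * (N \<bullet> c' t)" by simp
  then show ?thesis unfolding J_def N_def using vol2_pos[of K] S_pos[OF c_neq[OF st]]
    by (intro divide_nonneg_nonneg) auto
qed

lemma rho_diagonal [simp]: "rho s s = 0" "rho 0 T = 0"
  using c_period[of 0] by (simp_all add: rho_def Q_def qform_def)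

text \<open>Numerator and denominator are divided by \<open>t - s\<close>. Since \<open>Q\<close> is
  a quadratic form of the increment of \<open>c\<close>, the quotient
  \<open>Q s t / (t - s)\<^sup>2\<close> tends to the squared speed, and
  \<open>S s t / (t - s)\<close> to the speed. The sign is negative because moving \<open>s\<close>
  towards \<open>t\<close> shortens the chord.\<close>

lemma rho1_limit: "((\<lambda>t. rho1 s t) \<longlongrightarrow> - speed s) (at_right s)"
proof -
  have d: "((\<lambda>t. (c t $ i - c s $ i) / (t - s)) \<longlongrightarrow> c' s $ i) (at_right s)" for i
    using has_field_derivative_component[OF c_deriv[of s], of i] unfolding has_field_derivative_iff
    by (rule tendsto_within_subset) simp
  have ev: "eventually (\<lambda>t. s < t \<and> t < s + T) (at_right s)"
    using T_pos by (auto simp: eventually_at_right[of s "s + T"] intro: exI[of _ "s + T"])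
  have "((\<lambda>t. ((c t $ 1 - c s $ 1) / (t - s))\<^sup>2 + ((c t $ 2 - c s $ 2) / (t - s))\<^sup>2
      + sgn K * ((c t $ 3 - c s $ 3) / (t - s))\<^sup>2) \<longlongrightarrow> (c' s $ 1)\<^sup>2 + (c' s $ 2)\<^sup>2 + sgn K * (c' s $ 3)\<^sup>2) (at_right s)"
    by (intro tendsto_intros d)
  also have "(\<lambda>t. ((c t $ 1 - c s $ 1) / (t - s))\<^sup>2 + ((c t $ 2 - c s $ 2) / (t - s))\<^sup>2
      + sgn K * ((c t $ 3 - c s $ 3) / (t - s))\<^sup>2) = (\<lambda>t. Q s t / (t - s)\<^sup>2)"
    by (simp add: Q_def qform_def power_divide add_divide_distrib[symmetric] power2_eq_square algebra_simps)
  also have sp: "(c' s $ 1)\<^sup>2 + (c' s $ 2)\<^sup>2 + sgn K * (c' s $ 3)\<^sup>2 = (speed s)\<^sup>2"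
    unfolding speed_squared by (simp add: qform_def power2_eq_square)
  finally have X: "((\<lambda>t. Q s t / (t - s)\<^sup>2) \<longlongrightarrow> (speed s)\<^sup>2) (at_right s)"
    .
  have "isCont (Q s) s" using Q_deriv(1)[of s s] by (rule DERIV_isCont)
  then have "(Q s \<longlongrightarrow> Q s s) (at s)" by (simp add: isCont_def)
  then have "(Q s \<longlongrightarrow> Q s s) (at_right s)" by (rule tendsto_within_subset) simp
  then have Q0: "(Q s \<longlongrightarrow> 0) (at_right s)" by (simp add: Q_def qform_def)
  have "((\<lambda>t. sqrt (Q s t / (t - s)\<^sup>2 * (1 - K * Q s t / 4))) \<longlongrightarrow> sqrt ((speed s)\<^sup>2 * (1 - K * 0 / 4))) (at_right s)"
    by (intro tendsto_intros X Q0) simp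
  then have "((\<lambda>t. sqrt (Q s t / (t - s)\<^sup>2 * (1 - K * Q s t / 4))) \<longlongrightarrow> speed s) (at_right s)"
    using speed_pos[of s] by simp
  moreover have "eventually (\<lambda>t. sqrt (Q s t / (t - s)\<^sup>2 * (1 - K * Q s t / 4)) = S s t / (t - s)) (at_right s)"
    using ev
  proof eventually_elim
    case (elim t)
    have "Q s t / (t - s)\<^sup>2 * (1 - K * Q s t / 4) = (Q s t - K * (Q s t)\<^sup>2 / 4) / (t - s)\<^sup>2"
      by (simp add: power2_eq_square algebra_simps)
    then show ?case using elim by (simp add: S_def sin_of_Q_def real_sqrt_divide)
  qed
  ultimately have S: "((\<lambda>t. S s t / (t - s)) \<longlongrightarrow> speed s) (at_right s)" by (rule Lim_transform_eventually)
  have "((\<lambda>t. qform K (c s - c t) (c' s)) has_field_derivative - (speed s)\<^sup>2) (at s)"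
    unfolding speed_squared qform_def
    by (auto intro!: derivative_eq_intros has_field_derivative_component[OF c_deriv] simp: algebra_simps)
  then have "((\<lambda>t. (qform K (c s - c t) (c' s) - qform K (c s - c s) (c' s)) / (t - s)) \<longlongrightarrow> - (speed s)\<^sup>2) (at_right s)"
    unfolding has_field_derivative_iff by (rule tendsto_within_subset) simp
  then have "((\<lambda>t. qform K (c s - c t) (c' s) / (t - s)) \<longlongrightarrow> - (speed s)\<^sup>2) (at_right s)"
    by (simp add: qform_def)
  from tendsto_divide[OF this S]
  have "((\<lambda>t. (qform K (c s - c t) (c' s) / (t - s)) / (S s t / (t - s))) \<longlongrightarrow> - speed s) (at_right s)"
    using speed_pos[of s] by (simp add: power2_eq_square)
  moreover have "eventually (\<lambda>t. (qform K (c s - c t) (c' s) / (t - s)) / (S s t / (t - s)) = rho1 s t) (at_right s)"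
    using ev by eventually_elim (simp add: rho1_def)
  ultimately show ?thesis by (rule Lim_transform_eventually)
qed

lemma continuous_on_Q2: "continuous_on A (\<lambda>x. Q (fst x) (snd x))"
  unfolding Q_def qform_def
  by (intro continuous_intros continuous_on_compose2[OF c_continuous[of UNIV]]) auto

lemma continuous_on_rho2: "continuous_on A (\<lambda>x. rho (fst x) (snd x))"
proof -
  have "continuous_on {q. 0 \<le> q \<and> K * q < 4} (dist_of_Q K)"
    by (intro continuous_at_imp_continuous_on ballI isCont_dist_of_Q) auto
  then show ?thesis unfolding rho_def
    by (rule continuous_on_compose2[OF _ continuous_on_Q2]) (use Q_bounds in auto)
qed

lemma continuous_on_partials:
  assumes "\<And>x. x \<in> A \<Longrightarrow> c (fst x) \<noteq> c (snd x)"
  shows "continuous_on A (\<lambda>x. rho1 (fst x) (snd x))" "continuous_on A (\<lambda>x. rho2 (fst x) (snd x))"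
    "continuous_on A (\<lambda>x. J (fst x) (snd x))"
proof -
  have S: "continuous_on A (\<lambda>x. S (fst x) (snd x))"
    unfolding S_def sin_of_Q_def by (intro continuous_intros continuous_on_Q2) auto
  have S0: "S (fst x) (snd x) \<noteq> 0" if "x \<in> A" for x using S_pos[OF assms[OF that]] by simp
  have c: "continuous_on A (\<lambda>x. c (fst x))" "continuous_on A (\<lambda>x. c (snd x))"
    "continuous_on A (\<lambda>x. c' (fst x))" "continuous_on A (\<lambda>x. c' (snd x))"
    by (auto intro!: continuous_intros continuous_on_compose2[OF c_continuous[of UNIV]]
        continuous_on_compose2[OF c'_continuous])
  show "continuous_on A (\<lambda>x. rho1 (fst x) (snd x))" "continuous_on A (\<lambda>x. rho2 (fst x) (snd x))"
    unfolding rho1_def rho2_def qform_def using S0 by (auto intro!: continuous_intros S c)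
  show "continuous_on A (\<lambda>x. J (fst x) (snd x))"
    unfolding J_def using S0 vol2_pos[of K]
    by (auto intro!: continuous_intros S c continuous_on_cross)
qed

end

section \<open>Integration over pairs of boundary points\<close>

context smooth_domain
begin

definition pairs :: "(real \<times> real) set" where "pairs = {(s, t). 0 \<le> s \<and> s < t \<and> t < T}"

lemma pairs_borel [measurable]: "pairs \<in> sets borel"
proof -
  have "pairs = ({0..} \<times> UNIV) \<inter> {x. fst x < snd x} \<inter> (UNIV \<times> {..<T})" by (auto simp: pairs_def)
  also have "\<dots> \<in> sets borel"
    by (intro sets.Int borel_closed borel_open closed_Times open_Times open_Collect_less continuous_intros) auto
  finally show ?thesis .
qed

lemma pairs_neq: "x \<in> pairs \<Longrightarrow> c (fst x) \<noteq> c (snd x)"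
  using c_neq[of "fst x" "snd x"] by (auto simp: pairs_def)

lemma speed_bound: obtains B where "0 < B" "\<And>s. s \<in> {0..T} \<Longrightarrow> speed s \<le> B"
proof -
  have "bounded (speed ` {0..T})" by (intro compact_imp_bounded compact_continuous_image speed_continuous) auto
  then obtain B where "0 < B" "\<And>s. s \<in> {0..T} \<Longrightarrow> norm (speed s) \<le> B" by (auto simp: bounded_pos)
  then show thesis using that by force
qed

lemma rho_bound:
  obtains R where "0 < R" "\<And>s t. s \<in> {0..T} \<Longrightarrow> t \<in> {0..T} \<Longrightarrow> \<bar>rho s t\<bar> \<le> R"
proof -
  have "bounded ((\<lambda>x. rho (fst x) (snd x)) ` ({0..T} \<times> {0..T}))"
    by (intro compact_imp_bounded compact_continuous_image continuous_on_rho2 compact_Times) auto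
  then obtain B where "0 < B" "\<And>x. x \<in> {0..T} \<times> {0..T} \<Longrightarrow> norm (rho (fst x) (snd x)) \<le> B" by (auto simp: bounded_pos)
  then show thesis using that[of B] by force
qed

lemma continuous_bound_rho:
  assumes "continuous_on UNIV f"
  obtains B where "0 < B" "\<And>s t. s \<in> {0..T} \<Longrightarrow> t \<in> {0..T} \<Longrightarrow> \<bar>f (rho s t)\<bar> \<le> (B::real)"
proof -
  have "bounded ((\<lambda>x. f (rho (fst x) (snd x))) ` ({0..T} \<times> {0..T}))"
    by (intro compact_imp_bounded compact_continuous_image compact_Times
        continuous_on_compose2[OF assms continuous_on_rho2]) auto
  then obtain B where "0 < B" "\<And>x. x \<in> {0..T} \<times> {0..T} \<Longrightarrow> norm (f (rho (fst x) (snd x))) \<le> B" by (auto simp: bounded_pos)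
  then show thesis using that[of B] by force
qed

lemma rho_continuous: "continuous_on A (\<lambda>t. rho s t)" "continuous_on A (\<lambda>s. rho s t)"
proof -
  have "continuous_on A (\<lambda>t. rho (fst (s, t)) (snd (s, t)))" "continuous_on A (\<lambda>s. rho (fst (s, t)) (snd (s, t)))"
    by (rule continuous_on_compose2[OF continuous_on_rho2[of UNIV]]; intro continuous_intros subset_UNIV)+
  then show "continuous_on A (\<lambda>t. rho s t)" "continuous_on A (\<lambda>s. rho s t)" by simp_all
qed

section \<open>Iterated integrals for a fixed function\<close>

context
  fixes f :: "real \<Rightarrow> real" assumes f: "f C1_differentiable_on UNIV"
begin

lemma f_deriv: "(f has_field_derivative deriv f x) (at x)" and deriv_continuous: "continuous_on UNIV (deriv f)"
    and f_continuous: "continuous_on UNIV f"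
proof -
  have d: "f differentiable at x" for x using f by (auto simp: C1_differentiable_on_eq)
  then show fd: "(f has_field_derivative deriv f x) (at x)" for x
    using DERIV_deriv_iff_real_differentiable by blast
  then have "vector_derivative f (at x) = deriv f x" for x
    by (intro vector_derivative_at) (simp add: has_real_derivative_iff_has_vector_derivative)
  then show "continuous_on UNIV (deriv f)" using f by (simp add: C1_differentiable_on_eq)
  show "continuous_on UNIV f" using fd by (intro continuous_at_imp_continuous_on) (auto intro: DERIV_isCont)
qed

text \<open>The fundamental theorem of calculus in \<open>t\<close>. The case \<open>s = 0\<close>
  is left out because \<open>t = T\<close> would then return to the same boundary point.\<close>

lemma inner_has_integral:
  assumes "0 < s" "s < T"
  shows "((\<lambda>t. deriv f (rho s t) * (rho1 s t * rho2 s t) + f (rho s t) * J s t) has_integral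
    f (rho s T) * rho1 s T + f 0 * speed s) {s..T}"
proof -
  \<comment> \<open>The antiderivative is extended to the diagonal by its limit, known from
    \<open>rho1_limit\<close>; below \<open>s\<close> the value is arbitrary.\<close>
  define g where "g = (\<lambda>t. if t \<le> s then - f 0 * speed s else f (rho s t) * rho1 s t)"
  have ne: "c s \<noteq> c t" if "s < t" "t \<le> T" for t using c_neq[of s t] that assms by simp
  have D: "(g has_field_derivative deriv f (rho s t) * (rho1 s t * rho2 s t) + f (rho s t) * J s t) (at t)"
    if "s < t" "t \<le> T" for t
  proof (rule has_field_derivative_transform_within_open[of _ _ _ "{s<..}"])
    show "((\<lambda>t. f (rho s t) * rho1 s t) has_field_derivative
        deriv f (rho s t) * (rho1 s t * rho2 s t) + f (rho s t) * J s t) (at t)"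
      using DERIV_mult[OF DERIV_chain2[OF f_deriv rho_deriv(1)[OF ne[OF that]]] rho1_deriv[OF ne[OF that]]]
      by (simp add: algebra_simps)
  qed (use that in \<open>auto simp: g_def\<close>)
  have "continuous (at t within {s..T}) g" if "t \<in> {s..T}" for t
  proof (cases "t = s")
    case False
    then show ?thesis using D[of t] that DERIV_isCont by (auto intro: continuous_at_imp_continuous_within)
  next
    case True
    have "continuous_on UNIV (\<lambda>t. f (rho s t))" by (intro continuous_on_compose2[OF f_continuous rho_continuous(1)]) auto
    then have "isCont (\<lambda>t. f (rho s t)) s" by (simp add: continuous_on_eq_continuous_at)
    then have "((\<lambda>t. f (rho s t)) \<longlongrightarrow> f (rho s s)) (at s)" by (simp only: isCont_def)
    then have "((\<lambda>t. f (rho s t)) \<longlongrightarrow> f 0) (at_right s)"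
      unfolding rho_diagonal by (rule tendsto_within_subset) simp
    from tendsto_mult[OF this rho1_limit]
    have "((\<lambda>t. f (rho s t) * rho1 s t) \<longlongrightarrow> g s) (at_right s)" by (simp add: g_def)
    then have "(g \<longlongrightarrow> g s) (at_right s)"
      by (rule Lim_transform_eventually) (auto simp: g_def eventually_at_filter)
    then show ?thesis unfolding True continuous_within using assms by (simp add: at_within_Icc_at_right)
  qed
  then have "continuous_on {s..T} g" by (simp add: continuous_on_eq_continuous_within)
  from fundamental_theorem_of_calculus_interior[OF less_imp_le[OF assms(2)] this,
      of "\<lambda>t. deriv f (rho s t) * (rho1 s t * rho2 s t) + f (rho s t) * J s t"]
  show ?thesis using D assms by (simp add: has_real_derivative_iff_has_vector_derivative g_def)
qed

text \<open>The first summand is the derivative of an antiderivative of \<open>f\<close> along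
  \<open>rho s T\<close>, and \<open>rho\<close> vanishes at both ends \<open>s = 0\<close> and
  \<open>s = T\<close>. Only the speed contributes.\<close>

lemma outer_has_integral:
  "((\<lambda>s. f (rho s T) * rho1 s T + f 0 * speed s) has_integral f 0 * curve_length K c T) {0..T}"
proof -
  obtain R where R: "0 < R" "\<And>s t. s \<in> {0..T} \<Longrightarrow> t \<in> {0..T} \<Longrightarrow> \<bar>rho s t\<bar> \<le> R" using rho_bound by blast
  \<comment> \<open>The margin of 1 places all values of \<open>rho s T\<close> in the interior of
    the interval, so that the derivative there is two-sided.\<close>
  obtain \<Phi> where \<Phi>: "\<And>x. x \<in> {- (R + 1)..R + 1} \<Longrightarrow> (\<Phi> has_vector_derivative f x) (at x within {- (R + 1)..R + 1})"
    using antiderivative_continuous[OF continuous_on_subset[OF f_continuous]] by blast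
  have r: "rho s T \<in> {- (R + 1)<..<R + 1}" if "s \<in> {0..T}" for s using R(2)[OF that, of T] T_pos by auto
  have "continuous_on {- (R + 1)..R + 1} \<Phi>"
    using \<Phi> by (intro continuous_on_vector_derivative) auto
  then have cont: "continuous_on {0..T} (\<lambda>s. \<Phi> (rho s T))"
    by (rule continuous_on_compose2[OF _ rho_continuous(2)]) (use r in force)
  have "((\<lambda>s. \<Phi> (rho s T)) has_vector_derivative f (rho s T) * rho1 s T) (at s)" if "s \<in> {0<..<T}" for s
  proof -
    have "(\<Phi> has_vector_derivative f (rho s T)) (at (rho s T))"
      using \<Phi>[of "rho s T"] r[of s] that at_within_interior[of "rho s T" "{- (R + 1)..R + 1}"] by auto
    moreover have "c s \<noteq> c T" using c_neq[of s T] that by simp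
    ultimately show ?thesis using DERIV_chain2[OF _ rho_deriv(2)] by (simp add: has_real_derivative_iff_has_vector_derivative)
  qed
  from fundamental_theorem_of_calculus_interior[OF _ cont this] T_pos
  have "((\<lambda>s. f (rho s T) * rho1 s T) has_integral \<Phi> (rho T T) - \<Phi> (rho 0 T)) {0..T}" by simp
  then have i1: "((\<lambda>s. f (rho s T) * rho1 s T) has_integral 0) {0..T}" by simp
  have "curve_length K c T = integral {0..T} speed"
    by (simp add: curve_length_def speed_def[abs_def] c'_def)
  then have "(speed has_integral curve_length K c T) {0..T}"
    using integrable_continuous_interval[OF speed_continuous] by (simp add: has_integral_integral)
  then have "((\<lambda>s. f 0 * speed s) has_integral f 0 * curve_length K c T) {0..T}" by (rule has_integral_mult_right)
  from has_integral_add[OF i1 this] show ?thesis by simp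
qed

end

lemma J_has_integral:
  assumes "0 < s" "s < T" shows "(J s has_integral rho1 s T + speed s) {s..T}"
  using inner_has_integral[of "\<lambda>_. 1" s] assms by simp

lemma continuous_on_pairs_measurable:
  fixes h :: "real \<times> real \<Rightarrow> real"
  assumes "continuous_on pairs h"
  shows "(\<lambda>x. indicator pairs x * h x) \<in> borel_measurable borel"
  using borel_measurable_continuous_on_indicator[OF pairs_borel assms] by simp

lemma slice_indicator: "0 \<le> s \<Longrightarrow> indicator pairs (s, t) = (indicator {s<..<T} t :: real)"
  and slice_indicator0: "s < 0 \<or> T \<le> s \<Longrightarrow> indicator pairs (s, t) = (0 :: real)"
  by (auto simp: pairs_def indicator_def)

lemma has_integral_slice:
  assumes "(h has_integral I) {s..T}"
  shows "((\<lambda>t. indicator {s<..<T} t * h t) has_integral (I::real)) UNIV"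
proof -
  have "(h has_integral I) {s<..<T}" using assms by (simp add: has_integral_Icc_iff_Ioo)
  then have "((\<lambda>t. if t \<in> {s<..<T} then h t else 0) has_integral I) UNIV" unfolding has_integral_restrict_UNIV .
  moreover have "(\<lambda>t. if t \<in> {s<..<T} then h t else 0) = (\<lambda>t. indicator {s<..<T} t * h t)" by auto
  ultimately show ?thesis by simp
qed

lemma J_continuous: "continuous_on pairs (\<lambda>x. J (fst x) (snd x))"
  and rho12_continuous: "continuous_on pairs (\<lambda>x. rho1 (fst x) (snd x) * rho2 (fst x) (snd x))"
  by (intro continuous_intros continuous_on_partials pairs_neq; assumption)+

text \<open>Near the diagonal no bound on \<open>J\<close> is at hand. Being nonnegative, it may be
  integrated slice by slice, and the slices are known exactly and bounded by twice the maximal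
  speed.\<close>

lemma J_integrable: "set_integrable lborel pairs (\<lambda>x. J (fst x) (snd x))"
proof -
  define h where "h = (\<lambda>x. indicator pairs x * J (fst x) (snd x))"
  have hm: "h \<in> borel_measurable borel" unfolding h_def by (rule continuous_on_pairs_measurable[OF J_continuous])
  have h0: "0 \<le> h x" for x
    using J_nonneg[of "fst x" "snd x"] by (auto simp: h_def pairs_def indicator_def)
  obtain B where B: "0 < B" "\<And>s. s \<in> {0..T} \<Longrightarrow> speed s \<le> B" using speed_bound by blast
  \<comment> \<open>The slice \<open>s = 0\<close>, not covered by \<open>J_has_integral\<close>, is
    discarded as a null set.\<close>
  have slice: "(\<integral>\<^sup>+ t. h (s, t) \<partial>lborel) \<le> ennreal (2 * B) * indicator {0..T} s" if "s \<noteq> 0" for s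
  proof (cases "0 < s \<and> s < T")
    case True
    have "(\<integral>\<^sup>+ t. h (s, t) \<partial>lborel) = ennreal (rho1 s T + speed s)"
    proof (rule nn_integral_has_integral_lborel)
      show "(\<lambda>t. h (s, t)) \<in> borel_measurable borel" using hm by measurable
      show "((\<lambda>t. h (s, t)) has_integral rho1 s T + speed s) UNIV"
        using has_integral_slice[OF J_has_integral] True by (simp add: h_def slice_indicator)
    qed (rule h0)
    also have "\<dots> \<le> ennreal (2 * B)"
      using rho_partials_bound(1)[of s T] c_neq[of s T] B(2)[of s] True by (intro ennreal_leI) auto
    finally show ?thesis using True by simp
  next
    case False
    then have "s < 0 \<or> T \<le> s" using that by auto
    then have "(\<lambda>t. ennreal (h (s, t))) = (\<lambda>t. 0)" by (simp add: h_def slice_indicator0)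
    then show ?thesis by simp
  qed
  have "(\<integral>\<^sup>+ x. h x \<partial>(lborel \<Otimes>\<^sub>M lborel)) = (\<integral>\<^sup>+ s. \<integral>\<^sup>+ t. h (s, t) \<partial>lborel \<partial>lborel)"
    using hm by (intro lborel.nn_integral_fst[symmetric]) (simp add: lborel_prod)
  also have "\<dots> \<le> (\<integral>\<^sup>+ s. ennreal (2 * B) * indicator {0..T} s \<partial>lborel)"
  proof (rule nn_integral_mono_AE)
    have "AE s in lborel. s \<noteq> (0::real)" by (rule AE_lborel_singleton)
    then show "AE s in lborel. (\<integral>\<^sup>+ t. h (s, t) \<partial>lborel) \<le> ennreal (2 * B) * indicator {0..T} s"
      by eventually_elim (rule slice)
  qed
  also have "\<dots> < \<infinity>" by (use T_pos in \<open>simp add: nn_integral_cmult_indicator ennreal_mult_less_top\<close>)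
  finally have "(\<integral>\<^sup>+ x. h x \<partial>lborel) < \<infinity>" by (simp add: lborel_prod)
  then have "integrable lborel h" using hm h0 by (intro integrableI_nonneg) auto
  then show ?thesis by (simp add: set_integrable_def h_def)
qed

text \<open>The integrand with \<open>J\<close> is dominated by a multiple of \<open>J\<close>, the
  other one by a constant on a set of finite measure. Integrability of their sum justifies Fubini,
  and the sum is what \<open>inner_has_integral\<close> and \<open>outer_has_integral\<close>
  evaluate.\<close>

theorem pairs_integral:
  assumes f: "f C1_differentiable_on UNIV"
  shows "set_integrable lborel pairs (\<lambda>x. f (rho (fst x) (snd x)) * J (fst x) (snd x))" (is ?A)
    and "set_integrable lborel pairs
      (\<lambda>x. deriv f (rho (fst x) (snd x)) * (rho1 (fst x) (snd x) * rho2 (fst x) (snd x)))" (is ?B)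
    and "(LINT x:pairs|lborel. f (rho (fst x) (snd x)) * J (fst x) (snd x)) +
      (LINT x:pairs|lborel. deriv f (rho (fst x) (snd x)) * (rho1 (fst x) (snd x) * rho2 (fst x) (snd x)))
      = f 0 * curve_length K c T"
proof -
  have ranges: "fst x \<in> {0..T}" "snd x \<in> {0..T}" if "x \<in> pairs" for x using that by (auto simp: pairs_def)
  have rc: "continuous_on pairs (\<lambda>x. g (rho (fst x) (snd x)))" if "continuous_on UNIV g" for g :: "real \<Rightarrow> real"
    by (intro continuous_on_compose2[OF that continuous_on_rho2]) auto
  obtain Bf where Bf: "0 < Bf" "\<And>s t. s \<in> {0..T} \<Longrightarrow> t \<in> {0..T} \<Longrightarrow> \<bar>f (rho s t)\<bar> \<le> Bf"
    using continuous_bound_rho[OF f_continuous[OF f]] by blast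
  obtain Bd where Bd: "0 < Bd" "\<And>s t. s \<in> {0..T} \<Longrightarrow> t \<in> {0..T} \<Longrightarrow> \<bar>deriv f (rho s t)\<bar> \<le> Bd"
    using continuous_bound_rho[OF deriv_continuous[OF f]] by blast
  obtain B where B: "0 < B" "\<And>s. s \<in> {0..T} \<Longrightarrow> speed s \<le> B" using speed_bound by blast
  define hA where "hA = (\<lambda>x. f (rho (fst x) (snd x)) * J (fst x) (snd x))"
  define hB where "hB = (\<lambda>x. deriv f (rho (fst x) (snd x)) * (rho1 (fst x) (snd x) * rho2 (fst x) (snd x)))"
  have mA: "(\<lambda>x. indicator pairs x * hA x) \<in> borel_measurable borel"
    and mB: "(\<lambda>x. indicator pairs x * hB x) \<in> borel_measurable borel"
    unfolding hA_def hB_def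
    by (intro continuous_on_pairs_measurable continuous_on_mult[OF rc[OF f_continuous[OF f]] J_continuous]
        continuous_on_mult[OF rc[OF deriv_continuous[OF f]] rho12_continuous])+
  have "integrable lborel (\<lambda>x. Bf * (indicator pairs x * J (fst x) (snd x)))"
    using J_integrable by (simp add: set_integrable_def)
  then have iA: "integrable lborel (\<lambda>x. indicator pairs x * hA x)"
  proof (rule Bochner_Integration.integrable_bound)
    show "(\<lambda>x. indicator pairs x * hA x) \<in> borel_measurable lborel" using mA by simp
    have "\<bar>hA x\<bar> \<le> Bf * \<bar>J (fst x) (snd x)\<bar>" if "x \<in> pairs" for x
      unfolding hA_def abs_mult using Bf(2)[OF ranges[OF that]] by (intro mult_right_mono) auto
    then show "AE x in lborel. norm (indicator pairs x * hA x) \<le> norm (Bf * (indicator pairs x * J (fst x) (snd x)))"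
      using Bf(1) by (auto simp: indicator_def abs_mult)
  qed
  have "emeasure lborel pairs \<le> emeasure lborel (cbox (0, 0) (T, T))"
    by (intro emeasure_mono) (auto simp: pairs_def cbox_Pair_eq intro!: borel_closed closed_Times)
  also have "\<dots> < \<infinity>" by (rule emeasure_lborel_cbox_finite)
  finally have "integrable lborel (\<lambda>x. Bd * (B * B) * indicator pairs x :: real)" by simp
  then have iB: "integrable lborel (\<lambda>x. indicator pairs x * hB x)"
  proof (rule Bochner_Integration.integrable_bound)
    show "(\<lambda>x. indicator pairs x * hB x) \<in> borel_measurable lborel" using mB by simp
    have "\<bar>hB x\<bar> \<le> Bd * (B * B)" if "x \<in> pairs" for x
      unfolding hB_def abs_mult
      using Bd(2)[OF ranges[OF that]] rho_partials_bound[OF pairs_neq[OF that]] B(2)[OF ranges(1)[OF that]]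
        B(2)[OF ranges(2)[OF that]] B(1) Bd(1) by (intro mult_mono) auto
    then show "AE x in lborel. norm (indicator pairs x * hB x) \<le> norm (Bd * (B * B) * indicator pairs x)"
      using Bd(1) B(1) by (auto simp: indicator_def abs_mult)
  qed
  show ?A ?B using iA iB by (simp_all add: set_integrable_def hA_def hB_def)
  define h where "h = (\<lambda>x. indicator pairs x * (hB x + hA x))"
  have h_eq: "h = (\<lambda>x. indicator pairs x * hB x + indicator pairs x * hA x)" by (simp add: h_def distrib_left)
  have ih: "integrable lborel h" unfolding h_eq by (rule Bochner_Integration.integrable_add[OF iB iA])
  then have ih2: "integrable (lborel \<Otimes>\<^sub>M lborel) h" by (simp add: lborel_prod)
  define G where "G = (\<lambda>s. f (rho s T) * rho1 s T + f 0 * speed s)"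
  have slice: "AE s in lborel. (\<integral>t. h (s, t) \<partial>lborel) = indicator {0<..<T} s * G s"
  proof -
    have "AE s in lborel. integrable lborel (\<lambda>t. h (s, t))" by (rule lborel_pair.AE_integrable_fst'[OF ih2])
    moreover have "AE s in lborel. s \<noteq> (0::real)" by (rule AE_lborel_singleton)
    ultimately show ?thesis
    proof eventually_elim
      case (elim s)
      show ?case
      proof (cases "0 < s \<and> s < T")
        case True
        have "((\<lambda>t. h (s, t)) has_integral G s) UNIV"
          using has_integral_slice[OF inner_has_integral[OF f, of s]] True
          by (simp add: h_def hA_def hB_def slice_indicator G_def)
        moreover have "((\<lambda>t. h (s, t)) has_integral (\<integral>t. h (s, t) \<partial>lborel)) UNIV"
          by (rule has_integral_integral_lborel[OF elim(1)])
        ultimately show ?thesis using True has_integral_unique by (auto simp: indicator_def)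
      next
        case False
        then have "s < 0 \<or> T \<le> s" using elim(2) by auto
        then have "(\<lambda>t. h (s, t)) = (\<lambda>t. 0)" by (simp add: h_def slice_indicator0)
        then show ?thesis using False by simp
      qed
    qed
  qed
  define \<Psi> where "\<Psi> = (\<lambda>s. \<integral>t. h (s, t) \<partial>lborel)"
  have "(\<integral>x. h x \<partial>lborel) = (\<integral>s. \<Psi> s \<partial>lborel)"
    unfolding \<Psi>_def using lborel_pair.integral_fst'[OF ih2] by (simp add: lborel_prod)
  moreover have "integrable lborel \<Psi>" unfolding \<Psi>_def by (rule lborel_pair.integrable_fst'[OF ih2])
  then have "(\<Psi> has_integral (\<integral>s. \<Psi> s \<partial>lborel)) UNIV" by (rule has_integral_integral_lborel)
  moreover have "(\<Psi> has_integral f 0 * curve_length K c T) UNIV"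
  proof -
    have i: "((\<lambda>s. indicator {0<..<T} s * G s) has_integral f 0 * curve_length K c T) UNIV"
      using has_integral_slice[OF outer_has_integral[OF f]] by (simp add: G_def)
    \<comment> \<open>The slice formula holds off a null set, which the gauge integral ignores; this
      links the Bochner integral with the value from the fundamental theorem.\<close>
    obtain N where "\<And>s. s \<in> space lborel - N \<Longrightarrow> \<Psi> s = indicator {0<..<T} s * G s" "N \<in> null_sets lborel"
      using AE_E3[OF slice] unfolding \<Psi>_def by blast
    then have N: "negligible N" "\<And>s. s \<in> UNIV - N \<Longrightarrow> \<Psi> s = indicator {0<..<T} s * G s"
      by (auto simp: negligible_iff_null_sets null_sets_completionI)
    show ?thesis by (rule has_integral_spike[OF N i])
  qed
  ultimately have "(\<integral>x. h x \<partial>lborel) = f 0 * curve_length K c T" using has_integral_unique by metis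
  moreover have "(\<integral>x. h x \<partial>lborel) = (LINT x:pairs|lborel. hB x) + (LINT x:pairs|lborel. hA x)"
    unfolding h_eq set_lebesgue_integral_def using Bochner_Integration.integral_add[OF iB iA] by simp
  ultimately show "(LINT x:pairs|lborel. f (rho (fst x) (snd x)) * J (fst x) (snd x)) +
      (LINT x:pairs|lborel. deriv f (rho (fst x) (snd x)) * (rho1 (fst x) (snd x) * rho2 (fst x) (snd x)))
      = f 0 * curve_length K c T" by (simp add: hA_def hB_def)
qed

end

section \<open>Change of variables\<close>

text \<open>The change of variables is carried out on \<open>real^2\<close>, iterated integration on
  \<open>real \<times> real\<close>; boxes correspond to boxes of the same volume.\<close>

lemma lborel_real2: "distr lborel borel (\<lambda>x::real^2. (x $ 1, x $ 2)) = lborel"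
proof (rule lborel_eqI[symmetric])
  have m: "(\<lambda>x::real^2. (x $ 1, x $ 2)) \<in> borel_measurable borel"
    by (intro borel_measurable_continuous_onI continuous_intros)
  fix l u :: "real \<times> real"
  assume lu: "\<And>b. b \<in> Basis \<Longrightarrow> l \<bullet> b \<le> u \<bullet> b"
  have le: "fst l \<le> fst u" "snd l \<le> snd u" using lu[of "(1, 0)"] lu[of "(0, 1)"] by (auto simp: Basis_prod_def inner_prod_def)
  define l' u' :: "real^2" where "l' = vector [fst l, snd l]" and "u' = vector [fst u, snd u]"
  have B2: "(Basis :: (real^2) set) = {axis 1 1, axis 2 1}" by (auto simp: Basis_vec_def UNIV_2)
  have ne: "axis 1 1 \<noteq> (axis 2 1 :: real^2)" by (simp add: axis_eq_axis)
  have "(\<lambda>x::real^2. (x $ 1, x $ 2)) -` box l u = box l' u'"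
    by (auto simp: box_def Basis_prod_def inner_prod_def B2 l'_def u'_def inner_axis)
  then have "emeasure (distr lborel borel (\<lambda>x::real^2. (x $ 1, x $ 2))) (box l u) = emeasure lborel (box l' u')"
    using m by (subst emeasure_distr) auto
  also have "\<dots> = (\<Prod>b\<in>Basis. (u' - l') \<bullet> b)"
    using le by (intro emeasure_lborel_box) (auto simp: B2 l'_def u'_def inner_axis)
  also have "(\<Prod>b\<in>Basis. (u' - l') \<bullet> b) = (\<Prod>b\<in>Basis. (u - l) \<bullet> b)"
    using ne by (simp add: B2 l'_def u'_def inner_axis Basis_prod_def inner_prod_def)
  finally show "emeasure (distr lborel borel (\<lambda>x::real^2. (x $ 1, x $ 2))) (box l u) = (\<Prod>b\<in>Basis. (u - l) \<bullet> b)" .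
qed simp

lemma nn_integral_real2:
  assumes "h \<in> borel_measurable borel"
  shows "(\<integral>\<^sup>+ x. h (x $ 1, x $ 2) \<partial>(lborel :: (real^2) measure)) = (\<integral>\<^sup>+ x. h x \<partial>lborel)"
proof -
  have m: "(\<lambda>x::real^2. (x $ 1, x $ 2)) \<in> measurable lborel borel"
    by (simp add: borel_measurable_continuous_onI continuous_intros)
  show ?thesis by (subst lborel_real2[symmetric], subst nn_integral_distr[OF m]) (use assms in auto)
qed

text \<open>For nonnegative integrands, integrability together with the value is a single equation
  between extended nonnegative numbers.\<close>

lemma nonneg_has_absolute_integral_iff:
  fixes j :: "'a::euclidean_space \<Rightarrow> real"
  assumes m: "(\<lambda>x. indicator A x * j x) \<in> borel_measurable borel" and nn: "\<And>x. x \<in> A \<Longrightarrow> 0 \<le> j x" and b: "0 \<le> b"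
  shows "j absolutely_integrable_on A \<and> integral A j = b \<longleftrightarrow> (\<integral>\<^sup>+ x. ennreal (indicator A x * j x) \<partial>lborel) = ennreal b"
proof -
  have nn': "0 \<le> indicator A x * j x" for x using nn by (simp add: indicator_def)
  have eq: "(\<lambda>x. if x \<in> A then j x else 0) = (\<lambda>x. indicator A x * j x)" by auto
  have r: "(j has_integral b) A \<longleftrightarrow> ((\<lambda>x. indicator A x * j x) has_integral b) UNIV"
    using has_integral_restrict_UNIV[of A j b] unfolding eq by simp
  show ?thesis
  proof
    assume *: "j absolutely_integrable_on A \<and> integral A j = b"
    then have "(j has_integral b) A" by (auto simp: absolutely_integrable_on_def has_integral_iff)
    then show "(\<integral>\<^sup>+ x. ennreal (indicator A x * j x) \<partial>lborel) = ennreal b"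
      unfolding r using m nn' by (intro nn_integral_has_integral_lborel)
  next
    assume *: "(\<integral>\<^sup>+ x. ennreal (indicator A x * j x) \<partial>lborel) = ennreal b"
    then have i: "integrable lborel (\<lambda>x. indicator A x * j x)" using m nn' by (intro integrableI_nonneg) auto
    then have "ennreal (\<integral>x. indicator A x * j x \<partial>lborel) = ennreal b"
      using * nn' nn_integral_eq_integral[OF i] by simp
    then have "(\<integral>x. indicator A x * j x \<partial>lborel) = b" using b nn' by (simp add: integral_nonneg)
    then have "(j has_integral b) A" using has_integral_integral_lborel[OF i] unfolding r by simp
    then show "j absolutely_integrable_on A \<and> integral A j = b"
      using nn by (auto intro!: nonnegative_absolutely_integrable_1 simp: has_integral_iff)
  qed
qed

text \<open>An equivalence, because it is used in both directions: to pass from crossing coordinates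
  to the plane and from the plane to pairs of boundary points. The chart \<open>(g1, g2)\<close>
  pulls the weight \<open>w\<close> back to the density \<open>j\<close>.\<close>

lemma change_of_variables_chart:
  fixes g1 g2 pa pb qa qb j :: "real \<times> real \<Rightarrow> real" and w :: "real \<Rightarrow> real \<Rightarrow> real"
  assumes S: "S \<in> sets borel"
    and d1: "\<And>x. x \<in> S \<Longrightarrow> (g1 has_derivative (\<lambda>h. fst h * pa x + snd h * pb x)) (at x)"
    and d2: "\<And>x. x \<in> S \<Longrightarrow> (g2 has_derivative (\<lambda>h. fst h * qa x + snd h * qb x)) (at x)"
    and inj: "inj_on (\<lambda>x. (g1 x, g2 x)) S"
    and j: "\<And>x. x \<in> S \<Longrightarrow> \<bar>pa x * qb x - pb x * qa x\<bar> * w (g1 x) (g2 x) = j x"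
    and m: "(\<lambda>x. indicator S x * j x) \<in> borel_measurable borel" and nn: "\<And>x. x \<in> S \<Longrightarrow> 0 \<le> j x" and b: "0 \<le> b"
  shows "(\<integral>\<^sup>+ x. ennreal (indicator S x * j x) \<partial>lborel) = ennreal b \<longleftrightarrow>
    (\<lambda>y. w (y $ 1) (y $ 2)) absolutely_integrable_on (\<lambda>x. vector [g1 x, g2 x] :: real^2) ` S \<and>
    integral ((\<lambda>x. vector [g1 x, g2 x] :: real^2) ` S) (\<lambda>y. w (y $ 1) (y $ 2)) = b"
proof -
  define \<phi> where "\<phi> = (\<lambda>x::real^2. (x $ 1, x $ 2))"
  define S2 where "S2 = \<phi> -` S"
  define G where "G = (\<lambda>x. vector [g1 (\<phi> x), g2 (\<phi> x)] :: real^2)"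
  define G' where "G' = (\<lambda>x (h::real^2). vector [h $ 1 * pa (\<phi> x) + h $ 2 * pb (\<phi> x), h $ 1 * qa (\<phi> x) + h $ 2 * qb (\<phi> x)] :: real^2)"
  have \<phi>m: "\<phi> \<in> borel_measurable borel"
    unfolding \<phi>_def by (intro borel_measurable_continuous_onI continuous_intros)
  have S2b: "S2 \<in> sets borel" unfolding S2_def using measurable_sets[OF \<phi>m S] by simp
  then have S2: "S2 \<in> sets lebesgue" by simp
  have \<phi>d: "(\<phi> has_derivative \<phi>) (at x within A)" for x A
    unfolding \<phi>_def by (intro has_derivative_Pair bounded_linear_imp_has_derivative bounded_linear_vec_nth)
  have der: "(G has_derivative G' x) (at x within S2)" if "x \<in> S2" for x
  proof -
    have x: "\<phi> x \<in> S" using that by (simp add: S2_def)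
    have 1: "((\<lambda>x. g1 (\<phi> x)) has_derivative (\<lambda>h. h $ 1 * pa (\<phi> x) + h $ 2 * pb (\<phi> x))) (at x within S2)"
      using has_derivative_compose[OF \<phi>d d1[OF x]] by (simp add: \<phi>_def)
    have 2: "((\<lambda>x. g2 (\<phi> x)) has_derivative (\<lambda>h. h $ 1 * qa (\<phi> x) + h $ 2 * qb (\<phi> x))) (at x within S2)"
      using has_derivative_compose[OF \<phi>d d2[OF x]] by (simp add: \<phi>_def)
    have B2: "(Basis :: (real^2) set) = {axis 1 1, axis 2 1}" by (auto simp: Basis_vec_def UNIV_2)
    show ?thesis
      unfolding has_derivative_componentwise_within[of G] B2 using 1 2 by (simp add: G_def G'_def inner_axis)
  qed
  have inj2: "inj_on G S2"
  proof (rule inj_onI)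
    fix x y assume xy: "x \<in> S2" "y \<in> S2" "G x = G y"
    have "G x $ 1 = G y $ 1" "G x $ 2 = G y $ 2" by (simp_all add: xy(3))
    then have "(g1 (\<phi> x), g2 (\<phi> x)) = (g1 (\<phi> y), g2 (\<phi> y))" by (simp add: G_def)
    then have "\<phi> x = \<phi> y" by (rule inj_onD[OF inj]) (use xy in \<open>simp_all add: S2_def\<close>)
    then show "x = y" by (simp add: \<phi>_def vec_eq_iff forall_2)
  qed
  have det: "det (matrix (G' x)) = pa (\<phi> x) * qb (\<phi> x) - pb (\<phi> x) * qa (\<phi> x)" for x
    by (simp add: det_2 matrix_def G'_def axis_def)
  have img: "G ` S2 = (\<lambda>x. vector [g1 x, g2 x]) ` S"
  proof -
    have "S = \<phi> ` S2"
    proof (intro equalityI subsetI)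
      fix x assume "x \<in> S"
      then show "x \<in> \<phi> ` S2"
        by (intro image_eqI[of _ _ "vector [fst x, snd x]"]) (simp_all add: S2_def \<phi>_def)
    qed (auto simp: S2_def)
    then show ?thesis unfolding G_def by (simp add: image_image)
  qed
  \<comment> \<open>The change of variables theorem is for vector-valued integrands, so the weight
    is read in \<open>real^1\<close>.\<close>
  define F where "F = (\<lambda>y::real^2. vec (w (y $ 1) (y $ 2)) :: real^1)"
  have "(\<lambda>x. j (\<phi> x)) absolutely_integrable_on S2 \<and> integral S2 (\<lambda>x. j (\<phi> x)) = b \<longleftrightarrow>
      (\<lambda>x. (\<bar>det (matrix (G' x))\<bar> *\<^sub>R F (G x)) $ 1) absolutely_integrable_on S2 \<and>
      integral S2 (\<lambda>x. (\<bar>det (matrix (G' x))\<bar> *\<^sub>R F (G x)) $ 1) = b"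
  proof -
    have e: "j (\<phi> x) = (\<bar>det (matrix (G' x))\<bar> *\<^sub>R F (G x)) $ 1" if "x \<in> S2" for x
      using j[of "\<phi> x"] that by (simp add: det F_def G_def S2_def)
    have "(\<lambda>x. j (\<phi> x)) absolutely_integrable_on S2 \<longleftrightarrow>
      (\<lambda>x. (\<bar>det (matrix (G' x))\<bar> *\<^sub>R F (G x)) $ 1) absolutely_integrable_on S2"
      by (rule set_integrable_cong[OF refl refl e])
    moreover have "integral S2 (\<lambda>x. j (\<phi> x)) = integral S2 (\<lambda>x. (\<bar>det (matrix (G' x))\<bar> *\<^sub>R F (G x)) $ 1)"
      by (rule Henstock_Kurzweil_Integration.integral_cong[OF e])
    ultimately show ?thesis by simp
  qed
  also have "\<dots> \<longleftrightarrow> (\<lambda>x. \<bar>det (matrix (G' x))\<bar> *\<^sub>R F (G x)) absolutely_integrable_on S2 \<and>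
      integral S2 (\<lambda>x. \<bar>det (matrix (G' x))\<bar> *\<^sub>R F (G x)) = vec b"
    by (auto simp: absolutely_integrable_on_1_iff integral_on_1_eq vec_eq_iff)
  also have "\<dots> \<longleftrightarrow> F absolutely_integrable_on (G ` S2) \<and> integral (G ` S2) F = vec b"
    by (rule has_absolute_integral_change_of_variables[OF S2 der inj2])
  also have "\<dots> \<longleftrightarrow> (\<lambda>y. w (y $ 1) (y $ 2)) absolutely_integrable_on (G ` S2) \<and>
      integral (G ` S2) (\<lambda>y. w (y $ 1) (y $ 2)) = b"
    by (auto simp: absolutely_integrable_on_1_iff integral_on_1_eq vec_eq_iff F_def)
  finally have main: "(\<lambda>x. j (\<phi> x)) absolutely_integrable_on S2 \<and> integral S2 (\<lambda>x. j (\<phi> x)) = b \<longleftrightarrow>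
      (\<lambda>y. w (y $ 1) (y $ 2)) absolutely_integrable_on (G ` S2) \<and> integral (G ` S2) (\<lambda>y. w (y $ 1) (y $ 2)) = b" .
  have ind: "indicator S2 x * j (\<phi> x) = indicator S (\<phi> x) * j (\<phi> x)" for x by (simp add: S2_def indicator_def)
  have "(\<lambda>x. indicator S2 x * j (\<phi> x)) \<in> borel_measurable borel"
    unfolding ind by (rule measurable_compose[OF \<phi>m m])
  then have "(\<lambda>x. j (\<phi> x)) absolutely_integrable_on S2 \<and> integral S2 (\<lambda>x. j (\<phi> x)) = b \<longleftrightarrow>
      (\<integral>\<^sup>+ x. ennreal (indicator S2 x * j (\<phi> x)) \<partial>lborel) = ennreal b"
    using nn b by (intro nonneg_has_absolute_integral_iff) (auto simp: S2_def)
  also have "(\<integral>\<^sup>+ x. ennreal (indicator S2 x * j (\<phi> x)) \<partial>lborel) = (\<integral>\<^sup>+ x. ennreal (indicator S x * j x) \<partial>lborel)"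
    unfolding ind unfolding \<phi>_def by (rule nn_integral_real2) (use m in measurable)
  finally show ?thesis using main unfolding img by simp
qed

text \<open>A conormal has fixed length for the dual quadratic form, whose coefficients in the frame
  are \<open>K\<close>, 1, 1 because \<open>qform K p p = 1 / K\<close> when
  \<open>K \<noteq> 0\<close>. The products with \<open>p\<close>, \<open>v\<close>,
  \<open>n\<close> are 2 by 2 minors, and the identity is Lagrange's.\<close>

lemma dual_form_normalized:
  assumes f: "orthonormal_frame K p v n" and x: "unit_tangent K x w"
  shows "K * (cross3 x w \<bullet> p)\<^sup>2 + (cross3 x w \<bullet> v)\<^sup>2 + (cross3 x w \<bullet> n)\<^sup>2 = vol2 K"
proof -
  note * = orthonormal_frameD[OF f]
  obtain a b e where xe: "x = a *\<^sub>R p + b *\<^sub>R v + e *\<^sub>R n" using frame_expansion[OF f] .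
  obtain a' b' e' where we: "w = a' *\<^sub>R p + b' *\<^sub>R v + e' *\<^sub>R n" using frame_expansion[OF f] .
  define d where "d = cross3 p v \<bullet> n"
  have c: "cross3 x w \<bullet> p = d * (b * e' - e * b')" "cross3 x w \<bullet> v = d * (e * a' - a * e')"
      "cross3 x w \<bullet> n = d * (a * b' - b * a')"
    by (simp_all add: xe we d_def cross3_simps)
  have d2: "d\<^sup>2 = vol2 K" unfolding d_def by (rule frame_det_squared[OF f])
  have "K * (b * e' - e * b')\<^sup>2 + (e * a' - a * e')\<^sup>2 + (a * b' - b * a')\<^sup>2 = 1"
  proof (cases "K = 0")
    case True
    have 1: "a = 1" "a' = 0" using True x * by (auto simp: xe we unit_tangent_def tangent_def space_form_iff)
    have "qform K w w = 1" using x by (simp add: unit_tangent_def)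
    then have "b' * b' + e' * e' = 1" using * 1 by (simp add: we qform_linear)
    then show ?thesis using True 1 by (simp add: power2_eq_square)
  next
    case False
    then have pp: "qform K p p = 1 / K" using * by (simp add: space_form_iff)
    have w: "qform K w w = 1" "qform K x x = 1 / K" "qform K x w = 0"
      using x False by (auto simp: unit_tangent_def tangent_def space_form_iff)
    have e: "a'\<^sup>2 / K + b'\<^sup>2 + e'\<^sup>2 = 1" "a\<^sup>2 / K + b\<^sup>2 + e\<^sup>2 = 1 / K" "a * a' / K + b * b' + e * e' = 0"
      using w *(6-9) *(10-13)[OF False] pp
      by (simp_all add: xe we qform_linear power2_eq_square mult.commute)
    have "K * (b * e' - e * b')\<^sup>2 + (e * a' - a * e')\<^sup>2 + (a * b' - b * a')\<^sup>2 =
        K * ((a\<^sup>2 / K + b\<^sup>2 + e\<^sup>2) * (a'\<^sup>2 / K + b'\<^sup>2 + e'\<^sup>2) - (a * a' / K + b * b' + e * e')\<^sup>2)"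
      using False by (simp add: power2_eq_square field_simps)
    then show ?thesis unfolding e using False by simp
  qed
  then have "d\<^sup>2 * (K * (b * e' - e * b')\<^sup>2 + (e * a' - a * e')\<^sup>2 + (a * b' - b * a')\<^sup>2) = vol2 K" by (simp add: d2)
  then show ?thesis unfolding c power_mult_distrib by (simp add: distrib_left mult.left_commute)
qed

section \<open>Chords in the coordinates of a crossing segment\<close>

text \<open>Multiplicativity of the determinant for the matrix of dot products of \<open>N\<close>,
  \<open>M\<close>, \<open>L\<close> with \<open>p\<close>, \<open>v\<close>,
  \<open>n\<close>.\<close>

lemma triple_product_gram:
  fixes N M L p v n :: "real^3"
  shows "(N \<bullet> p) * ((M \<bullet> v) * (L \<bullet> n) - (M \<bullet> n) * (L \<bullet> v)) - (N \<bullet> v) * ((M \<bullet> p) * (L \<bullet> n) - (M \<bullet> n) * (L \<bullet> p))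
    + (N \<bullet> n) * ((M \<bullet> p) * (L \<bullet> v) - (M \<bullet> v) * (L \<bullet> p)) = (N \<bullet> cross3 M L) * (cross3 p v \<bullet> n)"
  by (simp add: cross3_simps)

text \<open>With \<open>x' = c' s\<close> and \<open>y' = c' t\<close>, this is the determinant of
  the conormal and its two partial derivatives. Its factorization produces the numerator of
  \<open>J\<close>.\<close>

lemma triple_product_of_crosses:
  fixes x y x' y' :: "real^3"
  shows "cross3 x y \<bullet> cross3 (cross3 x' y) (cross3 x y') = (cross3 x y \<bullet> x') * (cross3 x y \<bullet> y')"
  by (simp add: cross3_simps)

lemma same_line_parallel:
  assumes v: "unit_tangent K p v" and w: "unit_tangent K x w" and e: "geodesic_line K p v = geodesic_line K x w"
  obtains l where "l \<noteq> 0" "cross3 x w = l *\<^sub>R cross3 p v"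
proof -
  obtain s where s: "0 < s" "short K s" using geod_near[of UNIV p] by auto
  have "geod K x w 0 \<in> geodesic_line K p v" "geod K x w s \<in> geodesic_line K p v"
    unfolding e unfolding geodesic_line_def by (rule rangeI)+
  then have x: "x \<in> geodesic_line K p v" and "cross3 p v \<bullet> x = 0" "cross3 p v \<bullet> geod K x w s = 0"
    by (auto simp: geodesic_line_eq[OF v])
  then have "cross3 p v \<bullet> w = 0" using sinK_pos[OF s] by (simp add: geod_def inner_add_right)
  then show thesis using geodesic_line_through(2)[OF v x w] that by blast
qed

lemma parallel_same_line:
  assumes "unit_tangent K p v" "unit_tangent K x w" "l \<noteq> 0" "cross3 x w = l *\<^sub>R cross3 p v"
  shows "geodesic_line K x w = geodesic_line K p v"
  using assms by (auto simp: geodesic_line_eq)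

lemma frame_dots_eq:
  assumes f: "orthonormal_frame K p v n" and "N \<bullet> p = M \<bullet> p" "N \<bullet> v = M \<bullet> v" "N \<bullet> n = M \<bullet> n"
  shows "N = M"
proof -
  obtain a b e where "N - M = a *\<^sub>R p + b *\<^sub>R v + e *\<^sub>R n" using frame_expansion[OF f] .
  from arg_cong[OF this, of "(\<bullet>) (N - M)"] have "(N - M) \<bullet> (N - M) = 0"
    using assms by (simp add: inner_add_right inner_diff_left)
  then show ?thesis by simp
qed

lemma quotient_derivative:
  fixes A B :: "real \<times> real \<Rightarrow> real"
  assumes "(A has_derivative (\<lambda>h. fst h * a1 + snd h * a2)) (at x)"
    and "(B has_derivative (\<lambda>h. fst h * b1 + snd h * b2)) (at x)" and "B x \<noteq> 0"
  shows "((\<lambda>x. - A x / B x) has_derivative (\<lambda>h. fst h * (- (a1 * B x - A x * b1) / (B x)\<^sup>2)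
      + snd h * (- (a2 * B x - A x * b2) / (B x)\<^sup>2))) (at x)"
proof -
  have "((\<lambda>x. - A x / B x) has_derivative (\<lambda>h. (- (fst h * a1 + snd h * a2) * B x - - A x * (fst h * b1 + snd h * b2)) / (B x * B x))) (at x)"
    by (rule has_derivative_divide'[OF has_derivative_minus[OF assms(1)] assms(2,3)])
  moreover have "(- (fst h * a1 + snd h * a2) * B x - - A x * (fst h * b1 + snd h * b2)) / (B x * B x)
      = fst h * (- (a1 * B x - A x * b1) / (B x)\<^sup>2) + snd h * (- (a2 * B x - A x * b2) / (B x)\<^sup>2)" for h
    using assms(3) by (simp add: field_simps power2_eq_square)
  ultimately show ?thesis by simp
qed

text \<open>The Jacobian of a central projection to the plane: a 3 by 3 determinant divided by the
  cube of the coordinate which is projected away.\<close>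

lemma quotient_jacobian:
  fixes A B C :: real assumes "B \<noteq> 0"
  shows "(- (As * B - A * Bs) / B\<^sup>2) * (- (Ct * B - C * Bt) / B\<^sup>2) - (- (At * B - A * Bt) / B\<^sup>2) * (- (Cs * B - C * Bs) / B\<^sup>2)
    = - (A * (Bs * Ct - Cs * Bt) - B * (As * Ct - Cs * At) + C * (As * Bt - Bs * At)) / B ^ 3"
  using assms by (simp add: field_simps power2_eq_square power3_eq_cube)

definition crossing_direction :: "real \<Rightarrow> real^3 \<Rightarrow> real^3 \<Rightarrow> real^3 \<Rightarrow> real \<times> real \<Rightarrow> real^3" where
  "crossing_direction K p v n x = cos (snd x) *\<^sub>R geod_vel K p v (fst x) + sin (snd x) *\<^sub>R n"

lemma crossing_geodesic_eq:
  "crossing_geodesic K p v n x = geodesic_line K (geod K p v (fst x)) (crossing_direction K p v n x)"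
  by (simp add: crossing_geodesic_def crossing_direction_def split_beta)

lemma unit_tangent_rotate:
  assumes "orthonormal_frame K p v n" shows "unit_tangent K p (cos a *\<^sub>R v + sin a *\<^sub>R n)"
  using orthonormal_frameD(3,4,6-9)[OF assms] sin_cos_squared_add[of a]
  by (auto simp: unit_tangent_def qform_linear power2_eq_square intro!: tangent_add tangent_scaleR)

lemma unit_tangent_crossing:
  "orthonormal_frame K p v n \<Longrightarrow> unit_tangent K (geod K p v (fst x)) (crossing_direction K p v n x)"
  unfolding crossing_direction_def by (intro unit_tangent_rotate orthonormal_frame_geod)

text \<open>The conormal in spherical-type coordinates \<open>l\<close> and \<open>a\<close>.
  Dividing by its product with \<open>v\<close> gives the chart \<open>sinK K l / cosK K l\<close>
  and \<open>cot a / cosK K l\<close> of the crossing geodesics.\<close>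

lemma crossing_conormal:
  assumes f: "orthonormal_frame K p v n"
  shows "cross3 (geod K p v (fst x)) (crossing_direction K p v n x) \<bullet> p = sin (snd x) * sinK K (fst x) * (cross3 p v \<bullet> n)"
    and "cross3 (geod K p v (fst x)) (crossing_direction K p v n x) \<bullet> v = - sin (snd x) * cosK K (fst x) * (cross3 p v \<bullet> n)"
    and "cross3 (geod K p v (fst x)) (crossing_direction K p v n x) \<bullet> n = cos (snd x) * (cross3 p v \<bullet> n)"
proof -
  have "cross3 (geod K p v (fst x)) (crossing_direction K p v n x) = cos (snd x) *\<^sub>R cross3 p v
      + (sin (snd x) * cosK K (fst x)) *\<^sub>R cross3 p n + (sin (snd x) * sinK K (fst x)) *\<^sub>R cross3 v n"
    unfolding cross3_geod[OF orthonormal_frameD(1)[OF f], of "fst x", symmetric] crossing_direction_def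
    by (simp add: geod_def cross_add_left cross_add_right cross_mult_left cross_mult_right algebra_simps)
  then show "cross3 (geod K p v (fst x)) (crossing_direction K p v n x) \<bullet> p = sin (snd x) * sinK K (fst x) * (cross3 p v \<bullet> n)"
    "cross3 (geod K p v (fst x)) (crossing_direction K p v n x) \<bullet> v = - sin (snd x) * cosK K (fst x) * (cross3 p v \<bullet> n)"
    "cross3 (geod K p v (fst x)) (crossing_direction K p v n x) \<bullet> n = cos (snd x) * (cross3 p v \<bullet> n)"
    by (simp_all add: cross3_simps)
qed

text \<open>Measurability of a set of lines is defined on the unit tangent bundle, so a continuous
  choice of base point and direction pulls it back to the parameters.\<close>

lemma borel_preimage_lines:
  fixes h k :: "real \<times> real \<Rightarrow> real^3"
  assumes A: "A \<in> borel_geodesic_sets K" and P: "P \<in> sets borel"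
    and c: "continuous_on P h" "continuous_on P k" and u: "\<And>x. x \<in> P \<Longrightarrow> unit_tangent K (h x) (k x)"
  shows "{x \<in> P. geodesic_line K (h x) (k x) \<in> A} \<in> sets borel"
proof -
  define B where "B = {(p, v). unit_tangent K p v \<and> geodesic_line K p v \<in> A}"
  have "B \<in> sets borel" using A by (simp add: borel_geodesic_sets_def B_def)
  moreover have "(\<lambda>x. (h x, k x)) \<in> borel_measurable (restrict_space borel P)"
    by (intro borel_measurable_continuous_on_restrict continuous_on_Pair c)
  ultimately have "(\<lambda>x. (h x, k x)) -` B \<inter> space (restrict_space borel P) \<in> sets (restrict_space borel P)"
    by (rule measurable_sets[rotated])
  moreover have "(\<lambda>x. (h x, k x)) -` B \<inter> space (restrict_space borel P) = {x \<in> P. geodesic_line K (h x) (k x) \<in> A}"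
    using u by (auto simp: B_def space_restrict_space)
  ultimately show ?thesis using P by (simp add: sets_restrict_space_iff)
qed

lemma crossing_preimage_borel:
  assumes A: "A \<in> borel_geodesic_sets K" and f: "orthonormal_frame K p v n" and P: "P \<in> sets borel"
  shows "{x \<in> P. crossing_geodesic K p v n x \<in> A} \<in> sets borel"
  unfolding crossing_geodesic_eq
proof (rule borel_preimage_lines[OF A P])
  show "continuous_on P (\<lambda>x. geod K p v (fst x))" unfolding geod_def by (intro continuous_intros)
  show "continuous_on P (crossing_direction K p v n)"
    unfolding crossing_direction_def[abs_def] geod_vel_def by (intro continuous_intros)
qed (rule unit_tangent_crossing[OF f])

section \<open>Chord lines indexed by pairs of boundary parameters\<close>

context smooth_domain
begin

text \<open>Solves \<open>c t = geod K (c s) w (rho s t)\<close> for the initial velocity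
  \<open>w\<close>; the explicit formula makes it continuous on \<open>pairs\<close>.\<close>

definition dir :: "real \<times> real \<Rightarrow> real^3" where
  "dir x = (1 / S (fst x) (snd x)) *\<^sub>R (c (snd x) - cosK K (rho (fst x) (snd x)) *\<^sub>R c (fst x))"

definition chord_line :: "real \<times> real \<Rightarrow> (real^3) set" where
  "chord_line x = geodesic_line K (c (fst x)) (dir x)"

lemma dir_unique:
  assumes "c s \<noteq> c t" "unit_tangent K (c s) w" "0 < r" "short K r" "c t = geod K (c s) w r"
  shows "w = dir (s, t)" "rho s t = r"
proof -
  obtain w' where w': "is_chord K D (geodesic_line K (c s) w') (c s) w' (rho s t)" "0 < rho s t"
    "c t = geod K (c s) w' (rho s t)" "S s t = sinK K (rho s t)" using chord_data[OF assms(1)] by metis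
  note ch = is_chordD[OF w'(1)]
  have e: "geod K (c s) w r = geod K (c s) w' (rho s t)" using assms(5) w'(3) by simp
  show r: "rho s t = r" and "w = dir (s, t)"
  proof -
    show "rho s t = r" using geod_unique(1)[OF assms(2) ch(1) e less_imp_le[OF assms(3)] w'(2) assms(4) ch(4)] by simp
    have "w = w'" using geod_unique(2)[OF assms(2) ch(1) e less_imp_le[OF assms(3)] w'(2) assms(4) ch(4)] .
    have "c t - cosK K (rho s t) *\<^sub>R c s = S s t *\<^sub>R w'"
      unfolding w'(4) by (subst w'(3)) (simp add: geod_def)
    then have "w' = dir (s, t)" using S_pos[OF assms(1)] by (simp add: dir_def)
    then show "w = dir (s, t)" using \<open>w = w'\<close> by simp
  qed
qed

lemma chord_line_is_chord:
  assumes "x \<in> pairs"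
  shows "is_chord K D (chord_line x) (c (fst x)) (dir x) (rho (fst x) (snd x))" "0 < rho (fst x) (snd x)"
    "c (snd x) = geod K (c (fst x)) (dir x) (rho (fst x) (snd x))"
    "cross3 (c (fst x)) (c (snd x)) = S (fst x) (snd x) *\<^sub>R cross3 (c (fst x)) (dir x)"
    "S (fst x) (snd x) = sinK K (rho (fst x) (snd x))"
proof -
  note ne = pairs_neq[OF assms]
  obtain w where w: "is_chord K D (geodesic_line K (c (fst x)) w) (c (fst x)) w (rho (fst x) (snd x))" "0 < rho (fst x) (snd x)"
    "c (snd x) = geod K (c (fst x)) w (rho (fst x) (snd x))" "S (fst x) (snd x) = sinK K (rho (fst x) (snd x))"
    using chord_data[OF ne] by metis
  note ch = is_chordD[OF w(1)]
  have wd: "w = dir x" using dir_unique(1)[OF ne ch(1) w(2) ch(4) w(3)] by simp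
  show "is_chord K D (chord_line x) (c (fst x)) (dir x) (rho (fst x) (snd x))" "0 < rho (fst x) (snd x)"
    "c (snd x) = geod K (c (fst x)) (dir x) (rho (fst x) (snd x))"
    "S (fst x) (snd x) = sinK K (rho (fst x) (snd x))"
    using w unfolding wd chord_line_def by blast+
  show "cross3 (c (fst x)) (c (snd x)) = S (fst x) (snd x) *\<^sub>R cross3 (c (fst x)) (dir x)"
    unfolding w(4) by (subst w(3)) (simp add: geod_def cross_add_right cross_mult_right wd)
qed

lemma dir_unit_tangent: "x \<in> pairs \<Longrightarrow> unit_tangent K (c (fst x)) (dir x)"
  using chord_line_is_chord(1) is_chordD(1) by blast

lemma chord_line_ends:
  assumes "x \<in> pairs" shows "c (fst x) \<in> chord_line x" "c (snd x) \<in> chord_line x"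
proof -
  have "geod K (c (fst x)) (dir x) 0 \<in> chord_line x" unfolding chord_line_def geodesic_line_def by (rule rangeI)
  then show "c (fst x) \<in> chord_line x" by simp
  show "c (snd x) \<in> chord_line x" unfolding chord_line_is_chord(3)[OF assms] chord_line_def geodesic_line_def by (rule rangeI)
qed

text \<open>A line with a chord meets the boundary in its two endpoints only, and the order of the
  parameters decides which is which.\<close>

lemma chord_line_inj: "inj_on chord_line pairs"
proof (rule inj_onI)
  fix x y assume x: "x \<in> pairs" and y: "y \<in> pairs" and e: "chord_line x = chord_line y"
  have "z = c (fst x) \<or> z = c (snd x)" if "z \<in> chord_line y" "z \<in> boundaryK K D" for z
    using boundary_of_chord[OF chord_line_is_chord(1)[OF x]] that e chord_line_is_chord(3)[OF x] by metis
  then have *: "c (fst y) = c (fst x) \<or> c (fst y) = c (snd x)" "c (snd y) = c (fst x) \<or> c (snd y) = c (snd x)"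
    using chord_line_ends[OF y] c_boundary by blast+
  have r: "fst x \<in> {0..<T}" "snd x \<in> {0..<T}" "fst y \<in> {0..<T}" "snd y \<in> {0..<T}" "fst x < snd x" "fst y < snd y"
    using x y by (auto simp: pairs_def)
  have "fst y = fst x \<or> fst y = snd x" "snd y = fst x \<or> snd y = snd x"
    using * inj_onD[OF c_inj] r by blast+
  then show "x = y" using r by (auto simp: prod_eq_iff)
qed

lemma chord_line_cases:
  assumes "g \<in> geodesics_meeting K D"
  shows "g \<in> chord_line ` pairs \<or> (\<exists>y. g \<inter> D = {y})"
proof (rule disjCI)
  assume *: "\<not> (\<exists>y. g \<inter> D = {y})"
  obtain p v where v: "unit_tangent K p v" and g: "g = geodesic_line K p v" and ne: "g \<inter> D \<noteq> {}"
    using assms by (auto simp: geodesics_meeting_def geodesics_def)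
  then obtain y y' where "y \<in> g \<inter> D" "y' \<in> g \<inter> D" "y \<noteq> y'" using * by blast
  then obtain x w r where ch: "is_chord K D g x w r" "0 < r" "short K r"
    using chord_exists[OF v, folded g] by metis
  have "\<exists>s\<in>{0..<T}. c s = z" if "z \<in> boundaryK K D" for z using that unfolding c_image[symmetric] by auto
  then obtain s t where st: "s \<in> {0..<T}" "t \<in> {0..<T}" "c s = x" "c t = geod K x w r"
    using chord_start_boundary[OF ch(1,2)] chord_end_boundary[OF ch(1,2)] by metis
  \<comment> \<open>The chord that was found may start at the larger parameter; it is reversed in
    that case.\<close>
  have key: "g \<in> chord_line ` pairs"
    if "is_chord K D g (c s) w r" "c t = geod K (c s) w r" "s < t" "s \<in> {0..<T}" "t \<in> {0..<T}" for s t w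
  proof -
    note c = is_chordD[OF that(1)]
    have p: "(s, t) \<in> pairs" using that by (simp add: pairs_def)
    have "w = dir (s, t)" using dir_unique(1)[OF _ c(1) ch(2) c(4) that(2)] pairs_neq[OF p] by simp
    then have "g = chord_line (s, t)" using c(2) by (simp add: chord_line_def)
    then show ?thesis using p by blast
  qed
  have "x \<noteq> geod K x w r" using geod_neq[OF is_chordD(1)[OF ch(1)] ch(2)] ch(3) by simp
  then have "s \<noteq> t" using st by auto
  then consider "s < t" | "t < s" by linarith
  then show "g \<in> chord_line ` pairs"
  proof cases
    case 1
    then show ?thesis using key[of s w t] ch st by simp
  next
    case 2
    then show ?thesis using key[of t "- geod_vel K x w r" s] is_chord_reverse[OF ch(1)] st by simp
  qed
qed

lemma dir_continuous: "continuous_on pairs dir"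
proof -
  have S: "continuous_on pairs (\<lambda>x. S (fst x) (snd x))"
    unfolding S_def sin_of_Q_def by (intro continuous_intros continuous_on_Q2) auto
  have "S (fst x) (snd x) \<noteq> 0" if "x \<in> pairs" for x using S_pos[OF pairs_neq[OF that]] by simp
  then show ?thesis unfolding dir_def[abs_def]
    by (auto intro!: continuous_intros S continuous_on_rho2 continuous_on_compose2[OF c_continuous[of UNIV]])
qed

lemma chord_line_preimage_borel:
  assumes A: "A \<in> borel_geodesic_sets K" shows "{x \<in> pairs. chord_line x \<in> A} \<in> sets borel"
  unfolding chord_line_def
  by (rule borel_preimage_lines[OF A pairs_borel _ dir_continuous dir_unit_tangent])
    (auto intro!: continuous_on_compose2[OF c_continuous[of UNIV]] continuous_intros)

lemma cross_c_deriv: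
  "((\<lambda>x. cross3 (c (fst x)) (c (snd x)) \<bullet> q) has_derivative
    (\<lambda>h. fst h * (cross3 (c' (fst x)) (c (snd x)) \<bullet> q) + snd h * (cross3 (c (fst x)) (c' (snd x)) \<bullet> q))) (at x)"
proof -
  have 1: "((\<lambda>x. c (fst x)) has_derivative (\<lambda>h. fst h *\<^sub>R c' (fst x))) (at x)"
    by (rule has_derivative_compose[OF has_derivative_fst[OF has_derivative_ident] c_deriv[unfolded has_vector_derivative_def]])
  have 2: "((\<lambda>x. c (snd x)) has_derivative (\<lambda>h. snd h *\<^sub>R c' (snd x))) (at x)"
    by (rule has_derivative_compose[OF has_derivative_snd[OF has_derivative_ident] c_deriv[unfolded has_vector_derivative_def]])
  have "bounded_bilinear cross3" using bilinear_cross by (simp add: bilinear_conv_bounded_bilinear)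
  from has_derivative_inner_left[OF bounded_bilinear.FDERIV[OF this 1 2], of q]
  show ?thesis by (simp add: cross_mult_left cross_mult_right inner_add_left add.commute)
qed

text \<open>Both integrals are the integral of the weight \<open>w\<close> in the coordinates \<open>(- N \<bullet> p / N \<bullet> v, - N \<bullet> n / N \<bullet> v)\<close> of
  a geodesic with conormal \<open>N\<close>.\<close>
lemma chart_formula:
  assumes f: "orthonormal_frame K p v n" and m: "0 < m" "K > 0 \<longrightarrow> 2 * m \<le> pi / sqrt K"
    and A: "A \<in> borel_geodesic_sets K" and A1: "A \<subseteq> crossing_geodesic K p v n ` ({0<..<m} \<times> {0<..<pi})"
    and A2: "A \<subseteq> chord_line ` pairs"
  shows "(\<integral>\<^sup>+ x \<in> {0<..<m} \<times> {0<..<pi}. ennreal (sin (snd x)) * indicator A (crossing_geodesic K p v n x) \<partial>lborel) =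
    (\<integral>\<^sup>+ x. ennreal (indicator {x \<in> pairs. chord_line x \<in> A} x * J (fst x) (snd x)) \<partial>lborel)"
proof -
  define W where "W = {x \<in> {0<..<m} \<times> {0<..<pi}. crossing_geodesic K p v n x \<in> A}"
  define V where "V = {x \<in> pairs. chord_line x \<in> A}"
  \<comment> \<open>The density of the invariant measure on conormals after central projection to
    the plane; for \<open>K = 1\<close> it is that of the area of the sphere.\<close>
  define w where "w = (\<lambda>u z::real. 1 / sqrt (1 + K * u\<^sup>2 + z\<^sup>2) ^ 3)"
  define d where "d = cross3 p v \<bullet> n"
  have d: "d \<noteq> 0" "d\<^sup>2 = vol2 K" using frame_det_nonzero[OF f] frame_det_squared[OF f] by (simp_all add: d_def)
  define NW where "NW = (\<lambda>x. cross3 (geod K p v (fst x)) (crossing_direction K p v n x))"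
  define NV where "NV = (\<lambda>x. cross3 (c (fst x)) (c (snd x)))"
  have box_borel: "{0<..<m} \<times> {0<..<pi} \<in> sets borel" by (intro borel_open open_Times) auto
  have Wb: "W \<in> sets borel" unfolding W_def by (rule crossing_preimage_borel[OF A f box_borel])
  have Vb: "V \<in> sets borel" unfolding V_def by (rule chord_line_preimage_borel[OF A])
  have W: "0 < fst x" "fst x < m" "0 < snd x" "snd x < pi" "0 < sin (snd x)" "0 < cosK K (fst x)" if "x \<in> W" for x
  proof -
    show 1: "0 < fst x" "fst x < m" "0 < snd x" "snd x < pi" using that by (auto simp: W_def)
    show "0 < sin (snd x)" using 1 by (intro sin_gt_zero)
    \<comment> \<open>The chart divides by this value; the bound
      \<open>2 * m \<le> pi / sqrt K\<close> keeps it positive.\<close>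
    show "0 < cosK K (fst x)" using 1 m by (intro cosK_pos) (auto simp: short_def)
  qed
  have NW: "NW x \<bullet> p = sin (snd x) * sinK K (fst x) * d" "NW x \<bullet> v = - sin (snd x) * cosK K (fst x) * d"
      "NW x \<bullet> n = cos (snd x) * d" for x
    unfolding NW_def d_def by (rule crossing_conormal[OF f])+
  have VW: "\<exists>l. l \<noteq> 0 \<and> NW y = l *\<^sub>R NV x" if "x \<in> V" "crossing_geodesic K p v n y = chord_line x" for x y
  proof -
    have xp: "x \<in> pairs" using that by (simp add: V_def)
    have "geodesic_line K (c (fst x)) (dir x) = geodesic_line K (geod K p v (fst y)) (crossing_direction K p v n y)"
      using that by (simp add: crossing_geodesic_eq chord_line_def)
    then obtain l where "l \<noteq> 0" "NW y = l *\<^sub>R cross3 (c (fst x)) (dir x)"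
      using same_line_parallel[OF dir_unit_tangent[OF xp] unit_tangent_crossing[OF f]] unfolding NW_def by metis
    then show ?thesis using chord_line_is_chord(4)[OF xp] S_pos[OF pairs_neq[OF xp]]
      by (intro exI[of _ "l / S (fst x) (snd x)"]) (simp add: NV_def)
  qed
  \<comment> \<open>Each line of \<open>A\<close> crosses the segment, so its conormal is
    proportional to one in crossing coordinates, whose product with \<open>v\<close> is
    nonzero.\<close>
  have V: "NV x \<bullet> v \<noteq> 0" "x \<in> pairs" if xV: "x \<in> V" for x
  proof -
    show "x \<in> pairs" using xV by (simp add: V_def)
    have "chord_line x \<in> A" using xV by (simp add: V_def)
    then obtain y where y: "y \<in> {0<..<m} \<times> {0<..<pi}" "crossing_geodesic K p v n y = chord_line x"
      using A1 by force
    then have yW: "y \<in> W" using xV by (simp add: W_def V_def)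
    obtain l where l: "l \<noteq> 0" "NW y = l *\<^sub>R NV x" using VW[OF xV y(2)] by blast
    have "NW y \<bullet> v \<noteq> 0" using NW(2) W[OF yW] d by simp
    then show "NV x \<bullet> v \<noteq> 0" using l by auto
  qed
  define g1 where "g1 = (\<lambda>x :: real \<times> real. sinK K (fst x) / cosK K (fst x))"
  define g2 where "g2 = (\<lambda>x :: real \<times> real. cos (snd x) / (sin (snd x) * cosK K (fst x)))"
  define k1 where "k1 = (\<lambda>x. - (NV x \<bullet> p) / (NV x \<bullet> v))"
  define k2 where "k2 = (\<lambda>x. - (NV x \<bullet> n) / (NV x \<bullet> v))"
  \<comment> \<open>Conormals of the same line differ by a factor, which the homogeneous quotients
    do not see.\<close>
  have gk: "g1 y = k1 x \<and> g2 y = k2 x" if H: "x \<in> V" "y \<in> W" "crossing_geodesic K p v n y = chord_line x" for x y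
  proof -
    obtain l where l: "l \<noteq> 0" "NW y = l *\<^sub>R NV x" using VW[OF H(1,3)] by blast
    have "g1 y = - (NW y \<bullet> p) / (NW y \<bullet> v)" "g2 y = - (NW y \<bullet> n) / (NW y \<bullet> v)"
      unfolding NW g1_def g2_def using W(5,6)[OF H(2)] d(1) by simp_all
    moreover have "- (NW y \<bullet> p) / (NW y \<bullet> v) = k1 x" "- (NW y \<bullet> n) / (NW y \<bullet> v) = k2 x"
      using l(1) unfolding l(2) k1_def k2_def by simp_all
    ultimately show ?thesis by (simp only:)
  qed
  \<comment> \<open>Both parameter sets describe exactly the lines of \<open>A\<close>, once as
    crossings and once as chords, so the charts have the same image.\<close>
  have img: "(\<lambda>x. vector [g1 x, g2 x] :: real^2) ` W = (\<lambda>x. vector [k1 x, k2 x]) ` V"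
  proof (intro equalityI subsetI)
    fix z assume "z \<in> (\<lambda>x. vector [g1 x, g2 x] :: real^2) ` W"
    then obtain y where y: "y \<in> W" "z = vector [g1 y, g2 y]" by blast
    then obtain x where x: "x \<in> pairs" "crossing_geodesic K p v n y = chord_line x" using A2 by (auto simp: W_def)
    then have "x \<in> V" using y by (simp add: W_def V_def)
    then show "z \<in> (\<lambda>x. vector [k1 x, k2 x]) ` V"
      using gk[OF _ y(1) x(2)] y(2) by (intro image_eqI[of _ _ x]) simp_all
  next
    fix z assume "z \<in> (\<lambda>x. vector [k1 x, k2 x] :: real^2) ` V"
    then obtain x where x: "x \<in> V" "z = vector [k1 x, k2 x]" by blast
    then have "chord_line x \<in> A" by (simp add: V_def)
    then obtain y where y: "y \<in> {0<..<m} \<times> {0<..<pi}" "crossing_geodesic K p v n y = chord_line x"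
      using A1 by force
    then have "y \<in> W" using x by (simp add: W_def V_def)
    then show "z \<in> (\<lambda>x. vector [g1 x, g2 x]) ` W"
      using gk[OF x(1) _ y(2)] x(2) by (intro image_eqI[of _ _ y]) simp_all
  qed
  \<comment> \<open>The change of variables is stated for a real value. Finiteness comes from the
    crossing side, where the density is at most 1 on a bounded box, and the pairs inherit
    it.\<close>
  define b where "b = enn2real (\<integral>\<^sup>+ x. ennreal (indicator W x * sin (snd x)) \<partial>lborel)"
  have "(\<integral>\<^sup>+ x. ennreal (indicator W x * sin (snd x)) \<partial>lborel) \<le> (\<integral>\<^sup>+ x. indicator (cbox (0, 0) (m, pi)) x \<partial>lborel)"
    by (intro nn_integral_mono) (auto simp: indicator_def W_def cbox_Pair_eq)
  also have "\<dots> = emeasure lborel (cbox (0, 0) (m, pi))" by simp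
  also have "\<dots> < \<infinity>" by (rule emeasure_lborel_cbox_finite)
  finally have b: "(\<integral>\<^sup>+ x. ennreal (indicator W x * sin (snd x)) \<partial>lborel) = ennreal b" by (simp add: b_def)
  have b0: "0 \<le> b" by (simp add: b_def)
  have "(\<integral>\<^sup>+ x. ennreal (indicator W x * sin (snd x)) \<partial>lborel) = ennreal b \<longleftrightarrow>
    (\<lambda>y. w (y $ 1) (y $ 2)) absolutely_integrable_on (\<lambda>x. vector [g1 x, g2 x] :: real^2) ` W \<and>
    integral ((\<lambda>x. vector [g1 x, g2 x] :: real^2) ` W) (\<lambda>y. w (y $ 1) (y $ 2)) = b"
  proof (rule change_of_variables_chart[where pa = "\<lambda>x. 1 / (cosK K (fst x))\<^sup>2" and pb = "\<lambda>x. 0"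
        and qa = "\<lambda>x. cos (snd x) * K * sinK K (fst x) / (sin (snd x) * (cosK K (fst x))\<^sup>2)"
        and qb = "\<lambda>x. - 1 / ((sin (snd x))\<^sup>2 * cosK K (fst x))"])
    fix x assume x: "x \<in> W"
    note Wx = W[OF x]
    have ds: "((\<lambda>x. sinK K (fst x)) has_derivative (\<lambda>h. cosK K (fst x) * fst h)) (at x)"
      by (rule has_derivative_compose[OF has_derivative_fst[OF has_derivative_ident]
            has_field_derivative_sinK[unfolded has_field_derivative_def]])
    have dc: "((\<lambda>x. cosK K (fst x)) has_derivative (\<lambda>h. - K * sinK K (fst x) * fst h)) (at x)"
      by (rule has_derivative_compose[OF has_derivative_fst[OF has_derivative_ident]
            has_field_derivative_cosK[unfolded has_field_derivative_def]])
    have cs: "(cosK K (fst x))\<^sup>2 + K * (sinK K (fst x))\<^sup>2 = 1" by (rule cosK_sinK_squared)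
    have "(g1 has_derivative (\<lambda>h. (cosK K (fst x) * fst h * cosK K (fst x) - sinK K (fst x) * (- K * sinK K (fst x) * fst h))
        / (cosK K (fst x) * cosK K (fst x)))) (at x)"
      unfolding g1_def by (rule has_derivative_divide'[OF ds dc]) (use Wx in simp)
    moreover have "(cosK K (fst x) * fst h * cosK K (fst x) - sinK K (fst x) * (- K * sinK K (fst x) * fst h))
        / (cosK K (fst x) * cosK K (fst x)) = fst h * (1 / (cosK K (fst x))\<^sup>2) + snd h * 0" for h :: "real \<times> real"
    proof -
      have "cosK K (fst x) * fst h * cosK K (fst x) - sinK K (fst x) * (- K * sinK K (fst x) * fst h)
        = fst h * ((cosK K (fst x))\<^sup>2 + K * (sinK K (fst x))\<^sup>2)" by (simp add: power2_eq_square algebra_simps)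
      then show ?thesis unfolding cs by (simp add: power2_eq_square)
    qed
    ultimately show "(g1 has_derivative (\<lambda>h. fst h * (1 / (cosK K (fst x))\<^sup>2) + snd h * 0)) (at x)" by simp
    have d1: "((\<lambda>x. cos (snd x)) has_derivative (\<lambda>h. - sin (snd x) * snd h)) (at x)"
      by (rule has_derivative_compose[OF has_derivative_snd[OF has_derivative_ident] DERIV_cos[unfolded has_field_derivative_def]])
    have d2: "((\<lambda>x. sin (snd x)) has_derivative (\<lambda>h. cos (snd x) * snd h)) (at x)"
      by (rule has_derivative_compose[OF has_derivative_snd[OF has_derivative_ident] DERIV_sin[unfolded has_field_derivative_def]])
    have "(g2 has_derivative (\<lambda>h. (- sin (snd x) * snd h * (sin (snd x) * cosK K (fst x)) -
        cos (snd x) * (sin (snd x) * (- K * sinK K (fst x) * fst h) + cos (snd x) * snd h * cosK K (fst x)))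
        / ((sin (snd x) * cosK K (fst x)) * (sin (snd x) * cosK K (fst x))))) (at x)"
      unfolding g2_def by (rule has_derivative_divide'[OF d1 has_derivative_mult[OF d2 dc]]) (use Wx in simp)
    moreover have "(- sin (snd x) * snd h * (sin (snd x) * cosK K (fst x)) -
        cos (snd x) * (sin (snd x) * (- K * sinK K (fst x) * fst h) + cos (snd x) * snd h * cosK K (fst x)))
        / ((sin (snd x) * cosK K (fst x)) * (sin (snd x) * cosK K (fst x)))
        = fst h * (cos (snd x) * K * sinK K (fst x) / (sin (snd x) * (cosK K (fst x))\<^sup>2))
          + snd h * (- 1 / ((sin (snd x))\<^sup>2 * cosK K (fst x)))" for h :: "real \<times> real"
    proof -
      have "- sin (snd x) * snd h * (sin (snd x) * cosK K (fst x)) -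
        cos (snd x) * (sin (snd x) * (- K * sinK K (fst x) * fst h) + cos (snd x) * snd h * cosK K (fst x))
        = fst h * (cos (snd x) * K * sinK K (fst x) * sin (snd x)) - snd h * cosK K (fst x) * ((sin (snd x))\<^sup>2 + (cos (snd x))\<^sup>2)"
        by algebra
      also have "\<dots> = fst h * (cos (snd x) * K * sinK K (fst x) * sin (snd x)) - snd h * cosK K (fst x)"
        unfolding sin_cos_squared_add by simp
      finally have num: "- sin (snd x) * snd h * (sin (snd x) * cosK K (fst x)) -
        cos (snd x) * (sin (snd x) * (- K * sinK K (fst x) * fst h) + cos (snd x) * snd h * cosK K (fst x))
        = fst h * (cos (snd x) * K * sinK K (fst x) * sin (snd x)) - snd h * cosK K (fst x)" .
      show ?thesis unfolding num using Wx(5,6) by (simp add: diff_divide_distrib power2_eq_square mult_ac)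
    qed
    ultimately show "(g2 has_derivative (\<lambda>h. fst h * (cos (snd x) * K * sinK K (fst x) / (sin (snd x) * (cosK K (fst x))\<^sup>2))
          + snd h * (- 1 / ((sin (snd x))\<^sup>2 * cosK K (fst x))))) (at x)" by simp
    show "\<bar>1 / (cosK K (fst x))\<^sup>2 * (- 1 / ((sin (snd x))\<^sup>2 * cosK K (fst x))) -
        0 * (cos (snd x) * K * sinK K (fst x) / (sin (snd x) * (cosK K (fst x))\<^sup>2))\<bar> * w (g1 x) (g2 x) = sin (snd x)"
    proof -
      define sa ca ck sk where "sa = sin (snd x)" and "ca = cos (snd x)" and "ck = cosK K (fst x)" and "sk = sinK K (fst x)"
      have pos: "0 < sa" "0 < ck" using Wx by (auto simp: sa_def ck_def)
      have 1: "ck\<^sup>2 + K * sk\<^sup>2 = 1" "sa\<^sup>2 + ca\<^sup>2 = 1" using cs by (simp_all add: ck_def sk_def sa_def ca_def)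
      \<comment> \<open>In crossing coordinates the weight is \<open>(sa * ck) ^ 3\<close>, and the
        Jacobian \<open>1 / (sa ^ 2 * ck ^ 3)\<close> leaves \<open>sa\<close>.\<close>
      have "1 + K * (sk / ck)\<^sup>2 + (ca / (sa * ck))\<^sup>2 = ((ck\<^sup>2 + K * sk\<^sup>2) * sa\<^sup>2 + ca\<^sup>2) / (sa * ck)\<^sup>2"
        using pos by (simp add: field_simps power2_eq_square)
      also have "\<dots> = (1 / (sa * ck))\<^sup>2" unfolding 1(1) using 1(2) by (simp add: power_divide)
      finally have "w (g1 x) (g2 x) = 1 / (1 / (sa * ck)) ^ 3"
        using pos by (simp add: w_def g1_def g2_def sa_def ca_def ck_def sk_def)
      then show ?thesis unfolding sa_def[symmetric] ck_def[symmetric] using pos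
        by (simp add: field_simps power2_eq_square power3_eq_cube)
    qed
    show "0 \<le> sin (snd x)" using Wx by simp
  next
    show "inj_on (\<lambda>x. (g1 x, g2 x)) W"
    proof (rule inj_onI)
      fix x y assume x: "x \<in> W" and y: "y \<in> W" and e: "(g1 x, g2 x) = (g1 y, g2 y)"
      note Wx = W[OF x] and Wy = W[OF y]
      have "sinK K (fst x) * cosK K (fst y) = cosK K (fst x) * sinK K (fst y)"
        using e Wx Wy by (simp add: g1_def field_simps)
      then have "sinK K (fst x - fst y) = 0" "sinK K (fst y - fst x) = 0" by (simp_all add: sinK_diff mult.commute)
      moreover have "short K (fst x - fst y)" "short K (fst y - fst x)" using Wx Wy m by (auto simp: short_def)
      ultimately have 1: "fst x = fst y"
        using sinK_pos[of "fst x - fst y" K] sinK_pos[of "fst y - fst x" K]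
        by (metis diff_gt_0_iff_gt less_irrefl linorder_neqE_linordered_idom)
      then have "cos (snd x) * sin (snd y) = cos (snd y) * sin (snd x)"
        using e Wx Wy by (simp add: g2_def field_simps)
      then have "sin (snd x - snd y) = 0" "sin (snd y - snd x) = 0" by (simp_all add: sin_diff mult.commute)
      then have "snd x = snd y"
        using sin_gt_zero[of "snd x - snd y"] sin_gt_zero[of "snd y - snd x"] Wx Wy by (cases "snd x" "snd y" rule: linorder_cases) auto
      with 1 show "x = y" by (simp add: prod_eq_iff)
    qed
    have "(\<lambda>x. indicator W x *\<^sub>R sin (snd x)) \<in> borel_measurable borel"
      by (intro borel_measurable_continuous_on_indicator Wb continuous_intros)
    then show "(\<lambda>x. indicator W x * sin (snd x)) \<in> borel_measurable borel" by simp
  qed (fact Wb b0)+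
  with b have fin: "(\<lambda>y. w (y $ 1) (y $ 2)) absolutely_integrable_on (\<lambda>x. vector [k1 x, k2 x] :: real^2) ` V \<and>
    integral ((\<lambda>x. vector [k1 x, k2 x] :: real^2) ` V) (\<lambda>y. w (y $ 1) (y $ 2)) = b"
    unfolding img by simp
  define Ns Nt where "Ns = (\<lambda>x. cross3 (c' (fst x)) (c (snd x)))" and "Nt = (\<lambda>x. cross3 (c (fst x)) (c' (snd x)))"
  have dN: "((\<lambda>x. NV x \<bullet> q) has_derivative (\<lambda>h. fst h * (Ns x \<bullet> q) + snd h * (Nt x \<bullet> q))) (at x)" for q x
    unfolding NV_def Ns_def Nt_def by (rule cross_c_deriv)
  have "(\<integral>\<^sup>+ x. ennreal (indicator V x * J (fst x) (snd x)) \<partial>lborel) = ennreal b \<longleftrightarrow>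
    (\<lambda>y. w (y $ 1) (y $ 2)) absolutely_integrable_on (\<lambda>x. vector [k1 x, k2 x] :: real^2) ` V \<and>
    integral ((\<lambda>x. vector [k1 x, k2 x] :: real^2) ` V) (\<lambda>y. w (y $ 1) (y $ 2)) = b"
  proof (rule change_of_variables_chart[where
        pa = "\<lambda>x. - ((Ns x \<bullet> p) * (NV x \<bullet> v) - (NV x \<bullet> p) * (Ns x \<bullet> v)) / (NV x \<bullet> v)\<^sup>2" and
        pb = "\<lambda>x. - ((Nt x \<bullet> p) * (NV x \<bullet> v) - (NV x \<bullet> p) * (Nt x \<bullet> v)) / (NV x \<bullet> v)\<^sup>2" and
        qa = "\<lambda>x. - ((Ns x \<bullet> n) * (NV x \<bullet> v) - (NV x \<bullet> n) * (Ns x \<bullet> v)) / (NV x \<bullet> v)\<^sup>2" and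
        qb = "\<lambda>x. - ((Nt x \<bullet> n) * (NV x \<bullet> v) - (NV x \<bullet> n) * (Nt x \<bullet> v)) / (NV x \<bullet> v)\<^sup>2"])
    fix x assume x: "x \<in> V"
    note Vx = V[OF x]
    show "(k1 has_derivative (\<lambda>h. fst h * (- ((Ns x \<bullet> p) * (NV x \<bullet> v) - (NV x \<bullet> p) * (Ns x \<bullet> v)) / (NV x \<bullet> v)\<^sup>2)
        + snd h * (- ((Nt x \<bullet> p) * (NV x \<bullet> v) - (NV x \<bullet> p) * (Nt x \<bullet> v)) / (NV x \<bullet> v)\<^sup>2))) (at x)"
      unfolding k1_def by (rule quotient_derivative[OF dN dN Vx(1)])
    show "(k2 has_derivative (\<lambda>h. fst h * (- ((Ns x \<bullet> n) * (NV x \<bullet> v) - (NV x \<bullet> n) * (Ns x \<bullet> v)) / (NV x \<bullet> v)\<^sup>2)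
        + snd h * (- ((Nt x \<bullet> n) * (NV x \<bullet> v) - (NV x \<bullet> n) * (Nt x \<bullet> v)) / (NV x \<bullet> v)\<^sup>2))) (at x)"
      unfolding k2_def by (rule quotient_derivative[OF dN dN Vx(1)])
    define D1 D2 where "D1 = NV x \<bullet> c' (fst x)" and "D2 = NV x \<bullet> c' (snd x)"
    define B where "B = NV x \<bullet> v"
    define s where "s = S (fst x) (snd x)"
    have s: "0 < s" and B: "B \<noteq> 0" using S_pos[OF pairs_neq[OF Vx(2)]] Vx by (simp_all add: s_def B_def)
    \<comment> \<open>The determinant of \<open>NV x\<close>, \<open>Ns x\<close> and
      \<open>Nt x\<close> splits into the two factors in the numerator of \<open>J\<close>, and the
      frame contributes \<open>d\<close>.\<close>
    have det: "(- ((Ns x \<bullet> p) * (NV x \<bullet> v) - (NV x \<bullet> p) * (Ns x \<bullet> v)) / (NV x \<bullet> v)\<^sup>2) *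
        (- ((Nt x \<bullet> n) * (NV x \<bullet> v) - (NV x \<bullet> n) * (Nt x \<bullet> v)) / (NV x \<bullet> v)\<^sup>2) -
        (- ((Nt x \<bullet> p) * (NV x \<bullet> v) - (NV x \<bullet> p) * (Nt x \<bullet> v)) / (NV x \<bullet> v)\<^sup>2) *
        (- ((Ns x \<bullet> n) * (NV x \<bullet> v) - (NV x \<bullet> n) * (Ns x \<bullet> v)) / (NV x \<bullet> v)\<^sup>2) = - (D1 * D2 * d) / B ^ 3"
      unfolding quotient_jacobian[OF Vx(1)] triple_product_gram d_def[symmetric] B_def
      unfolding NV_def Ns_def Nt_def triple_product_of_crosses D1_def D2_def ..
    \<comment> \<open>\<open>NV x\<close> is \<open>s\<close> times the conormal of a unit tangent
      vector, so \<open>dual_form_normalized\<close> evaluates the weight; the powers of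
      \<open>B\<close> then cancel against the Jacobian.\<close>
    have "NV x = s *\<^sub>R cross3 (c (fst x)) (dir x)" unfolding NV_def s_def by (rule chord_line_is_chord(4)[OF Vx(2)])
    then have "K * (NV x \<bullet> p)\<^sup>2 + (NV x \<bullet> v)\<^sup>2 + (NV x \<bullet> n)\<^sup>2 = s\<^sup>2 * vol2 K"
      unfolding dual_form_normalized[OF f dir_unit_tangent[OF Vx(2)], symmetric]
      by (simp add: power_mult_distrib algebra_simps)
    then have "1 + K * (k1 x)\<^sup>2 + (k2 x)\<^sup>2 = s\<^sup>2 * d\<^sup>2 / B\<^sup>2"
      unfolding k1_def k2_def d(2) B_def using Vx(1) by (simp add: field_simps)
    then have "1 + K * (k1 x)\<^sup>2 + (k2 x)\<^sup>2 = (s * \<bar>d\<bar> / \<bar>B\<bar>)\<^sup>2" by (simp add: power_divide power_mult_distrib)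
    then have w: "w (k1 x) (k2 x) = 1 / (s * \<bar>d\<bar> / \<bar>B\<bar>) ^ 3" using s by (simp add: w_def)
    have "\<bar>- (D1 * D2 * d) / B ^ 3\<bar> * w (k1 x) (k2 x) = \<bar>D1 * D2\<bar> / (\<bar>d\<bar>\<^sup>2 * s ^ 3)"
      unfolding w using s B d by (simp add: abs_mult power_abs field_simps power2_eq_square power3_eq_cube)
    also have "\<dots> = \<bar>J (fst x) (snd x)\<bar>"
      using s vol2_pos[of K] by (simp add: J_def D1_def D2_def NV_def s_def d abs_mult)
    also have "\<dots> = J (fst x) (snd x)"
      using J_nonneg[of "fst x" "snd x"] Vx(2) by (auto simp: pairs_def)
    finally show "\<bar>(- ((Ns x \<bullet> p) * (NV x \<bullet> v) - (NV x \<bullet> p) * (Ns x \<bullet> v)) / (NV x \<bullet> v)\<^sup>2) *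
        (- ((Nt x \<bullet> n) * (NV x \<bullet> v) - (NV x \<bullet> n) * (Nt x \<bullet> v)) / (NV x \<bullet> v)\<^sup>2) -
        (- ((Nt x \<bullet> p) * (NV x \<bullet> v) - (NV x \<bullet> p) * (Nt x \<bullet> v)) / (NV x \<bullet> v)\<^sup>2) *
        (- ((Ns x \<bullet> n) * (NV x \<bullet> v) - (NV x \<bullet> n) * (Ns x \<bullet> v)) / (NV x \<bullet> v)\<^sup>2)\<bar> * w (k1 x) (k2 x) = J (fst x) (snd x)"
      unfolding det .
    show "0 \<le> J (fst x) (snd x)" using J_nonneg[of "fst x" "snd x"] Vx(2) by (auto simp: pairs_def)
  next
    show "inj_on (\<lambda>x. (k1 x, k2 x)) V"
    proof (rule inj_onI)
      fix x y assume x: "x \<in> V" and y: "y \<in> V" and e: "(k1 x, k2 x) = (k1 y, k2 y)"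
      note Vx = V[OF x] and Vy = V[OF y]
      have "(NV y \<bullet> v) *\<^sub>R NV x = (NV x \<bullet> v) *\<^sub>R NV y"
        by (rule frame_dots_eq[OF f]) (use e Vx Vy in \<open>simp_all add: k1_def k2_def field_simps\<close>)
      then have "((NV y \<bullet> v) * S (fst x) (snd x)) *\<^sub>R cross3 (c (fst x)) (dir x)
          = ((NV x \<bullet> v) * S (fst y) (snd y)) *\<^sub>R cross3 (c (fst y)) (dir y)"
        using chord_line_is_chord(4)[OF Vx(2)] chord_line_is_chord(4)[OF Vy(2)] by (simp add: NV_def)
      from arg_cong[OF this, of "\<lambda>z. (1 / ((NV y \<bullet> v) * S (fst x) (snd x))) *\<^sub>R z"]
      have "cross3 (c (fst x)) (dir x) = ((NV x \<bullet> v) * S (fst y) (snd y) / ((NV y \<bullet> v) * S (fst x) (snd x))) *\<^sub>R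
          cross3 (c (fst y)) (dir y)" using Vy(1) S_pos[OF pairs_neq[OF Vx(2)]] by simp
      moreover have "(NV x \<bullet> v) * S (fst y) (snd y) / ((NV y \<bullet> v) * S (fst x) (snd x)) \<noteq> 0"
        using Vx(1) Vy(1) S_pos[OF pairs_neq[OF Vx(2)]] S_pos[OF pairs_neq[OF Vy(2)]] by simp
      ultimately have "chord_line x = chord_line y"
        unfolding chord_line_def using parallel_same_line[OF dir_unit_tangent[OF Vy(2)] dir_unit_tangent[OF Vx(2)]] by blast
      then show "x = y" using inj_onD[OF chord_line_inj] Vx Vy by blast
    qed
    have "(\<lambda>x. indicator V x *\<^sub>R J (fst x) (snd x)) \<in> borel_measurable borel"
      by (intro borel_measurable_continuous_on_indicator Vb continuous_on_subset[OF J_continuous]) (auto simp: V_def)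
    then show "(\<lambda>x. indicator V x * J (fst x) (snd x)) \<in> borel_measurable borel" by simp
  qed (fact Vb b0)+
  with fin have "(\<integral>\<^sup>+ x. ennreal (indicator V x * J (fst x) (snd x)) \<partial>lborel) = ennreal b" by simp
  moreover have "(\<integral>\<^sup>+ x \<in> {0<..<m} \<times> {0<..<pi}. ennreal (sin (snd x)) * indicator A (crossing_geodesic K p v n x) \<partial>lborel)
      = (\<integral>\<^sup>+ x. ennreal (indicator W x * sin (snd x)) \<partial>lborel)"
    by (intro nn_integral_cong) (auto simp: W_def indicator_def)
  ultimately show ?thesis using b by (simp add: V_def)
qed

end

section \<open>Measurability of sets of geodesics\<close>

lemma space_form_borel: "space_form K \<in> sets borel"
proof -
  have q: "continuous_on UNIV (\<lambda>x. qform K x x)" unfolding qform_def by (intro continuous_intros)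
  have 3: "continuous_on UNIV (\<lambda>x::real^3. x $ 3)" by (intro continuous_intros)
  have "space_form K = (if K = 0 then {x. x $ 3 = 1} else {x. qform K x x = 1 / K} \<inter> (if K < 0 then {x. 0 < x $ 3} else UNIV))"
    by (auto simp: space_form_iff)
  moreover have "closed {x::real^3. x $ 3 = 1}" "closed {x. qform K x x = 1 / K}" "open {x::real^3. 0 < x $ 3}"
    using q 3 by (auto intro!: closed_Collect_eq open_Collect_less continuous_on_const)
  ultimately show ?thesis by auto
qed

lemma unit_tangent_borel: "{(p, v). unit_tangent K p v} \<in> sets borel"
proof -
  have c: "continuous_on UNIV (\<lambda>z. qform K (fst z) (snd z))" "continuous_on UNIV (\<lambda>z::(real^3)\<times>(real^3). qform K (snd z) (snd z))"
    "continuous_on UNIV (\<lambda>z::(real^3)\<times>(real^3). snd z $ 3)"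
    unfolding qform_def by (intro continuous_intros)+
  have "{(p, v). unit_tangent K p v} = (space_form K \<times> UNIV) \<inter> {z. (if K = 0 then snd z $ 3 else qform K (fst z) (snd z)) = 0}
      \<inter> {z. qform K (snd z) (snd z) = 1}"
    by (auto simp: unit_tangent_def tangent_def)
  also have "\<dots> \<in> sets borel"
  proof (intro sets.Int)
    have "fst \<in> borel_measurable (borel :: ((real^3) \<times> (real^3)) measure)"
      by (intro borel_measurable_continuous_onI continuous_intros)
    from measurable_sets[OF this space_form_borel[of K]]
    show "space_form K \<times> (UNIV :: (real^3) set) \<in> sets borel" by (simp add: fst_vimage_eq_Times)
    show "{z. (if K = 0 then snd z $ 3 else qform K (fst z) (snd z)) = 0} \<in> sets borel"
      using c by (cases "K = 0") (auto intro!: borel_closed closed_Collect_eq continuous_on_const)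
    show "{z::(real^3)\<times>(real^3). qform K (snd z) (snd z) = 1} \<in> sets borel"
      using c by (auto intro!: borel_closed closed_Collect_eq continuous_on_const)
  qed
  finally show ?thesis .
qed

lemma borel_geodesic_setsI:
  assumes "A \<subseteq> geodesics K" "B \<in> sets borel"
    and "\<And>p v. unit_tangent K p v \<Longrightarrow> geodesic_line K p v \<in> A \<longleftrightarrow> (p, v) \<in> B"
  shows "A \<in> borel_geodesic_sets K"
proof -
  have "{(p, v). unit_tangent K p v \<and> geodesic_line K p v \<in> A} = {(p, v). unit_tangent K p v} \<inter> B"
    using assms(3) by auto
  then show ?thesis using assms(1,2) unit_tangent_borel[of K] by (simp add: borel_geodesic_sets_def)
qed

lemma continuous_on_cross_triple: "continuous_on A (\<lambda>z. cross3 (fst z) (snd z) \<bullet> q)"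
  by (intro continuous_intros continuous_on_cross)

text \<open>The unit tangent vectors whose geodesic separates the endpoints of the segment of length \<open>m\<close>.\<close>
definition crossing_frame :: "real \<Rightarrow> real \<Rightarrow> real^3 \<Rightarrow> real^3 \<Rightarrow> ((real^3) \<times> (real^3)) set" where
  "crossing_frame K m p v = {z. (cross3 (fst z) (snd z) \<bullet> p) * (cross3 (fst z) (snd z) \<bullet> geod K p v m) < 0}"

lemma open_crossing_frame: "open (crossing_frame K m p v)"
  unfolding crossing_frame_def
  by (intro open_Collect_less continuous_intros continuous_on_cross_triple)

text \<open>The product of the conormal with the point of the segment changes sign, so there is a
  crossing point inside. The direction there can be turned to the side of \<open>n\<close>; a
  direction along the segment would make the product vanish at \<open>p\<close>, against the strict
  inequality.\<close>

lemma crossing_frame_crosses: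
  assumes f: "orthonormal_frame K p v n" and m: "0 < m" and w: "unit_tangent K q w" and z: "(q, w) \<in> crossing_frame K m p v"
  shows "geodesic_line K q w \<in> crossing_geodesic K p v n ` ({0<..<m} \<times> {0<..<pi})"
proof -
  define N where "N = cross3 q w"
  define g where "g = (\<lambda>l. N \<bullet> geod K p v l)"
  have neg: "g 0 * g m < 0" using z by (simp add: crossing_frame_def g_def N_def)
  have cont: "continuous_on {0..m} g" unfolding g_def geod_def by (intro continuous_intros)
  have "\<exists>l\<ge>0. l \<le> m \<and> g l = 0"
  proof (cases "g 0 \<le> 0")
    case True
    then show ?thesis using neg m IVT'[of g 0 0 m, OF _ _ _ cont] by (auto simp: mult_less_0_iff)
  next
    case False
    then show ?thesis using neg m IVT2'[of g m 0 0, OF _ _ _ cont] by (auto simp: mult_less_0_iff)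
  qed
  then obtain l where l: "0 \<le> l" "l \<le> m" "g l = 0" by blast
  then have l': "0 < l" "l < m" using neg by (auto simp: less_le)
  define x where "x = geod K p v l"
  have v: "unit_tangent K p v" using orthonormal_frameD(1)[OF f] .
  have "x \<in> geodesic_line K q w" using l(3) unit_tangent_geod(2)[OF v, of l] by (simp add: geodesic_line_eq[OF w] x_def g_def N_def)
  then obtain s where s: "x = geod K q w s" by (auto simp: geodesic_line_def)
  define u where "u = geod_vel K q w s"
  have u: "unit_tangent K x u" using unit_tangent_geod(1)[OF w, of s] by (simp add: s u_def)
  have xq: "x \<in> geodesic_line K q w" using s by (simp add: geodesic_line_def)
  have Nu: "N \<bullet> u = 0" by (simp add: N_def u_def geod_vel_def cross3_simps)
  define gv where "gv = geod_vel K p v l"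
  have fx: "orthonormal_frame K x gv n" using orthonormal_frame_geod[OF f, of l] by (simp add: x_def gv_def)
  have key: "geodesic_line K q w \<in> crossing_geodesic K p v n ` ({0<..<m} \<times> {0<..<pi})"
    if u: "unit_tangent K x u" and Nu: "N \<bullet> u = 0" and pos: "0 < qform K u n" for u
  proof -
    define A B where "A = qform K u gv" and "B = qform K u n"
    have ue: "u = A *\<^sub>R gv + B *\<^sub>R n"
      using frame_tangent_expansion[OF fx] u by (simp add: unit_tangent_def A_def B_def)
    have "A * A + B * B = 1"
      using frame_qform[OF fx, of u u] u by (simp add: unit_tangent_def A_def B_def)
    then have AB: "A\<^sup>2 + B\<^sup>2 = 1" "0 < B" using pos by (simp_all add: power2_eq_square B_def)
    then have "A\<^sup>2 < 1" by (smt (verit) zero_less_power)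
    then have A: "-1 < A" "A < 1" by (simp_all add: abs_square_less_1 abs_less_iff)
    define a where "a = arccos A"
    have a: "0 < a" "a < pi" using A arccos_lt_bounded by (auto simp: a_def)
    have "cos a = A" using A by (simp add: a_def)
    moreover have "1 - A\<^sup>2 = B\<^sup>2" using AB by simp
    then have "sqrt (1 - A\<^sup>2) = B" using AB(2) by (simp only: real_sqrt_abs abs_of_pos)
    then have "sin a = B" using A by (simp add: a_def sin_arccos)
    ultimately have "u = crossing_direction K p v n (l, a)" using ue by (simp add: crossing_direction_def gv_def)
    moreover have "geodesic_line K x u = geodesic_line K q w"
      using geodesic_line_through(1)[OF w xq u] Nu by (simp add: N_def)
    ultimately have "geodesic_line K q w = crossing_geodesic K p v n (l, a)" by (simp add: crossing_geodesic_eq x_def)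
    then show ?thesis using a l' by (intro image_eqI[of _ _ "(l, a)"]) auto
  qed
  have "qform K u n \<noteq> 0"
  proof
    assume *: "qform K u n = 0"
    have ue: "u = qform K u gv *\<^sub>R gv" using frame_tangent_expansion[OF fx, of u] u * by (simp add: unit_tangent_def)
    obtain k where k: "k \<noteq> 0" "cross3 x u = k *\<^sub>R N" using geodesic_line_through(2)[OF w xq u] Nu by (auto simp: N_def)
    have "cross3 x u = qform K u gv *\<^sub>R cross3 p v"
      by (subst ue) (simp add: cross_mult_right x_def gv_def cross3_geod[OF v])
    then have "k *\<^sub>R N = qform K u gv *\<^sub>R cross3 p v" using k by simp
    from arg_cong[OF this, of "\<lambda>z. z \<bullet> p"] have "k * (N \<bullet> p) = 0" by (simp add: dot_cross_self inner_commute)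
    then have "g 0 = 0" using k by (simp add: g_def)
    then show False using neg by simp
  qed
  then have "0 < qform K u n \<or> 0 < qform K (- u) n" by (auto simp: qform_linear linorder_neq_iff)
  then consider "0 < qform K u n" | "0 < qform K (- u) n" by blast
  then show ?thesis
    by cases (use key[OF u Nu] key[OF unit_tangent_minus[OF u]] Nu in auto)
qed

text \<open>The segment is centred at \<open>p0\<close> and perpendicular to \<open>v0\<close>,
  which completes the frame at its starting point. The two products with the conormal are opposite
  because \<open>sinK\<close> is odd.\<close>

lemma crossing_frame_exists:
  assumes v0: "unit_tangent K p0 v0" and m: "0 < m" "short K m"
  obtains p v n where "orthonormal_frame K p v n" "(p0, v0) \<in> crossing_frame K m p v"
proof -
  obtain n0 where "orthonormal_frame K p0 v0 n0" using orthonormal_frame_exists[OF v0] by blast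
  then have f: "orthonormal_frame K p0 n0 v0" by (auto simp: orthonormal_frame_def qform_commute)
  define p v where "p = geod K p0 n0 (- m / 2)" and "v = geod_vel K p0 n0 (- m / 2)"
  have "orthonormal_frame K p v v0" unfolding p_def v_def by (rule orthonormal_frame_geod[OF f])
  moreover have e: "geod K p v m = geod K p0 n0 (m / 2)" unfolding p_def v_def geod_geod by (simp add: field_simps)
  have "(p0, v0) \<in> crossing_frame K m p v"
  proof -
    define d where "d = cross3 p0 v0 \<bullet> n0"
    have "d = - (cross3 p0 n0 \<bullet> v0)" by (simp add: d_def cross3_simps)
    then have d: "d \<noteq> 0" using frame_det_nonzero[OF f] by simp
    have g: "cross3 p0 v0 \<bullet> geod K p0 n0 t = sinK K t * d" for t
      by (simp add: geod_def d_def inner_add_right dot_cross_self inner_commute)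
    have s: "0 < sinK K (m / 2)" using m by (intro sinK_pos short_mono[OF m(2)]) auto
    have "(cross3 p0 v0 \<bullet> p) * (cross3 p0 v0 \<bullet> geod K p v m) = - ((sinK K (m / 2))\<^sup>2 * d\<^sup>2)"
      unfolding e unfolding p_def g using sinK_minus[of K "m / 2"] by (simp add: power2_eq_square)
    also have "\<dots> < 0" using s d by simp
    finally show ?thesis by (simp add: crossing_frame_def)
  qed
  ultimately show thesis using that by blast
qed

text \<open>The sets of unit tangent vectors that cross one given segment are open, so Lindelof's
  theorem selects countably many of them.\<close>

lemma countable_crossing_cover:
  assumes m: "0 < m" "short K m"
  obtains F :: "nat \<Rightarrow> (real^3) \<times> (real^3) \<times> (real^3)"
  where "\<And>i. case F i of (p, v, n) \<Rightarrow> orthonormal_frame K p v n"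
    and "\<And>q w. unit_tangent K q w \<Longrightarrow> \<exists>i. case F i of (p, v, n) \<Rightarrow> (q, w) \<in> crossing_frame K m p v"
proof -
  define \<F> where "\<F> = {crossing_frame K m p v | p v n. orthonormal_frame K p v n}"
  obtain \<F>' where F': "\<F>' \<subseteq> \<F>" "countable \<F>'" "\<Union>\<F>' = \<Union>\<F>"
    using Lindelof[of \<F>] open_crossing_frame unfolding \<F>_def by (smt (verit) mem_Collect_eq)
  have cov: "\<exists>S\<in>\<F>'. (q, w) \<in> S" if "unit_tangent K q w" for q w
  proof -
    have "(q, w) \<in> \<Union>\<F>" using crossing_frame_exists[OF that m] unfolding \<F>_def by (smt (verit) UnionI mem_Collect_eq)
    then show ?thesis using F'(3) by auto
  qed
  \<comment> \<open>One point of the surface, needed only to see that the subcover is nonempty and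
    can be enumerated by the natural numbers.\<close>
  define p1 :: "real^3" where "p1 = (if K = 0 then vector [0, 0, 1] else vector [0, 0, 1 / sqrt \<bar>K\<bar>])"
  have "p1 \<in> space_form K"
  proof (cases "K > 0")
    case False
    then show ?thesis by (auto simp: p1_def space_form_iff qform_def)
  qed (simp add: p1_def space_form_iff qform_def)
  then obtain v1 where v1: "unit_tangent K p1 v1" using unit_tangent_exists by blast
  have ne: "\<F>' \<noteq> {}" using cov[OF v1] by auto
  have "\<exists>z. (case z of (p, v, n) \<Rightarrow> orthonormal_frame K p v n) \<and> from_nat_into \<F>' i = crossing_frame K m (fst z) (fst (snd z))" for i
    using from_nat_into[OF ne, of i] F'(1) unfolding \<F>_def by force
  then obtain F where F: "\<And>i. case F i of (p, v, n) \<Rightarrow> orthonormal_frame K p v n"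
    "\<And>i. from_nat_into \<F>' i = crossing_frame K m (fst (F i)) (fst (snd (F i)))" by metis
  show thesis
  proof (rule that[of F])
    fix q w assume "unit_tangent K q w"
    then obtain S where S: "S \<in> \<F>'" "(q, w) \<in> S" using cov by blast
    then obtain i where "from_nat_into \<F>' i = S" using from_nat_into_surj[OF F'(2)] by blast
    then show "\<exists>i. case F i of (p, v, n) \<Rightarrow> (q, w) \<in> crossing_frame K m p v"
      using F(2)[of i] S(2) by (intro exI[of _ i]) (simp add: case_prod_beta)
  qed (rule F(1))
qed

definition crossing_lines :: "real \<Rightarrow> real \<Rightarrow> real^3 \<Rightarrow> real^3 \<Rightarrow> (real^3) set set" where
  "crossing_lines K m p v = {geodesic_line K q w | q w. unit_tangent K q w \<and> (q, w) \<in> crossing_frame K m p v}"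

text \<open>Another representative of the line multiplies the conormal by some
  \<open>l \<noteq> 0\<close> and the product of the two values by \<open>l * l\<close>, so the sign
  is a property of the line.\<close>

lemma crossing_lines_iff:
  assumes "unit_tangent K q w"
  shows "geodesic_line K q w \<in> crossing_lines K m p v \<longleftrightarrow> (q, w) \<in> crossing_frame K m p v"
proof
  assume "geodesic_line K q w \<in> crossing_lines K m p v"
  then obtain q' w' where *: "geodesic_line K q w = geodesic_line K q' w'" "unit_tangent K q' w'" "(q', w') \<in> crossing_frame K m p v"
    by (auto simp: crossing_lines_def)
  obtain l where l: "l \<noteq> 0" "cross3 q' w' = l *\<^sub>R cross3 q w" using same_line_parallel[OF assms *(2,1)] .
  have "(l * l) * ((cross3 q w \<bullet> p) * (cross3 q w \<bullet> geod K p v m)) < 0"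
    using *(3) by (simp add: crossing_frame_def l(2) algebra_simps)
  moreover have "0 < l * l" using l(1) not_real_square_gt_zero by blast
  ultimately show "(q, w) \<in> crossing_frame K m p v" by (simp add: crossing_frame_def mult_less_0_iff)
qed (use assms in \<open>auto simp: crossing_lines_def\<close>)

lemma crossing_lines_borel: "crossing_lines K m p v \<in> borel_geodesic_sets K"
  by (rule borel_geodesic_setsI[OF _ borel_open[OF open_crossing_frame] crossing_lines_iff])
    (auto simp: crossing_lines_def geodesics_def)

text \<open>A closed relation stays closed under projection along a compact factor; this is how
  existence of a point of \<open>D\<close> or of a pair becomes a measurable condition.\<close>

lemma closed_exists_compact:
  fixes h :: "'a::euclidean_space \<Rightarrow> 'b::euclidean_space \<Rightarrow> real"
  assumes "compact C" "continuous_on UNIV (\<lambda>z. h (fst z) (snd z))"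
  shows "closed {y. \<exists>x\<in>C. h x y = 0}"
proof -
  have "closed {y. \<exists>x. x \<in> C \<and> (x, y) \<in> {z. h (fst z) (snd z) = 0}}"
    using assms by (intro closed_compact_projection closed_Collect_eq continuous_on_const)
  then show ?thesis by (simp add: Bex_def)
qed

lemma (in convex_domain) geodesics_meeting_borel: "geodesics_meeting K D \<in> borel_geodesic_sets K"
proof (rule borel_geodesic_setsI)
  show "{z. \<exists>d\<in>D. cross3 (fst z) (snd z) \<bullet> d = 0} \<in> sets borel"
    by (intro borel_closed closed_exists_compact compact_D continuous_intros continuous_on_cross)
  fix p v assume v: "unit_tangent K p v"
  show "geodesic_line K p v \<in> geodesics_meeting K D \<longleftrightarrow> (p, v) \<in> {z. \<exists>d\<in>D. cross3 (fst z) (snd z) \<bullet> d = 0}"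
  proof -
    have "geodesic_line K p v \<in> geodesics K" using v by (auto simp: geodesics_def)
    then show ?thesis using D_space_form by (auto simp: geodesics_meeting_def geodesic_line_eq[OF v])
  qed
qed (auto simp: geodesics_meeting_def)

section \<open>Measurable families of chords\<close>

context smooth_domain
begin

lemma chord_line_iff:
  assumes x: "x \<in> pairs" and v: "unit_tangent K p v"
  shows "geodesic_line K p v = chord_line x \<longleftrightarrow> cross3 p v \<bullet> c (fst x) = 0 \<and> cross3 p v \<bullet> c (snd x) = 0"
proof
  assume "geodesic_line K p v = chord_line x"
  then show "cross3 p v \<bullet> c (fst x) = 0 \<and> cross3 p v \<bullet> c (snd x) = 0"
    using chord_line_ends[OF x] by (auto simp: geodesic_line_eq[OF v])
next
  assume *: "cross3 p v \<bullet> c (fst x) = 0 \<and> cross3 p v \<bullet> c (snd x) = 0"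
  then have "cross3 p v \<bullet> dir x = 0" by (simp add: dir_def inner_diff_right)
  moreover have "c (fst x) \<in> geodesic_line K p v" using * c_space_form by (simp add: geodesic_line_eq[OF v])
  ultimately show "geodesic_line K p v = chord_line x"
    unfolding chord_line_def using geodesic_line_through(1)[OF v _ dir_unit_tangent[OF x]] by simp
qed

lemma chord_line_geodesic: "x \<in> pairs \<Longrightarrow> chord_line x \<in> geodesics K"
  unfolding chord_line_def geodesics_def using dir_unit_tangent by blast

lemma chord_line_meeting: "x \<in> pairs \<Longrightarrow> chord_line x \<in> geodesics_meeting K D"
  unfolding geodesics_meeting_def using chord_line_geodesic chord_line_ends(1) c_D by blast

text \<open>A line is the chord of a pair exactly when its plane contains both endpoints. This is a
  closed condition, written as one equation by a sum of squares, and existence over the compact set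
  \<open>P\<close> keeps it closed.\<close>

lemma chord_line_compact_image:
  assumes "compact P" "P \<subseteq> pairs" shows "chord_line ` P \<in> borel_geodesic_sets K"
proof (rule borel_geodesic_setsI)
  define h where "h = (\<lambda>(x :: real \<times> real) (z :: (real^3) \<times> (real^3)).
    (cross3 (fst z) (snd z) \<bullet> c (fst x))\<^sup>2 + (cross3 (fst z) (snd z) \<bullet> c (snd x))\<^sup>2)"
  have "closed {z. \<exists>x\<in>P. h x z = 0}"
    unfolding h_def
    by (intro closed_exists_compact assms(1) continuous_intros continuous_on_cross
        continuous_on_compose2[OF c_continuous[of UNIV]]) auto
  then show "{z. \<exists>x\<in>P. h x z = 0} \<in> sets borel" by (rule borel_closed)
  fix p v assume v: "unit_tangent K p v"
  have "geodesic_line K p v \<in> chord_line ` P \<longleftrightarrow> (\<exists>x\<in>P. geodesic_line K p v = chord_line x)" by auto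
  also have "\<dots> \<longleftrightarrow> (\<exists>x\<in>P. h x (p, v) = 0)"
    using chord_line_iff[OF _ v] assms(2) by (auto simp: h_def sum_power2_eq_zero_iff)
  finally show "geodesic_line K p v \<in> chord_line ` P \<longleftrightarrow> (p, v) \<in> {z. \<exists>x\<in>P. h x z = 0}" by simp
qed (use assms(2) chord_line_geodesic in auto)

text \<open>A compact exhaustion of \<open>pairs\<close>, which is neither open nor closed.\<close>

definition pairs_k :: "nat \<Rightarrow> (real \<times> real) set" where
  "pairs_k k = {x. 0 \<le> fst x \<and> fst x + 1 / (real k + 1) \<le> snd x \<and> snd x \<le> T - 1 / (real k + 1)}"

lemma compact_pairs_k: "compact (pairs_k k)"
proof -
  have "pairs_k k = {x. 0 \<le> fst x} \<inter> {x. fst x + 1 / (real k + 1) \<le> snd x} \<inter> {x. snd x \<le> T - 1 / (real k + 1)}"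
    by (auto simp: pairs_k_def)
  moreover have "closed \<dots>" by (intro closed_Int closed_Collect_le continuous_intros)
  moreover have "pairs_k k \<subseteq> cbox (0, 0) (T, T)"
  proof
    fix x assume "x \<in> pairs_k k"
    moreover have "0 < 1 / (real k + 1)" by simp
    ultimately have "0 \<le> fst x" "fst x \<le> T" "0 \<le> snd x" "snd x \<le> T" unfolding pairs_k_def mem_Collect_eq by linarith+
    then show "x \<in> cbox (0, 0) (T, T)" by (cases x) (simp add: cbox_Pair_eq)
  qed
  ultimately show ?thesis using bounded_subset[OF bounded_cbox] compact_eq_bounded_closed by metis
qed

lemma pairs_k_Union: "(\<Union>k. pairs_k k) = pairs"
proof (intro equalityI subsetI)
  fix x assume "x \<in> (\<Union>k. pairs_k k)"
  then obtain k where "x \<in> pairs_k k" by blast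
  moreover have "0 < 1 / (real k + 1)" by simp
  ultimately have "0 \<le> fst x" "fst x < snd x" "snd x < T" unfolding pairs_k_def mem_Collect_eq by linarith+
  then show "x \<in> pairs" by (auto simp: pairs_def)
next
  fix x assume "x \<in> pairs"
  then have x: "0 \<le> fst x" "fst x < snd x" "snd x < T" by (auto simp: pairs_def)
  then obtain k where k: "1 / real (Suc k) < min (snd x - fst x) (T - snd x)"
    using nat_approx_posE[of "min (snd x - fst x) (T - snd x)"] by auto
  then have "1 / (real k + 1) \<le> snd x - fst x" "1 / (real k + 1) \<le> T - snd x" by (simp_all add: add.commute)
  then have "x \<in> pairs_k k" using x(1) unfolding pairs_k_def mem_Collect_eq by linarith
  then show "x \<in> (\<Union>k. pairs_k k)" by blast
qed

end

section \<open>Boundary angles and the measure on the set of chords\<close>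

lemma angle_cot:
  assumes f: "orthonormal_frame K p v n" and w: "tangent K p w" "qform K w w = 1" "0 < qform K w n"
  shows "cot (angleK K v w) = qform K w v / qform K w n"
proof -
  define A B where "A = qform K w v" and "B = qform K w n"
  have "A\<^sup>2 + B\<^sup>2 = 1"
    using frame_qform[OF f w(1,1)] w(2) by (simp add: A_def B_def power2_eq_square)
  then have B: "1 - A\<^sup>2 = B\<^sup>2" by simp
  have B0: "0 < B" using w(3) by (simp add: B_def)
  then have "A\<^sup>2 < 1" using B zero_less_power[of B 2] by linarith
  then have A: "-1 < A" "A < 1" by (simp_all add: abs_square_less_1 abs_less_iff)
  have "angleK K v w = arccos A"
    using orthonormal_frameD(6)[OF f] w(2) by (simp add: angleK_def A_def qform_commute[of K v w])
  moreover have "sqrt (1 - A\<^sup>2) = B" unfolding B using B0 by simp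
  ultimately show ?thesis using A by (simp add: cot_def sin_arccos A_def B_def)
qed

section \<open>Cotangents of the boundary angles\<close>

context smooth_domain
begin

lemma rho_swap:
  "Q t s = Q s t" "rho t s = rho s t" "S t s = S s t" "rho1 t s = rho2 s t" "rho2 t s = rho1 s t" "J t s = J s t"
proof -
  show Q: "Q t s = Q s t" by (simp add: Q_def qform_def algebra_simps)
  show "rho t s = rho s t" and S: "S t s = S s t" by (simp_all add: rho_def S_def Q)
  have "qform K (c t - c s) x = - qform K (c s - c t) x" for x by (simp add: qform_linear)
  then show "rho1 t s = rho2 s t" "rho2 t s = rho1 s t" by (simp_all add: rho1_def rho2_def S)
  have "cross3 (c t) (c s) = - cross3 (c s) (c t)" by (rule cross_skew)
  then show "J t s = J s t" by (simp add: J_def S mult.commute)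
qed

text \<open>In the frames at the two endpoints the unit boundary directions have components
  \<open>A\<close>, \<open>B\<close> and \<open>A'\<close>, \<open>B'\<close>, with cotangents
  \<open>A / B\<close> and \<open>A' / B'\<close>. Then \<open>k * rho1 s t = - A\<close>,
  \<open>k' * rho2 s t = - A'\<close> and \<open>k * k' * J s t = - (B * B') / sinK K r\<close>; the
  scaling factors cancel. Transversality, that is \<open>B > 0\<close> and \<open>B' > 0\<close>,
  makes \<open>J\<close> nonzero.\<close>

lemma chord_angle_identity:
  assumes ne: "c s \<noteq> c t" and f: "orthonormal_frame K (c s) v n" and r: "0 < r" "short K r" "c t = geod K (c s) v r"
    and w: "w = k *\<^sub>R c' s" "qform K w w = 1" "0 < qform K w n"
    and w': "w' = k' *\<^sub>R c' t" "qform K w' w' = 1" "0 < qform K w' n"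
  shows "J s t \<noteq> 0"
    "sinK K r * cot (angleK K v w) * cot (angleK K (- geod_vel K (c s) v r) w') * J s t = - (rho1 s t * rho2 s t)"
proof -
  note fD = orthonormal_frameD[OF f]
  define u where "u = geod_vel K (c s) v r"
  have fu: "orthonormal_frame K (c t) u n" using orthonormal_frame_geod[OF f, of r] by (simp add: r(3) u_def)
  then have fu': "orthonormal_frame K (c t) (- u) n"
    using unit_tangent_minus by (auto simp: orthonormal_frame_def qform_linear)
  have tw: "tangent K (c s) w" "tangent K (c t) w'" unfolding w(1) w'(1) by (intro tangent_scaleR c'_tangent)+
  have sr: "0 < sinK K r" by (rule sinK_pos[OF r(1,2)])
  have Ssr: "S s t = sinK K r"
  proof -
    have "Q s t = 4 * (sinK K (r / 2))\<^sup>2" unfolding Q_def r(3) by (rule chord_qform_0[OF fD(1)])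
    then show ?thesis using Q_of_dist(2)[OF r(1,2)] by (simp add: S_def)
  qed
  define A B A' B' where "A = qform K w v" and "B = qform K w n" and "A' = qform K w' (- u)" and "B' = qform K w' n"
  define d where "d = cross3 (c s) v \<bullet> n"
  have d2: "d * d = vol2 K" using frame_det_squared[OF f] by (simp add: d_def power2_eq_square)
  have B: "0 < B" "0 < B'" using w w' by (simp_all add: B_def B'_def)
  have k: "k \<noteq> 0" "k' \<noteq> 0" using w(2) w'(2) by (auto simp: w(1) w'(1) qform_def)
  have cot: "cot (angleK K v w) = A / B" "cot (angleK K (- u) w') = A' / B'"
    unfolding A_def B_def A'_def B'_def by (rule angle_cot[OF f tw(1) w(2,3)] angle_cot[OF fu' tw(2) w'(2,3)])+
  have N: "cross3 (c s) (c t) = sinK K r *\<^sub>R cross3 (c s) v"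
    by (simp add: r(3) geod_def cross_add_right cross_mult_right)
  have N1: "cross3 (c s) (c t) \<bullet> w = sinK K r * (B * d)"
  proof -
    have "w = 0 *\<^sub>R c s + A *\<^sub>R v + B *\<^sub>R n" using frame_tangent_expansion[OF f tw(1)] by (simp add: A_def B_def)
    then have "cross3 (c s) v \<bullet> w = B * d" using cross3_frame[of "c s" v 0 A B n] by (simp add: d_def)
    then show ?thesis by (simp add: N)
  qed
  have N2: "cross3 (c s) (c t) \<bullet> w' = sinK K r * (B' * d)"
  proof -
    have "w' = 0 *\<^sub>R c t + qform K w' u *\<^sub>R u + B' *\<^sub>R n" using frame_tangent_expansion[OF fu tw(2)] by (simp add: B'_def)
    then have "cross3 (c t) u \<bullet> w' = B' * (cross3 (c t) u \<bullet> n)" using cross3_frame[of "c t" u 0 "qform K w' u" B' n] by simp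
    moreover have "cross3 (c t) u = cross3 (c s) v" unfolding r(3) u_def by (rule cross3_geod[OF fD(1)])
    ultimately have "cross3 (c s) v \<bullet> w' = B' * d" by (simp add: d_def)
    then show ?thesis by (simp add: N)
  qed
  have kJ: "k * k' * J s t = - (B * B') / sinK K r"
  proof -
    have "k * k' * J s t = - (cross3 (c s) (c t) \<bullet> w) * (cross3 (c s) (c t) \<bullet> w') / (vol2 K * sinK K r ^ 3)"
      by (simp add: J_def w(1) w'(1) Ssr)
    also have "\<dots> = - (B * B') * (d * d) * (sinK K r)\<^sup>2 / (vol2 K * sinK K r ^ 3)"
      by (simp add: N1 N2 power2_eq_square)
    also have "\<dots> = - (B * B') / sinK K r"
      unfolding d2 using sr vol2_pos[of K] by (simp add: power2_eq_square power3_eq_cube)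
    finally show ?thesis .
  qed
  have k1: "k * rho1 s t = - A"
  proof -
    have "c s - c t = (1 - cosK K r) *\<^sub>R c s - sinK K r *\<^sub>R v" by (simp add: r(3) geod_def algebra_simps)
    then have "qform K (c s - c t) w = (1 - cosK K r) * qform K (c s) w - sinK K r * A"
      by (simp add: qform_linear A_def qform_commute[of K v w])
    also have "(1 - cosK K r) * qform K (c s) w = 0"
      using tangent_qform[OF tw(1)] by (cases "K = 0") (simp_all add: cosK_def)
    finally show ?thesis using sr by (simp add: rho1_def Ssr w(1) qform_linear field_simps)
  qed
  have k2: "k' * rho2 s t = - A'"
  proof -
    \<comment> \<open>Seen from the second endpoint the first one lies backwards along the chord,
      which is why \<open>A'\<close> is taken with respect to \<open>- u\<close>.\<close>
    have "c s = geod K (c t) u (- r)" unfolding r(3) u_def geod_geod by simp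
    then have "c s - c t = (cosK K r - 1) *\<^sub>R c t - sinK K r *\<^sub>R u" by (simp add: geod_def algebra_simps)
    then have "qform K (c s - c t) w' = (cosK K r - 1) * qform K (c t) w' + sinK K r * A'"
      by (simp add: qform_linear A'_def qform_commute[of K u w'])
    also have "(cosK K r - 1) * qform K (c t) w' = 0"
      using tangent_qform[OF tw(2)] by (cases "K = 0") (simp_all add: cosK_def)
    finally show ?thesis using sr by (simp add: rho2_def Ssr w'(1) qform_linear field_simps)
  qed
  have "k * k' * J s t \<noteq> 0" unfolding kJ using B sr by simp
  then show "J s t \<noteq> 0" by simp
  have "k * k' * (sinK K r * (A / B) * (A' / B') * J s t) = sinK K r * (A / B) * (A' / B') * (k * k' * J s t)" by simp
  also have "\<dots> = - (A * A')" unfolding kJ using B sr by simp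
  also have "\<dots> = k * k' * (- (rho1 s t * rho2 s t))"
  proof -
    have "k * k' * (- (rho1 s t * rho2 s t)) = - ((k * rho1 s t) * (k' * rho2 s t))" by simp
    then show ?thesis unfolding k1 k2 by simp
  qed
  finally have E: "k * k' * (sinK K r * (A / B) * (A' / B') * J s t) = k * k' * (- (rho1 s t * rho2 s t))" .
  have "k * k' \<noteq> 0" using k by simp
  from mult_left_cancel[OF this, THEN iffD1, OF E]
  show "sinK K r * cot (angleK K v w) * cot (angleK K (- geod_vel K (c s) v r) w') * J s t = - (rho1 s t * rho2 s t)"
    unfolding u_def[symmetric] cot .
qed

text \<open>\<open>curve_direction\<close> names a boundary point but not its parameter; parameters
  of the same point differ by periods.\<close>

lemma c'_cong: assumes "c s = c t" shows "c' s = c' t"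
proof -
  obtain k where k: "0 \<le> s + real_of_int k * T" "s + real_of_int k * T < T" using period_reduce .
  obtain l where l: "0 \<le> t + real_of_int l * T" "t + real_of_int l * T < T" using period_reduce .
  have "c (s + real_of_int k * T) = c (t + real_of_int l * T)" using period_int assms by simp
  then have "s + real_of_int k * T = t + real_of_int l * T" using inj_onD[OF c_inj] k l by simp
  then show ?thesis using period_int by metis
qed

text \<open>The chord in \<open>chord_angles\<close> may run in either direction. The identity is
  symmetric under exchange of the endpoints by \<open>rho_swap\<close>.\<close>

lemma chord_angles_identity:
  assumes x: "x \<in> pairs" and a: "chord_angles K D c (chord_line x) a b"
  shows "J (fst x) (snd x) \<noteq> 0"
    "sinK K (rho (fst x) (snd x)) * cot a * cot b * J (fst x) (snd x) = - (rho1 (fst x) (snd x) * rho2 (fst x) (snd x))"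
proof -
  obtain p v r n w w' where ch: "is_chord K D (chord_line x) p v r" "0 < r" and f: "orthonormal_frame K p v n"
    and w: "curve_direction K c p w" "0 < qform K w n" and w': "curve_direction K c (geod K p v r) w'" "0 < qform K w' n"
    and ab: "a = angleK K v w" "b = angleK K (- geod_vel K p v r) w'"
    using a unfolding chord_angles_def by blast
  note cD = is_chordD[OF ch(1)]
  obtain s0 k where k: "c s0 = p" "w = k *\<^sub>R c' s0" "qform K w w = 1"
    using w(1) by (auto simp: curve_direction_def c'_def)
  obtain t0 k' where k': "c t0 = geod K p v r" "w' = k' *\<^sub>R c' t0" "qform K w' w' = 1"
    using w'(1) by (auto simp: curve_direction_def c'_def)
  have rr: "rho (fst x) (snd x) = r"
    using chord_length_eq[OF ch(1)] chord_length_eq[OF chord_line_is_chord(1)[OF x]] by simp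
  have "p \<in> chord_line x" "geod K p v r \<in> chord_line x"
    unfolding cD(2) geodesic_line_def using rangeI[of "geod K p v" 0] by auto
  then have e: "p = c (fst x) \<or> p = c (snd x)" "geod K p v r = c (fst x) \<or> geod K p v r = c (snd x)"
    using boundary_of_chord[OF chord_line_is_chord(1)[OF x]] c_boundary k(1) k'(1) chord_line_is_chord(3)[OF x] by metis+
  have ne: "p \<noteq> geod K p v r" using geod_neq[OF cD(1) ch(2)] cD(4) by simp
  have main: "J s t \<noteq> 0 \<and> sinK K r * cot a * cot b * J s t = - (rho1 s t * rho2 s t)"
    if st: "p = c s" "geod K p v r = c t" for s t
  proof -
    have cc: "c' s0 = c' s" "c' t0 = c' t"
      using c'_cong[OF trans[OF k(1) st(1)]] c'_cong[OF trans[OF k'(1) st(2)]] .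
    have "c s \<noteq> c t" "orthonormal_frame K (c s) v n" "c t = geod K (c s) v r" "w = k *\<^sub>R c' s" "w' = k' *\<^sub>R c' t"
      using ne f k(2) k'(2) unfolding st(2)[symmetric] cc[symmetric] by (simp_all add: st(1)[symmetric])
    from chord_angle_identity[OF this(1,2) ch(2) cD(4) this(3,4) k(3) w(2) this(5) k'(3) w'(2)]
    show ?thesis unfolding ab st(1) by blast
  qed
  have "(p = c (fst x) \<and> geod K p v r = c (snd x)) \<or> (p = c (snd x) \<and> geod K p v r = c (fst x))" using e ne by metis
  then have "J (fst x) (snd x) \<noteq> 0 \<and> sinK K r * cot a * cot b * J (fst x) (snd x) = - (rho1 (fst x) (snd x) * rho2 (fst x) (snd x))"
    using main[of "fst x" "snd x"] main[of "snd x" "fst x"] rho_swap[of "fst x" "snd x"] by (auto simp: mult.commute)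
  then show "J (fst x) (snd x) \<noteq> 0"
    "sinK K (rho (fst x) (snd x)) * cot a * cot b * J (fst x) (snd x) = - (rho1 (fst x) (snd x) * rho2 (fst x) (snd x))"
    unfolding rr by blast+
qed

end

section \<open>Transfer of the invariant measure to pairs of boundary parameters\<close>

locale measured_domain = smooth_domain +
  fixes \<mu> :: "(real^3) set measure"
  assumes measure: "invariant_geodesic_measure K \<mu>"
begin

lemma sets_mu: "sets \<mu> = borel_geodesic_sets K" and space_mu: "space \<mu> = geodesics K"
  using measure by (auto simp: invariant_geodesic_measure_def)

lemma crossing_measure:
  assumes "orthonormal_frame K p v n" "0 < m" "K > 0 \<longrightarrow> m \<le> pi / sqrt K" "A \<in> sets \<mu>"
    "A \<subseteq> crossing_geodesic K p v n ` ({0<..<m} \<times> {0<..<pi})"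
  shows "emeasure \<mu> A = (\<integral>\<^sup>+ x \<in> {0<..<m} \<times> {0<..<pi}.
      ennreal (sin (snd x)) * indicator A (crossing_geodesic K p v n x) \<partial>lborel)"
  using measure assms unfolding invariant_geodesic_measure_def by blast

text \<open>Induction over the sigma-algebra generated by the closed sets, which are exhausted by
  compact pieces; the step for complements rests on injectivity of
  \<open>chord_line\<close>.\<close>

lemma chord_line_image_sets:
  assumes "E \<in> sets borel" shows "chord_line ` (E \<inter> pairs) \<in> sets \<mu>"
proof -
  have "E \<in> sigma_sets UNIV {S. closed S}" using assms by (simp add: borel_eq_closed)
  then show ?thesis
  proof (induction E)
    case (Basic S)
    then have "closed S" by simp
    have "chord_line ` (S \<inter> pairs) = (\<Union>k. chord_line ` (S \<inter> pairs_k k))" by (auto simp: pairs_k_Union[symmetric])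
    moreover have "chord_line ` (S \<inter> pairs_k k) \<in> sets \<mu>" for k
      unfolding sets_mu using \<open>closed S\<close> compact_pairs_k pairs_k_Union
      by (intro chord_line_compact_image closed_Int_compact) auto
    ultimately show ?case by auto
  next
    case (Compl S)
    have "chord_line ` (pairs_k k) \<in> sets \<mu>" for k
      unfolding sets_mu using compact_pairs_k pairs_k_Union by (intro chord_line_compact_image) auto
    then have "chord_line ` pairs \<in> sets \<mu>" unfolding pairs_k_Union[symmetric] image_UN by auto
    moreover have "chord_line ` ((UNIV - S) \<inter> pairs) = chord_line ` pairs - chord_line ` (S \<inter> pairs)"
      using chord_line_inj by (auto simp: inj_on_def)
    ultimately show ?case using Compl by auto
  next
    case (Union a)
    have "chord_line ` ((\<Union>i. a i) \<inter> pairs) = (\<Union>i. chord_line ` (a i \<inter> pairs))" by auto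
    then show ?case using Union by auto
  qed simp
qed

definition chords :: "(real^3) set set" where "chords = chord_line ` pairs"

lemma chords_sets: "chords \<in> sets \<mu>"
  using chord_line_image_sets[of UNIV] by (simp add: chords_def)

lemma meeting_sets: "geodesics_meeting K D \<in> sets \<mu>"
  using geodesics_meeting_borel by (simp add: sets_mu)

lemma chords_meeting: "chords \<subseteq> geodesics_meeting K D"
  using chord_line_meeting by (auto simp: chords_def)

definition pair_measure :: "(real \<times> real) measure" where
  "pair_measure = density (restrict_space lborel pairs) (\<lambda>x. ennreal (J (fst x) (snd x)))"

lemma J_measurable: "(\<lambda>x. J (fst x) (snd x)) \<in> borel_measurable (restrict_space lborel pairs)"
proof -
  have "(\<lambda>x. J (fst x) (snd x)) \<in> borel_measurable (restrict_space borel pairs)"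
    by (rule borel_measurable_continuous_on_restrict[OF J_continuous])
  then show ?thesis by (simp cong: measurable_cong_sets add: sets_restrict_space)
qed

lemma space_pairs_measure: "space pair_measure = pairs"
  by (simp add: pair_measure_def space_restrict_space)

lemma sets_pairs_measure_iff: "E \<in> sets pair_measure \<longleftrightarrow> E \<in> sets borel \<and> E \<subseteq> pairs"
  by (auto simp: pair_measure_def sets_restrict_space_iff)

lemma chord_line_measurable: "chord_line \<in> measurable pair_measure (restrict_space \<mu> chords)"
proof (rule measurableI)
  fix x assume "x \<in> space pair_measure"
  then show "chord_line x \<in> space (restrict_space \<mu> chords)"
    using chord_line_geodesic by (auto simp: space_pairs_measure space_restrict_space chords_def space_mu)
next
  fix A assume "A \<in> sets (restrict_space \<mu> chords)"
  then have "A \<in> sets \<mu>" "A \<subseteq> chords" using chords_sets sets.sets_into_space[OF chords_sets] by (auto simp: sets_restrict_space_iff)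
  have "chord_line -` A \<inter> space pair_measure = {x \<in> pairs. chord_line x \<in> A}" by (auto simp: space_pairs_measure)
  then show "chord_line -` A \<inter> space pair_measure \<in> sets pair_measure"
    using chord_line_preimage_borel \<open>A \<in> sets \<mu>\<close> by (auto simp: sets_pairs_measure_iff sets_mu)
qed

text \<open>A quarter of a great circle for \<open>K > 0\<close>, the greatest length permitted by
  the chart of \<open>chart_formula\<close>.\<close>

definition seg_length :: real where "seg_length = (if K > 0 then pi / sqrt K / 2 else 1)"

lemma seg_length_bounds: "0 < seg_length" "short K seg_length" "K > 0 \<longrightarrow> 2 * seg_length \<le> pi / sqrt K" "K > 0 \<longrightarrow> seg_length \<le> pi / sqrt K"
proof -
  define P where "P = pi / sqrt K"
  have "0 < P" if "K > 0" using that by (simp add: P_def)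
  then show "0 < seg_length" "short K seg_length" "K > 0 \<longrightarrow> 2 * seg_length \<le> pi / sqrt K" "K > 0 \<longrightarrow> seg_length \<le> pi / sqrt K"
    unfolding seg_length_def short_def P_def[symmetric] by auto
qed

lemma countable_crossing_lines_cover:
  obtains C :: "nat \<Rightarrow> (real^3) set set"
  where "\<And>i. C i \<in> sets \<mu>" "geodesics K \<subseteq> (\<Union>i. C i)"
    "\<And>i. \<exists>p v n. orthonormal_frame K p v n \<and> C i = crossing_lines K seg_length p v"
proof -
  obtain F where F: "\<And>i::nat. case F i of (p, v, n) \<Rightarrow> orthonormal_frame K p v n"
    "\<And>q w. unit_tangent K q w \<Longrightarrow> \<exists>i. case F i of (p, v, n) \<Rightarrow> (q, w) \<in> crossing_frame K seg_length p v"
    using countable_crossing_cover[OF seg_length_bounds(1,2)] by metis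
  define C where "C = (\<lambda>i. crossing_lines K seg_length (fst (F i)) (fst (snd (F i))))"
  have Cs: "C i \<in> sets \<mu>" for i by (simp add: C_def sets_mu crossing_lines_borel)
  have Ccov: "geodesics K \<subseteq> (\<Union>i. C i)"
  proof
    fix g assume "g \<in> geodesics K"
    then obtain q w where g: "g = geodesic_line K q w" "unit_tangent K q w" by (auto simp: geodesics_def)
    then obtain i where "(q, w) \<in> crossing_frame K seg_length (fst (F i)) (fst (snd (F i)))" using F(2) by (force simp: case_prod_beta)
    then show "g \<in> (\<Union>i. C i)" using g by (auto simp: C_def crossing_lines_iff)
  qed
  have Cf: "\<exists>p v n. orthonormal_frame K p v n \<and> C i = crossing_lines K seg_length p v" for i
    using F(1)[of i] unfolding C_def by (cases "F i") auto
  show thesis by (rule that[OF Cs Ccov Cf])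
qed

text \<open>On lines crossing one fixed segment both sides are known: the normalization of the
  measure gives one, \<open>chart_formula\<close> the other.\<close>

lemma local_measure:
  assumes f: "orthonormal_frame K p v n" and A: "A \<in> sets \<mu>" "A \<subseteq> crossing_lines K seg_length p v" "A \<subseteq> chords"
  shows "emeasure \<mu> A = emeasure (distr pair_measure (restrict_space \<mu> chords) chord_line) A"
proof -
  have sub: "A \<subseteq> crossing_geodesic K p v n ` ({0<..<seg_length} \<times> {0<..<pi})"
  proof
    fix g assume "g \<in> A"
    then have "g \<in> crossing_lines K seg_length p v" using A by blast
    then show "g \<in> crossing_geodesic K p v n ` ({0<..<seg_length} \<times> {0<..<pi})"
      using crossing_frame_crosses[OF f seg_length_bounds(1)] by (auto simp: crossing_lines_def)
  qed
  have V: "{x \<in> pairs. chord_line x \<in> A} \<in> sets borel" using chord_line_preimage_borel A by (simp add: sets_mu)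
  have "A \<in> sets (restrict_space \<mu> chords)" using A chords_sets sets.sets_into_space[OF chords_sets]
    by (simp add: sets_restrict_space_iff Int_absorb2)
  then have "emeasure (distr pair_measure (restrict_space \<mu> chords) chord_line) A
      = emeasure pair_measure (chord_line -` A \<inter> space pair_measure)"
    by (rule emeasure_distr[OF chord_line_measurable])
  also have "chord_line -` A \<inter> space pair_measure = {x \<in> pairs. chord_line x \<in> A}" by (auto simp: space_pairs_measure)
  also have "emeasure pair_measure \<dots> = (\<integral>\<^sup>+ x. ennreal (J (fst x) (snd x)) * indicator {x \<in> pairs. chord_line x \<in> A} x \<partial>(restrict_space lborel pairs))"
    unfolding pair_measure_def using J_measurable V by (intro emeasure_density) (auto simp: sets_restrict_space_iff)
  also have "\<dots> = (\<integral>\<^sup>+ x. ennreal (J (fst x) (snd x)) * indicator {x \<in> pairs. chord_line x \<in> A} x * indicator pairs x \<partial>lborel)"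
    by (rule nn_integral_restrict_space) simp
  also have "\<dots> = (\<integral>\<^sup>+ x. ennreal (indicator {x \<in> pairs. chord_line x \<in> A} x * J (fst x) (snd x)) \<partial>lborel)"
    by (intro nn_integral_cong) (auto simp: indicator_def)
  also have "\<dots> = (\<integral>\<^sup>+ x \<in> {0<..<seg_length} \<times> {0<..<pi}. ennreal (sin (snd x)) * indicator A (crossing_geodesic K p v n x) \<partial>lborel)"
    using chart_formula[OF f seg_length_bounds(1,3) _ sub] A by (simp add: sets_mu chords_def)
  also have "\<dots> = emeasure \<mu> A" using crossing_measure[OF f seg_length_bounds(1,4) A(1) sub] by simp
  finally show ?thesis by simp
qed

text \<open>The normalization speaks about one segment at a time. Countably many segments see all
  geodesics, so a measurable set of chords is cut into disjoint pieces, each crossing a single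
  segment.\<close>

lemma chords_measure: "restrict_space \<mu> chords = distr pair_measure (restrict_space \<mu> chords) chord_line"
proof (rule measure_eqI)
  obtain C where Cs: "\<And>i::nat. C i \<in> sets \<mu>" and Ccov: "geodesics K \<subseteq> (\<Union>i. C i)"
    and Cf: "\<And>i. \<exists>p v n. orthonormal_frame K p v n \<and> C i = crossing_lines K seg_length p v"
    using countable_crossing_lines_cover by blast
  fix A assume "A \<in> sets (restrict_space \<mu> chords)"
  then have A: "A \<in> sets \<mu>" "A \<subseteq> chords" using chords_sets sets.sets_into_space[OF chords_sets] by (auto simp: sets_restrict_space_iff)
  define \<nu> where "\<nu> = distr pair_measure (restrict_space \<mu> chords) chord_line"
  define B where "B = (\<lambda>i. A \<inter> disjointed C i)"
  have Bs: "B i \<in> sets \<mu>" for i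
    unfolding B_def using A(1) sets.range_disjointed_sets[of C \<mu>] Cs by auto
  have BC: "B i \<subseteq> C i" "B i \<subseteq> chords" for i using disjointed_subset[of C i] A by (auto simp: B_def)
  have disj: "disjoint_family B" using disjoint_family_disjointed[of C] by (auto simp: B_def disjoint_family_on_def)
  have UB: "(\<Union>i. B i) = A"
  proof -
    have "A \<subseteq> (\<Union>i. C i)" using A Ccov sets.sets_into_space[OF A(1)] by (auto simp: space_mu)
    then show ?thesis unfolding B_def using UN_disjointed_eq[of C] by auto
  qed
  have Br: "range B \<subseteq> sets \<nu>"
    using Bs BC(2) chords_sets sets.sets_into_space[OF chords_sets] by (auto simp: \<nu>_def sets_restrict_space_iff Int_absorb2)
  have "emeasure (restrict_space \<mu> chords) A = emeasure \<mu> A"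
    using A chords_sets sets.sets_into_space[OF chords_sets] by (intro emeasure_restrict_space) (auto simp: Int_absorb2)
  also have "\<dots> = (\<Sum>i. emeasure \<mu> (B i))"
    using suminf_emeasure[OF _ disj, of \<mu>] Bs UB by (simp add: image_subset_iff)
  also have "\<dots> = (\<Sum>i. emeasure \<nu> (B i))"
  proof -
    have "emeasure \<mu> (B i) = emeasure \<nu> (B i)" for i
    proof -
      obtain p v n where f: "orthonormal_frame K p v n" "C i = crossing_lines K seg_length p v" using Cf by blast
      show ?thesis unfolding \<nu>_def using BC(1)[of i] unfolding f(2) by (rule local_measure[OF f(1) Bs _ BC(2)])
    qed
    then show ?thesis by simp
  qed
  also have "\<dots> = emeasure \<nu> A" using suminf_emeasure[OF Br disj] UB by simp
  finally show "emeasure (restrict_space \<mu> chords) A = emeasure (distr pair_measure (restrict_space \<mu> chords) chord_line) A"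
    by (simp add: \<nu>_def)
qed simp

lemma touching_null: "geodesics_meeting K D - chords \<in> null_sets \<mu>"
proof -
  obtain C where Cs: "\<And>i::nat. C i \<in> sets \<mu>" and Ccov: "geodesics K \<subseteq> (\<Union>i. C i)"
    and Cf: "\<And>i. \<exists>p v n. orthonormal_frame K p v n \<and> C i = crossing_lines K seg_length p v"
    using countable_crossing_lines_cover by blast
  define Z where "Z = geodesics_meeting K D - chords"
  have Zs: "Z \<in> sets \<mu>" unfolding Z_def using meeting_sets chords_sets by auto
  have null: "Z \<inter> C i \<in> null_sets \<mu>" for i
  proof -
    obtain p v n where f: "orthonormal_frame K p v n" and Ci: "C i = crossing_lines K seg_length p v" using Cf by blast
    have v: "unit_tangent K p v" using orthonormal_frameD(1)[OF f] .
    have s: "Z \<inter> C i \<in> sets \<mu>" using Zs Cs by auto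
    have sub: "Z \<inter> C i \<subseteq> crossing_geodesic K p v n ` ({0<..<seg_length} \<times> {0<..<pi})"
    proof
      fix g assume "g \<in> Z \<inter> C i"
      then have "g \<in> crossing_lines K seg_length p v" by (simp add: Ci)
      then show "g \<in> crossing_geodesic K p v n ` ({0<..<seg_length} \<times> {0<..<pi})"
        using crossing_frame_crosses[OF f seg_length_bounds(1)] by (auto simp: crossing_lines_def)
    qed
    define E where "E = {x \<in> {0<..<seg_length} \<times> {0<..<pi}. crossing_geodesic K p v n x \<in> Z \<inter> C i}"
    have Eb: "E \<in> sets borel"
      unfolding E_def using s by (intro crossing_preimage_borel[OF _ f]) (auto simp: sets_mu intro!: borel_open open_Times)
    \<comment> \<open>The exceptional crossing points: those on the boundary of \<open>D\<close> or
      antipodal to it. At any other point of the segment the slice of angles is finite, hence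
      null.\<close>
    define X where "X = {l \<in> {0<..<seg_length}. geod K p v l \<in> boundaryK K D} \<union> {l \<in> {0<..<seg_length}. - geod K p v l \<in> boundaryK K D}"
    have "finite X" unfolding X_def
      using finite_boundary_on_geodesic[OF v seg_length_bounds(2)] finite_antipodal_boundary_on_geodesic[OF v seg_length_bounds(2)] by simp
    have slice: "emeasure lborel (Pair l -` E) = 0" if l: "l \<notin> X" for l
    proof (cases "0 < l \<and> l < seg_length")
      case True
      have "Pair l -` E \<subseteq> {a \<in> {0<..<pi}. \<exists>y. geodesic_line K (geod K p v l)
          (cos a *\<^sub>R geod_vel K p v l + sin a *\<^sub>R n) \<inter> D = {y}}"
      proof
        fix a assume "a \<in> Pair l -` E"
        then have a: "a \<in> {0<..<pi}" "crossing_geodesic K p v n (l, a) \<in> Z" by (auto simp: E_def)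
        then show "a \<in> {a \<in> {0<..<pi}. \<exists>y. geodesic_line K (geod K p v l)
          (cos a *\<^sub>R geod_vel K p v l + sin a *\<^sub>R n) \<inter> D = {y}}"
          using chord_line_cases[of "crossing_geodesic K p v n (l, a)"]
          by (auto simp: Z_def chords_def crossing_geodesic_def)
      qed
      moreover have "finite {a \<in> {0<..<pi}. \<exists>y. geodesic_line K (geod K p v l)
          (cos a *\<^sub>R geod_vel K p v l + sin a *\<^sub>R n) \<inter> D = {y}}"
        using l True by (intro finite_touching_through orthonormal_frame_geod[OF f]) (auto simp: X_def)
      ultimately have "finite (Pair l -` E)" by (rule finite_subset)
      then show ?thesis by (intro emeasure_lborel_countable countable_finite)
    next
      case False
      then have "Pair l -` E = {}" by (auto simp: E_def)
      then show ?thesis by simp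
    qed
    have "emeasure (lborel \<Otimes>\<^sub>M lborel) E = (\<integral>\<^sup>+ l. emeasure lborel (Pair l -` E) \<partial>lborel)"
      using Eb by (intro lborel.emeasure_pair_measure_alt) (simp only: lborel_prod sets_lborel)
    also have "\<dots> = (\<integral>\<^sup>+ l. 0 \<partial>(lborel :: real measure))"
    proof (rule nn_integral_cong_AE)
      have "X \<in> null_sets lborel" using \<open>finite X\<close> by (intro finite_imp_null_set_lborel)
      then have "AE l in lborel. l \<notin> X" by (rule AE_not_in)
      then show "AE l in lborel. emeasure lborel (Pair l -` E) = 0" by eventually_elim (rule slice)
    qed
    finally have "E \<in> null_sets lborel" using Eb by (simp add: lborel_prod null_sets_def)
    then have "AE x in lborel. x \<notin> E" by (rule AE_not_in)
    then have "(\<integral>\<^sup>+ x \<in> {0<..<seg_length} \<times> {0<..<pi}. ennreal (sin (snd x)) * indicator (Z \<inter> C i) (crossing_geodesic K p v n x) \<partial>lborel)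
        = (\<integral>\<^sup>+ x. 0 \<partial>(lborel :: (real \<times> real) measure))"
      by (intro nn_integral_cong_AE) (auto simp: E_def indicator_def elim!: eventually_mono)
    then have "emeasure \<mu> (Z \<inter> C i) = 0" using crossing_measure[OF f seg_length_bounds(1,4) s sub] by simp
    then show ?thesis using s by (simp add: null_sets_def)
  qed
  have "(\<Union>i. Z \<inter> C i) \<in> null_sets \<mu>" by (intro null_sets_UN null)
  moreover have "(\<Union>i. Z \<inter> C i) = Z"
    using Ccov sets.sets_into_space[OF Zs] by (auto simp: space_mu)
  ultimately show ?thesis by (simp add: Z_def)
qed

text \<open>Integrals over lines become integrals over pairs. The touching lines form a null set,
  but completeness of the measure is not given; the constant value \<open>a\<close> on them provides
  measurability there.\<close>

lemma chords_integral:
  fixes g :: "(real^3) set \<Rightarrow> real" and h :: "real \<times> real \<Rightarrow> real"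
  assumes gh: "\<And>x. x \<in> pairs \<Longrightarrow> g (chord_line x) = h x" and h: "continuous_on pairs h"
    and i: "set_integrable lborel pairs (\<lambda>x. h x * J (fst x) (snd x))"
    and z: "\<And>\<gamma>. \<gamma> \<in> geodesics_meeting K D - chords \<Longrightarrow> g \<gamma> = a"
  shows "set_integrable \<mu> (geodesics_meeting K D) g"
    "(LINT \<gamma>:geodesics_meeting K D|\<mu>. g \<gamma>) = (LINT x:pairs|lborel. h x * J (fst x) (snd x))"
proof -
  define \<nu> where "\<nu> = restrict_space \<mu> chords"
  have hm: "h \<in> borel_measurable (restrict_space lborel pairs)"
  proof -
    have "h \<in> borel_measurable (restrict_space borel pairs)" by (rule borel_measurable_continuous_on_restrict[OF h])
    then show ?thesis by (simp cong: measurable_cong_sets add: sets_restrict_space)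
  qed
  have gm: "g \<in> borel_measurable \<nu>"
  proof (rule measurableI)
    fix B :: "real set" assume B: "B \<in> sets borel"
    \<comment> \<open>Measurability of \<open>g\<close> itself, not only of its composite with
      \<open>chord_line\<close>: its preimages are images of Borel sets of pairs.\<close>
    have e: "g -` B \<inter> space \<nu> = chord_line ` ((h -` B \<inter> pairs) \<inter> pairs)"
      using gh chord_line_geodesic by (auto simp: \<nu>_def space_restrict_space chords_def space_mu)
    have "h -` B \<inter> space (restrict_space lborel pairs) \<in> sets (restrict_space lborel pairs)" by (rule measurable_sets[OF hm B])
    then have "h -` B \<inter> pairs \<in> sets borel" by (simp add: space_restrict_space sets_restrict_space_iff)
    then have "g -` B \<inter> space \<nu> \<in> sets \<mu>" unfolding e by (rule chord_line_image_sets)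
    then show "g -` B \<inter> space \<nu> \<in> sets \<nu>"
      using chords_sets sets.sets_into_space[OF chords_sets] by (auto simp: \<nu>_def sets_restrict_space_iff space_restrict_space Int_absorb2)
  qed simp
  have \<nu>: "\<nu> = distr pair_measure \<nu> chord_line" unfolding \<nu>_def by (rule chords_measure)
  have Lm: "chord_line \<in> measurable pair_measure \<nu>" unfolding \<nu>_def by (rule chord_line_measurable)
  have gL: "(\<lambda>x. g (chord_line x)) \<in> borel_measurable (restrict_space lborel pairs)"
  proof -
    have "(\<lambda>x. g (chord_line x)) \<in> borel_measurable (restrict_space lborel pairs) \<longleftrightarrow> h \<in> borel_measurable (restrict_space lborel pairs)"
      by (rule measurable_cong) (simp add: space_restrict_space gh)
    then show ?thesis using hm by simp
  qed
  have Jnn: "AE x in restrict_space lborel pairs. 0 \<le> J (fst x) (snd x)"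
    using J_nonneg by (intro AE_I2) (auto simp: space_restrict_space pairs_def)
  have P: "pairs \<inter> space lborel \<in> sets lborel" by simp
  have gJ: "indicator pairs x *\<^sub>R (J (fst x) (snd x) *\<^sub>R g (chord_line x)) = indicator pairs x *\<^sub>R (h x * J (fst x) (snd x))" for x
    using gh[of x] by (auto simp: indicator_def)
  have "integrable \<nu> g \<longleftrightarrow> integrable (distr pair_measure \<nu> chord_line) g" using \<nu> by simp
  also have "\<dots> \<longleftrightarrow> integrable pair_measure (\<lambda>x. g (chord_line x))" by (rule integrable_distr_eq[OF Lm gm])
  also have "\<dots> \<longleftrightarrow> integrable (restrict_space lborel pairs) (\<lambda>x. J (fst x) (snd x) *\<^sub>R g (chord_line x))"
    unfolding pair_measure_def by (rule integrable_density[OF gL J_measurable Jnn])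
  also have "\<dots> \<longleftrightarrow> set_integrable lborel pairs (\<lambda>x. h x * J (fst x) (snd x))"
    unfolding integrable_restrict_space[OF P] gJ set_integrable_def ..
  finally have "integrable \<nu> g" using i by simp
  then have i1: "set_integrable \<mu> chords g"
    unfolding \<nu>_def using integrable_restrict_space[of chords \<mu> g] chords_sets by (simp add: set_integrable_def)
  have "(\<integral>x. g x \<partial>\<nu>) = (\<integral>x. g x \<partial>(distr pair_measure \<nu> chord_line))" using \<nu> by simp
  also have "\<dots> = (\<integral>x. g (chord_line x) \<partial>pair_measure)" by (rule integral_distr[OF Lm gm])
  also have "\<dots> = (\<integral>x. J (fst x) (snd x) *\<^sub>R g (chord_line x) \<partial>(restrict_space lborel pairs))"
    unfolding pair_measure_def by (rule integral_density[OF gL J_measurable Jnn])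
  also have "\<dots> = (LINT x:pairs|lborel. h x * J (fst x) (snd x))"
    unfolding integral_restrict_space[OF P] gJ set_lebesgue_integral_def ..
  finally have e1: "(LINT \<gamma>:chords|\<mu>. g \<gamma>) = (LINT x:pairs|lborel. h x * J (fst x) (snd x))"
    unfolding \<nu>_def using integral_restrict_space[of chords \<mu> g] chords_sets by (simp add: set_lebesgue_integral_def)
  define Z where "Z = geodesics_meeting K D - chords"
  have Zn: "Z \<in> null_sets \<mu>" unfolding Z_def by (rule touching_null)
  have "(\<lambda>\<gamma>. indicator Z \<gamma> *\<^sub>R g \<gamma>) = (\<lambda>\<gamma>. indicator Z \<gamma> *\<^sub>R a)"
  proof (rule ext)
    show "indicator Z \<gamma> *\<^sub>R g \<gamma> = indicator Z \<gamma> *\<^sub>R a" for \<gamma>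
      using z[folded Z_def, of \<gamma>] by (cases "\<gamma> \<in> Z") simp_all
  qed
  moreover have "integrable \<mu> (\<lambda>\<gamma>. indicator Z \<gamma> *\<^sub>R a)" using Zn by (intro integrable_indicator) (auto simp: null_setsD2 null_setsD1)
  ultimately have i2: "set_integrable \<mu> Z g" by (simp add: set_integrable_def)
  have e2: "(LINT \<gamma>:Z|\<mu>. g \<gamma>) = 0"
    unfolding set_lebesgue_integral_def using AE_not_in[OF Zn] by (intro integral_eq_zero_AE) (auto elim: eventually_mono)
  have U: "geodesics_meeting K D = chords \<union> Z" "chords \<inter> Z = {}" using chords_meeting by (auto simp: Z_def)
  have "Z \<in> sets \<mu>" using Zn by auto
  show "set_integrable \<mu> (geodesics_meeting K D) g"
    unfolding U(1) by (rule set_integrable_Un[OF i1 i2 chords_sets \<open>Z \<in> sets \<mu>\<close>])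
  show "(LINT \<gamma>:geodesics_meeting K D|\<mu>. g \<gamma>) = (LINT x:pairs|lborel. h x * J (fst x) (snd x))"
    unfolding U(1) set_integral_Un[OF U(2) i1 i2] e1 e2 by simp
qed

end

theorem theorem4:
  fixes K T :: real
    and D :: "(real^3) set"
    and c :: "real \<Rightarrow> real^3"
    and \<mu> :: "(real^3) set measure"
    and \<alpha>\<^sub>1 \<alpha>\<^sub>2 :: "(real^3) set \<Rightarrow> real"
    and f :: "real \<Rightarrow> real"
  assumes "invariant_geodesic_measure K \<mu>"
    and "convex_compact_domain K D"
    and "C1_closed_curve_param (boundaryK K D) c T"
    and "contains_no_geodesic_segment K (boundaryK K D)"
    and "\<And>\<gamma>. \<gamma> \<in> geodesics_meeting K D \<Longrightarrow> chord_length K D \<gamma> > 0 \<Longrightarrow>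
           chord_angles K D c \<gamma> (\<alpha>\<^sub>1 \<gamma>) (\<alpha>\<^sub>2 \<gamma>)"
    and "f C1_differentiable_on UNIV"
  shows "set_integrable \<mu> (geodesics_meeting K D) (\<lambda>\<gamma>. f (chord_length K D \<gamma>)) \<and>
    set_integrable \<mu> (geodesics_meeting K D)
      (\<lambda>\<gamma>. deriv f (chord_length K D \<gamma>) * sinK K (chord_length K D \<gamma>)
            * cot (\<alpha>\<^sub>1 \<gamma>) * cot (\<alpha>\<^sub>2 \<gamma>)) \<and>
    (LINT \<gamma>:geodesics_meeting K D|\<mu>. f (chord_length K D \<gamma>)) =
      (LINT \<gamma>:geodesics_meeting K D|\<mu>.
         deriv f (chord_length K D \<gamma>) * sinK K (chord_length K D \<gamma>)
         * cot (\<alpha>\<^sub>1 \<gamma>) * cot (\<alpha>\<^sub>2 \<gamma>))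
      + f 0 * curve_length K c T \<and>
    (f 0 = 0 \<longrightarrow>
      (LINT \<gamma>:geodesics_meeting K D|\<mu>. f (chord_length K D \<gamma>)) =
        (LINT \<gamma>:geodesics_meeting K D|\<mu>.
           deriv f (chord_length K D \<gamma>) * sinK K (chord_length K D \<gamma>)
           * cot (\<alpha>\<^sub>1 \<gamma>) * cot (\<alpha>\<^sub>2 \<gamma>)))"
proof -
  interpret measured_domain K D c T \<mu>
    by unfold_locales (fact assms)+
  note f = \<open>f C1_differentiable_on UNIV\<close>
  have len: "chord_length K D (chord_line x) = rho (fst x) (snd x)" if "x \<in> pairs" for x
    using chord_length_eq[OF chord_line_is_chord(1)[OF that]] .
  have len0: "chord_length K D \<gamma> = 0" if \<gamma>: "\<gamma> \<in> geodesics_meeting K D - chords" for \<gamma>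
  proof -
    obtain y where "\<gamma> \<inter> D = {y}" using chord_line_cases[of \<gamma>] \<gamma> by (auto simp: chords_def)
    then show ?thesis using chord_length_singleton[of \<gamma> y] \<gamma> by (auto simp: geodesics_meeting_def)
  qed
  have ang: "chord_angles K D c (chord_line x) (\<alpha>\<^sub>1 (chord_line x)) (\<alpha>\<^sub>2 (chord_line x))" if "x \<in> pairs" for x
    using assms(5) chord_line_meeting[OF that] len[OF that] chord_line_is_chord(2)[OF that] by simp
  \<comment> \<open>The second integrand in terms of pairs, solved from
    \<open>chord_angles_identity\<close>. Division by \<open>J\<close> is possible since the angles
    come with boundary directions transversal to the chord.\<close>
  define h2 where "h2 = (\<lambda>x. - (deriv f (rho (fst x) (snd x)) * (rho1 (fst x) (snd x) * rho2 (fst x) (snd x))) / J (fst x) (snd x))"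
  have J0: "J (fst x) (snd x) \<noteq> 0" if "x \<in> pairs" for x using chord_angles_identity(1)[OF that ang[OF that]] .
  have h1c: "continuous_on pairs (\<lambda>x. f (rho (fst x) (snd x)))"
    by (intro continuous_on_compose2[OF f_continuous[OF f] continuous_on_rho2]) auto
  have "continuous_on pairs (\<lambda>x. deriv f (rho (fst x) (snd x)))"
    by (intro continuous_on_compose2[OF deriv_continuous[OF f] continuous_on_rho2]) auto
  then have h2c: "continuous_on pairs h2"
    unfolding h2_def using J0 by (intro continuous_intros rho12_continuous J_continuous) auto
  note pi = pairs_integral[OF f]
  have h2J: "h2 x * J (fst x) (snd x) = - (deriv f (rho (fst x) (snd x)) * (rho1 (fst x) (snd x) * rho2 (fst x) (snd x)))"
    if "x \<in> pairs" for x using J0[OF that] by (simp add: h2_def)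
  have i2: "set_integrable lborel pairs (\<lambda>x. h2 x * J (fst x) (snd x))"
  proof -
    have "set_integrable lborel pairs (\<lambda>x. - (deriv f (rho (fst x) (snd x)) * (rho1 (fst x) (snd x) * rho2 (fst x) (snd x))))"
      using pi(2) by (simp add: set_integrable_def)
    moreover have "set_integrable lborel pairs (\<lambda>x. h2 x * J (fst x) (snd x)) \<longleftrightarrow>
      set_integrable lborel pairs (\<lambda>x. - (deriv f (rho (fst x) (snd x)) * (rho1 (fst x) (snd x) * rho2 (fst x) (snd x))))"
      by (intro set_integrable_cong refl h2J)
    ultimately show ?thesis by blast
  qed
  have e2: "(LINT x:pairs|lborel. h2 x * J (fst x) (snd x)) =
      - (LINT x:pairs|lborel. deriv f (rho (fst x) (snd x)) * (rho1 (fst x) (snd x) * rho2 (fst x) (snd x)))"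
  proof -
    have "(LINT x:pairs|lborel. h2 x * J (fst x) (snd x)) =
      (LINT x:pairs|lborel. - (deriv f (rho (fst x) (snd x)) * (rho1 (fst x) (snd x) * rho2 (fst x) (snd x))))"
      using h2J by (intro set_lebesgue_integral_cong) auto
    then show ?thesis by (simp add: set_lebesgue_integral_def)
  qed
  have g2: "deriv f (chord_length K D (chord_line x)) * sinK K (chord_length K D (chord_line x))
      * cot (\<alpha>\<^sub>1 (chord_line x)) * cot (\<alpha>\<^sub>2 (chord_line x)) = h2 x" if "x \<in> pairs" for x
  proof -
    have "sinK K (rho (fst x) (snd x)) * cot (\<alpha>\<^sub>1 (chord_line x)) * cot (\<alpha>\<^sub>2 (chord_line x))
        = - (rho1 (fst x) (snd x) * rho2 (fst x) (snd x)) / J (fst x) (snd x)"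
      using chord_angles_identity(2)[OF that ang[OF that]] nonzero_eq_divide_eq[OF J0[OF that]]
      by blast
    then have "deriv f (rho (fst x) (snd x)) * (sinK K (rho (fst x) (snd x)) * cot (\<alpha>\<^sub>1 (chord_line x)) * cot (\<alpha>\<^sub>2 (chord_line x))) = h2 x"
      by (simp add: h2_def)
    then show ?thesis unfolding len[OF that] by (simp only: mult.assoc)
  qed
  have 1: "set_integrable \<mu> (geodesics_meeting K D) (\<lambda>\<gamma>. f (chord_length K D \<gamma>))"
    "(LINT \<gamma>:geodesics_meeting K D|\<mu>. f (chord_length K D \<gamma>)) =
      (LINT x:pairs|lborel. f (rho (fst x) (snd x)) * J (fst x) (snd x))"
    \<comment> \<open>Touching lines have chord length 0, so the constant value there is
      \<open>f 0\<close>.\<close>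
    using chords_integral[of "\<lambda>\<gamma>. f (chord_length K D \<gamma>)", OF _ h1c pi(1), of "f 0"] len len0 by simp_all
  have 2: "set_integrable \<mu> (geodesics_meeting K D) (\<lambda>\<gamma>. deriv f (chord_length K D \<gamma>) * sinK K (chord_length K D \<gamma>)
            * cot (\<alpha>\<^sub>1 \<gamma>) * cot (\<alpha>\<^sub>2 \<gamma>))"
    "(LINT \<gamma>:geodesics_meeting K D|\<mu>. deriv f (chord_length K D \<gamma>) * sinK K (chord_length K D \<gamma>)
            * cot (\<alpha>\<^sub>1 \<gamma>) * cot (\<alpha>\<^sub>2 \<gamma>)) = (LINT x:pairs|lborel. h2 x * J (fst x) (snd x))"
    \<comment> \<open>On touching lines the factor \<open>sinK K 0\<close> vanishes, whatever values
      the angle functions take there.\<close>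
    using chords_integral[of "\<lambda>\<gamma>. deriv f (chord_length K D \<gamma>) * sinK K (chord_length K D \<gamma>)
            * cot (\<alpha>\<^sub>1 \<gamma>) * cot (\<alpha>\<^sub>2 \<gamma>)", OF g2 h2c i2, of 0] len0 by simp_all
  have main: "(LINT \<gamma>:geodesics_meeting K D|\<mu>. f (chord_length K D \<gamma>)) =
      (LINT \<gamma>:geodesics_meeting K D|\<mu>. deriv f (chord_length K D \<gamma>) * sinK K (chord_length K D \<gamma>)
         * cot (\<alpha>\<^sub>1 \<gamma>) * cot (\<alpha>\<^sub>2 \<gamma>)) + f 0 * curve_length K c T"
    unfolding 1(2) 2(2) e2 using pi(3) by simp
  then have "f 0 = 0 \<longrightarrow> (LINT \<gamma>:geodesics_meeting K D|\<mu>. f (chord_length K D \<gamma>)) =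
      (LINT \<gamma>:geodesics_meeting K D|\<mu>. deriv f (chord_length K D \<gamma>) * sinK K (chord_length K D \<gamma>)
         * cot (\<alpha>\<^sub>1 \<gamma>) * cot (\<alpha>\<^sub>2 \<gamma>))" by simp
  then show ?thesis using 1(1) 2(1) main by blast
qed

end
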